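(* Let $d \in \mathbb{Z}_{>0}$, $\rho\in[0,1]$ and $\delta>0$. There exists an explicitly computable $D = D(d,\delta)$, which may be taken to be $d^{O(d)}/\delta^4$, such that the following holds. Let $A, B : \mathbb{R}^N \to \mathbb{R}$ be multilinear polynomials of degree $d$ with $\|A\|_2, \|B\|_2 \le 1$. For column vectors $\mathbf{a},\mathbf{b}\in\mathbb{R}^D$ and $M \in \mathbb{R}^{N\times D}$ define $A_M, B_M : \mathbb{R}^D \to \mathbb{R}$ by $A_M(\mathbf{a}) = A\left(\frac{M\mathbf{a}}{\|\mathbf{a}\|_2}\right)$ and $B_M(\mathbf{b}) = B\left(\frac{M\mathbf{b}}{\|\mathbf{b}\|_2}\right)$. If $M$ has i.i.d. $\mathcal{N}(0,1)$ entries, then with probability at least $1-\delta$ over $M$, $$\left| \langle A_M, B_M\rangle_{\mathcal{G}_\rho^{\otimes D}} - \langle A,B\rangle_{\mathcal{G}_\rho^{\otimes N}} \right| < \delta.$$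
   Context: $\gamma_n$ is the standard Gaussian measure on $\mathbb{R}^n$ and $\|A\|_2 = (\mathbb{E}_{\mathbf{X}\sim\gamma_N} A(\mathbf{X})^2)^{1/2}$. $\mathcal{G}_\rho^{\otimes n}$ is the distribution of $(\mathbf{X},\mathbf{Y})\in\mathbb{R}^n\times\mathbb{R}^n$ with $\mathbf{X}\sim\gamma_n$ and $\mathbf{Y} = \rho\mathbf{X}+\sqrt{1-\rho^2}\mathbf{Z}$, $\mathbf{Z}\sim\gamma_n$ independent; $\langle A,B\rangle_{\mathcal{G}_\rho^{\otimes n}} = \mathbb{E}_{(\mathbf{X},\mathbf{Y})\sim\mathcal{G}_\rho^{\otimes n}}[A(\mathbf{X})B(\mathbf{Y})]$. Every $A\in L^2(\mathbb{R}^N,\gamma_N)$ has a Hermite expansion $A = \sum_{\boldsymbol\sigma\in\mathbb{Z}_{\ge0}^N}\widehat{A}(\boldsymbol\sigma)H_{\boldsymbol\sigma}$ with $H_{\boldsymbol\sigma}(\mathbf{X}) = \prod_i H_{\sigma_i}(X_i)$ the normalized (orthonormal) Hermite polynomials; the degree of $A$ is the largest $|\boldsymbol\sigma| = \sum_i\sigma_i$ with $\widehat A(\boldsymbol\sigma)\neq 0$, and $A$ is multilinear if $\widehat A(\boldsymbol\sigma)\ne0$ only when all $\sigma_i\in\{0,1\}$. *)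

theory Defs
  imports "HOL-Probability.Probability"
begin

text \<open>
  Vectors of \<open>\<real>\<^sup>n\<close> are the functions in \<open>{..<n} \<rightarrow>\<^sub>E UNIV\<close> (extensional, i.e. \<open>undefined\<close> outside
  \<open>{..<n}\<close>), which is the space of the product measure below. Dimensions are natural numbers and not
  types because the target dimension depends on the accuracy parameter.
\<close>

definition std_gaussian :: "real measure" where
  "std_gaussian = density lborel (\<lambda>x. ennreal (std_normal_density x))"

definition gaussian :: "nat \<Rightarrow> (nat \<Rightarrow> real) measure" where
  "gaussian n = Pi\<^sub>M {..<n} (\<lambda>_. std_gaussian)"

definition gaussian_matrix :: "nat \<Rightarrow> nat \<Rightarrow> (nat \<times> nat \<Rightarrow> real) measure" where
  "gaussian_matrix m n = Pi\<^sub>M ({..<m} \<times> {..<n}) (\<lambda>_. std_gaussian)"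

definition gaussian_norm :: "nat \<Rightarrow> ((nat \<Rightarrow> real) \<Rightarrow> real) \<Rightarrow> real" where
  "gaussian_norm n A = sqrt (\<integral>x. (A x)\<^sup>2 \<partial>gaussian n)"

definition correlated_gaussian :: "real \<Rightarrow> nat \<Rightarrow> ((nat \<Rightarrow> real) \<times> (nat \<Rightarrow> real)) measure" where
  "correlated_gaussian \<rho> n =
     distr (gaussian n \<Otimes>\<^sub>M gaussian n) (gaussian n \<Otimes>\<^sub>M gaussian n)
       (\<lambda>(x, z). (x, \<lambda>i\<in>{..<n}. \<rho> * x i + sqrt (1 - \<rho>\<^sup>2) * z i))"

definition correlated_inner ::
    "real \<Rightarrow> nat \<Rightarrow> ((nat \<Rightarrow> real) \<Rightarrow> real) \<Rightarrow> ((nat \<Rightarrow> real) \<Rightarrow> real) \<Rightarrow> real" where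
  "correlated_inner \<rho> n A B = (\<integral>(x, y). A x * B y \<partial>correlated_gaussian \<rho> n)"

text \<open>The monic probabilists' Hermite polynomials, orthogonal for the standard Gaussian measure;
  the \<open>k\<close>-th one has squared norm \<open>k!\<close>.\<close>

fun monic_hermite :: "nat \<Rightarrow> real \<Rightarrow> real" where
  "monic_hermite 0 x = 1"
| "monic_hermite (Suc 0) x = x"
| "monic_hermite (Suc (Suc k)) x = x * monic_hermite (Suc k) x - real (Suc k) * monic_hermite k x"

definition hermite :: "nat \<Rightarrow> real \<Rightarrow> real" where
  "hermite k x = monic_hermite k x / sqrt (fact k)"

definition hermite_prod :: "nat \<Rightarrow> (nat \<Rightarrow> nat) \<Rightarrow> (nat \<Rightarrow> real) \<Rightarrow> real" where
  "hermite_prod n \<sigma> x = (\<Prod>i<n. hermite (\<sigma> i) (x i))"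

definition hermite_coeff :: "nat \<Rightarrow> ((nat \<Rightarrow> real) \<Rightarrow> real) \<Rightarrow> (nat \<Rightarrow> nat) \<Rightarrow> real" where
  "hermite_coeff n A \<sigma> = (\<integral>x. A x * hermite_prod n \<sigma> x \<partial>gaussian n)"

definition hermite_support :: "nat \<Rightarrow> ((nat \<Rightarrow> real) \<Rightarrow> real) \<Rightarrow> (nat \<Rightarrow> nat) set" where
  "hermite_support n A = {\<sigma> \<in> {..<n} \<rightarrow>\<^sub>E UNIV. hermite_coeff n A \<sigma> \<noteq> 0}"

text \<open>A polynomial is a function given by its finite Hermite expansion. The expansion must hold at
  every point and not just almost everywhere, since \<open>A (M a / \<parallel>a\<parallel>\<^sub>2)\<close> depends on point values.\<close>

definition polynomial_on_Rn :: "nat \<Rightarrow> ((nat \<Rightarrow> real) \<Rightarrow> real) \<Rightarrow> bool" where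
  "polynomial_on_Rn n A \<longleftrightarrow>
     finite (hermite_support n A) \<and>
     (\<forall>x \<in> {..<n} \<rightarrow>\<^sub>E UNIV. A x = (\<Sum>\<sigma>\<in>hermite_support n A. hermite_coeff n A \<sigma> * hermite_prod n \<sigma> x))"

text \<open>The zero polynomial gets degree 0.\<close>

definition hermite_degree :: "nat \<Rightarrow> ((nat \<Rightarrow> real) \<Rightarrow> real) \<Rightarrow> nat" where
  "hermite_degree n A = Max (insert 0 ((\<lambda>\<sigma>. \<Sum>i<n. \<sigma> i) ` hermite_support n A))"

definition multilinear :: "nat \<Rightarrow> ((nat \<Rightarrow> real) \<Rightarrow> real) \<Rightarrow> bool" where
  "multilinear n A \<longleftrightarrow> (\<forall>\<sigma> \<in> hermite_support n A. \<forall>i<n. \<sigma> i \<in> {0, 1})"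

text \<open>\<open>A\<^sub>M(a) = A (M a / \<parallel>a\<parallel>\<^sub>2)\<close> for an \<open>N \<times> D\<close> matrix \<open>M\<close>. For \<open>a = 0\<close>, a null set if \<open>D > 0\<close>, the
  argument is the zero vector.\<close>

definition compose_matrix ::
    "nat \<Rightarrow> nat \<Rightarrow> (nat \<times> nat \<Rightarrow> real) \<Rightarrow> ((nat \<Rightarrow> real) \<Rightarrow> real) \<Rightarrow> (nat \<Rightarrow> real) \<Rightarrow> real" where
  "compose_matrix N D M A a =
     A (\<lambda>i\<in>{..<N}. (\<Sum>j<D. M (i, j) * a j) / L2_set a {..<D})"

end

theory Submission imports Defs begin

text \<open>
  Let \<open>F(M)\<close> be the correlation of \<open>A\<^sub>M\<close> and \<open>B\<^sub>M\<close> and \<open>\<mu>\<close> that of \<open>A\<close> and \<open>B\<close>; by Markov's inequality it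
  suffices that \<open>E (F - \<mu>)\<^sup>2 = O(9\<^sup>d / D)\<close>. Put \<open>u = a / \<parallel>a\<parallel>\<close> and \<open>v = b / \<parallel>b\<parallel>\<close>. Averaging over \<open>M\<close> first,
  \<open>E F\<close> is the polynomial \<open>\<Sum>S. f S * g S * r ^ card S\<close>, with \<open>f\<close> and \<open>g\<close> the coefficients
  of \<open>A\<close> and \<open>B\<close>, averaged over \<open>r = u \<bullet> v\<close>, and \<open>r\<close> has mean square distance \<open>O(1/D)\<close> from \<open>\<rho>\<close>. For \<open>E F\<^sup>2\<close> take an independent copy \<open>(u', v')\<close>: Wick's formula, row by row, writes
  \<open>E\<^sub>M A(Mu) B(Mv) A(Mu') B(Mv')\<close> as a polynomial in the six inner products of the four vectors. The terms
  without cross products such as \<open>u \<bullet> u'\<close> average to \<open>(E F)\<^sup>2\<close>. Of the others, the symmetry \<open>(u, v) \<mapsto> (-u, -v)\<close>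
  leaves only those with at least two cross products, which cost a factor \<open>O(1/D)\<close>, while their coefficients sum to at
  most \<open>E (A\<^sup>+ B\<^sup>+)\<^sup>2\<close>, where \<open>A\<^sup>+\<close> and \<open>B\<^sup>+\<close> have the absolute values of the coefficients of \<open>A\<close> and \<open>B\<close>.
  Hypercontractivity bounds this by \<open>9\<^sup>d\<close>.
\<close>

section \<open>Functions with moments of all orders\<close>

text \<open>Because of the norms, \<open>A\<^sub>M\<close> is not a polynomial in its argument. It
  is polynomial in the matrix, so the vectors are frozen and the matrix is integrated out. By
  multilinearity a row enters each of the four factors at most once, and moments of order four per
  row suffice. Negative moments of the norms never occur. When a squared norm drops below half of
  its mean \<open>D\<close>, its deviation is already of order \<open>D\<close>, and the trivial
  bound for vectors of length at most 1 is affordable. The integral of the square of the product of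
  the two majorants arises by replacing all six inner products by 1: Wick's polynomial then becomes
  a moment of a single Gaussian vector. Such moments are nonnegative, so only the signs of the
  coefficients are lost. Markov's inequality for the square asks for a mean square error of at most
  \<open>\<delta> ^ 3\<close>; the fourth power in \<open>D\<close> gives more for \<delta> < 1, and
  for \<delta> \<ge> 1 the claim is trivial. For d \<ge> 2 the bound \<open>9 ^ d\<close> is below
  \<open>d ^ (4 * d)\<close>; for d = 1 it goes into the constant.\<close>

definition all_moments :: "'a measure \<Rightarrow> ('a \<Rightarrow> real) \<Rightarrow> bool" where
  "all_moments M f \<longleftrightarrow> f \<in> borel_measurable M \<and> (\<forall>p. integrable M (\<lambda>x. \<bar>f x\<bar> ^ p))"

lemma all_moments_measurable: "all_moments M f \<Longrightarrow> f \<in> borel_measurable M"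
  by (simp add: all_moments_def)

lemma all_moments_integrable:
  assumes "all_moments M f"
  shows "integrable M f"
proof (rule integrable_abs_cancel)
  have "\<forall>p. integrable M (\<lambda>x. \<bar>f x\<bar> ^ p)"
    using assms by (simp add: all_moments_def)
  from spec[OF this, of 1] show "integrable M (\<lambda>x. \<bar>f x\<bar>)" by simp
qed (rule all_moments_measurable[OF assms])

lemma all_moments_add:
  assumes "all_moments M f" "all_moments M g"
  shows "all_moments M (\<lambda>x. f x + g x)"
proof -
  have [measurable]: "f \<in> borel_measurable M" "g \<in> borel_measurable M"
    using assms by (auto simp: all_moments_def)
  have le: "\<bar>a + b\<bar> ^ p \<le> 2 ^ p * (\<bar>a\<bar> ^ p + \<bar>b\<bar> ^ p)" for a b :: real and p
  proof -
    have "\<bar>a + b\<bar> ^ p \<le> (2 * max \<bar>a\<bar> \<bar>b\<bar>) ^ p" by (intro power_mono) auto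
    also have "\<dots> = 2 ^ p * (max \<bar>a\<bar> \<bar>b\<bar>) ^ p" by (simp add: power_mult_distrib)
    also have "\<dots> \<le> 2 ^ p * (\<bar>a\<bar> ^ p + \<bar>b\<bar> ^ p)"
      by (intro mult_left_mono) (auto simp: max_def)
    finally show ?thesis .
  qed
  have "integrable M (\<lambda>x. \<bar>f x + g x\<bar> ^ p)" for p
  proof (rule Bochner_Integration.integrable_bound)
    show "integrable M (\<lambda>x. 2 ^ p * (\<bar>f x\<bar> ^ p + \<bar>g x\<bar> ^ p))"
      using assms by (auto simp: all_moments_def)
  qed (use le[of "f _" "g _" p] in auto)
  then show ?thesis by (simp add: all_moments_def)
qed

text \<open>Closure under products is the reason for demanding all orders at once: the moment of
  order \<open>p\<close> of a product is controlled by moments of order \<open>2 * p\<close> of the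
  factors. Integrability of any polynomial expression then follows by introduction rules
  alone.\<close>

lemma all_moments_mult:
  assumes "all_moments M f" "all_moments M g"
  shows "all_moments M (\<lambda>x. f x * g x)"
proof -
  have [measurable]: "f \<in> borel_measurable M" "g \<in> borel_measurable M"
    using assms by (auto simp: all_moments_def)
  have le: "\<bar>a * b\<bar> ^ p \<le> \<bar>a\<bar> ^ (2 * p) + \<bar>b\<bar> ^ (2 * p)" for a b :: real and p
  proof -
    have "0 \<le> (\<bar>a\<bar> ^ p - \<bar>b\<bar> ^ p)\<^sup>2" by simp
    also have "\<dots> = \<bar>a\<bar> ^ (2 * p) + \<bar>b\<bar> ^ (2 * p) - 2 * (\<bar>a\<bar> ^ p * \<bar>b\<bar> ^ p)"
      by (simp only: power2_diff power_mult[symmetric] mult.assoc) (simp add: mult.commute)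
    finally have "2 * (\<bar>a\<bar> ^ p * \<bar>b\<bar> ^ p) \<le> \<bar>a\<bar> ^ (2 * p) + \<bar>b\<bar> ^ (2 * p)" by simp
    moreover have "0 \<le> \<bar>a\<bar> ^ p * \<bar>b\<bar> ^ p" by simp
    ultimately show ?thesis unfolding abs_mult power_mult_distrib by linarith
  qed
  have "integrable M (\<lambda>x. \<bar>f x * g x\<bar> ^ p)" for p
  proof (rule Bochner_Integration.integrable_bound)
    show "integrable M (\<lambda>x. \<bar>f x\<bar> ^ (2 * p) + \<bar>g x\<bar> ^ (2 * p))"
      using assms by (auto simp: all_moments_def)
    have "0 \<le> \<bar>a\<bar> ^ (2 * p) + \<bar>b\<bar> ^ (2 * p)" for a b :: real by simp
    then show "AE x in M. norm (\<bar>f x * g x\<bar> ^ p) \<le> norm (\<bar>f x\<bar> ^ (2 * p) + \<bar>g x\<bar> ^ (2 * p))"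
      using le[of "f _" "g _" p] by simp
  qed measurable
  then show ?thesis by (simp add: all_moments_def)
qed

lemma (in finite_measure) all_moments_bounded:
  assumes "f \<in> borel_measurable M" "\<And>x. x \<in> space M \<Longrightarrow> \<bar>f x\<bar> \<le> K"
  shows "all_moments M f"
proof -
  have "integrable M (\<lambda>x. \<bar>f x\<bar> ^ p)" for p
    using assms by (intro integrable_const_bound[where B="K ^ p"])
      (auto intro!: AE_I2 power_mono simp: power_abs)
  then show ?thesis using assms(1) by (simp add: all_moments_def)
qed

lemma (in finite_measure) all_moments_const: "all_moments M (\<lambda>x. c)"
  by (rule all_moments_bounded[where K="\<bar>c\<bar>"]) auto

lemma (in finite_measure) all_moments_cmult: "all_moments M f \<Longrightarrow> all_moments M (\<lambda>x. c * f x)"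
  by (intro all_moments_mult all_moments_const)

lemma (in finite_measure) all_moments_sum:
  "(\<And>i. i \<in> I \<Longrightarrow> all_moments M (f i)) \<Longrightarrow> all_moments M (\<lambda>x. \<Sum>i\<in>I. f i x)"
  by (induction I rule: infinite_finite_induct) (auto intro: all_moments_const all_moments_add)

lemma (in finite_measure) all_moments_prod:
  "(\<And>i. i \<in> I \<Longrightarrow> all_moments M (f i)) \<Longrightarrow> all_moments M (\<lambda>x. \<Prod>i\<in>I. f i x)"
  by (induction I rule: infinite_finite_induct) (auto intro: all_moments_const all_moments_mult)

lemma (in finite_measure) all_moments_power: "all_moments M f \<Longrightarrow> all_moments M (\<lambda>x. f x ^ p)"
  by (induction p) (auto intro: all_moments_const all_moments_mult)

lemma (in finite_measure) all_moments_diff: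
  assumes "all_moments M f" "all_moments M g"
  shows "all_moments M (\<lambda>x. f x - g x)"
  using all_moments_add[OF assms(1) all_moments_cmult[OF assms(2), of "-1"]] by simp

lemma all_moments_distr:
  assumes "all_moments N f" "g \<in> measurable M N" "distr M N g = N"
  shows "all_moments M (\<lambda>x. f (g x))"
proof -
  note [measurable] = all_moments_measurable[OF assms(1)] assms(2)
  have "integrable (distr M N g) (\<lambda>x. \<bar>f x\<bar> ^ p)" for p
    using assms(1) by (simp add: assms(3) all_moments_def)
  then have "integrable M (\<lambda>x. \<bar>f (g x)\<bar> ^ p)" for p
    by (subst (asm) integrable_distr_eq) auto
  then show ?thesis by (simp add: all_moments_def)
qed

lemma all_moments_fst:
  assumes "all_moments M f" "sigma_finite_measure M" "prob_space N"
  shows "all_moments (M \<Otimes>\<^sub>M N) (\<lambda>x. f (fst x))"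
proof (rule all_moments_distr[OF assms(1)])
  interpret N: prob_space N by fact
  show "distr (M \<Otimes>\<^sub>M N) M fst = M" by (simp add: N.distr_pair_fst)
qed simp

lemma all_moments_snd:
  assumes "all_moments N f" "prob_space M" "sigma_finite_measure N"
  shows "all_moments (M \<Otimes>\<^sub>M N) (\<lambda>x. f (snd x))"
proof (rule all_moments_distr[OF assms(1)])
  interpret M: prob_space M by fact
  interpret N: sigma_finite_measure N by fact
  interpret pair_sigma_finite M N ..
  have "distr (M \<Otimes>\<^sub>M N) N snd = distr (N \<Otimes>\<^sub>M M) N (snd \<circ> (\<lambda>(x, y). (y, x)))"
    by (subst distr_pair_swap, subst distr_distr) auto
  also have "snd \<circ> (\<lambda>(x, y). (y, x)) = (fst :: 'a \<times> 'b \<Rightarrow> 'a)"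
    by (auto simp: fun_eq_iff)
  finally show "distr (M \<Otimes>\<^sub>M N) N snd = N"
    by (simp add: M.distr_pair_fst)
qed simp

section \<open>Products of the standard Gaussian measure\<close>

lemma prob_space_std_gaussian: "prob_space std_gaussian"
  unfolding std_gaussian_def by (rule prob_space_normal_density) simp

lemma sets_std_gaussian[simp, measurable_cong]: "sets std_gaussian = sets borel"
  by (simp add: std_gaussian_def)

lemma space_std_gaussian[simp]: "space std_gaussian = UNIV"
  by (simp add: std_gaussian_def)

interpretation std_gaussian: prob_space std_gaussian
  by (rule prob_space_std_gaussian)

lemma prob_std_gaussian_UNIV[simp]: "measure std_gaussian UNIV = 1"
  using std_gaussian.prob_space by simp

interpretation gaussians: product_sigma_finite "\<lambda>_ :: 'i. std_gaussian"
  by unfold_locales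

text \<open>The index set is arbitrary so that vectors, matrices (indexed by pairs) and single rows
  are instances of one measure. A random matrix is then a Gaussian vector, and the moments of linear
  forms apply to its rows.\<close>

abbreviation gaussian_on :: "'i set \<Rightarrow> ('i \<Rightarrow> real) measure" where
  "gaussian_on I \<equiv> Pi\<^sub>M I (\<lambda>_. std_gaussian)"

lemma prob_space_gaussian_on: "prob_space (gaussian_on I)"
  by (intro prob_space_PiM prob_space_std_gaussian)

lemma all_moments_std_gaussian: "all_moments std_gaussian (\<lambda>x. x)"
proof -
  have "integrable std_gaussian (\<lambda>x. \<bar>x\<bar> ^ p)" for p
    using integrable_abs[OF integrable_std_normal_distribution_moment[of p]]
    by (simp add: std_gaussian_def power_abs)
  then show ?thesis by (simp add: all_moments_def)
qed

lemma integrable_std_gaussian_power: "integrable std_gaussian (\<lambda>x. x ^ k)"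
  using integrable_std_normal_distribution_moment by (simp add: std_gaussian_def)

lemma integral_std_gaussian_power:
  "(\<integral>x. x ^ k \<partial>std_gaussian) = (if even k then fact k / (2 ^ (k div 2) * fact (k div 2)) else 0)"
  using integral_std_normal_distribution_moment_odd[of k] std_normal_distribution_even_moments(1)[of "k div 2"]
  by (auto simp: std_gaussian_def)

lemma distr_gaussian_on_component:
  "i \<in> I \<Longrightarrow> distr (gaussian_on I) std_gaussian (\<lambda>x. x i) = std_gaussian"
  by (rule distr_PiM_component) (auto intro: prob_space_std_gaussian)

lemma all_moments_gaussian_on:
  assumes "i \<in> I"
  shows "all_moments (gaussian_on I) (\<lambda>x. x i)"
  by (rule all_moments_distr[OF all_moments_std_gaussian])
    (use assms distr_gaussian_on_component[of i I] in auto)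

lemma distr_uminus_std_gaussian: "distr std_gaussian std_gaussian uminus = std_gaussian"
proof -
  have "distr std_gaussian std_gaussian uminus = distr std_gaussian borel uminus"
    by (rule distr_cong) auto
  also have "\<dots> = density (distr lborel borel uminus) (\<lambda>x. ennreal (std_normal_density x))"
    unfolding std_gaussian_def
    by (subst density_distr) (auto simp: std_normal_density_def)
  also have "\<dots> = std_gaussian"
    by (simp add: std_gaussian_def lborel_distr_uminus)
  finally show ?thesis .
qed

lemma distr_uminus_gaussian_on:
  assumes "finite I"
  shows "distr (gaussian_on I) (gaussian_on I) (\<lambda>x. \<lambda>i\<in>I. - x i) = gaussian_on I"
proof -
  have "(\<lambda>x. \<lambda>i\<in>I. - x i) = compose I (uminus :: real \<Rightarrow> real)"
    by (auto simp: compose_def)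
  then show ?thesis
    using assms distr_PiM_finite_prob_space'[of I "\<lambda>_. std_gaussian" "\<lambda>_. std_gaussian" uminus]
    by (simp add: prob_space_std_gaussian distr_uminus_std_gaussian)
qed


text \<open>The moments 0, 1, 0, 3. The coordinate inductions below integrate out one fresh
  coordinate, in which the integrand has degree at most four; zero coefficients are written out
  there to match this pattern.\<close>

lemma integral_std_gaussian_quartic:
  "(\<integral>y. a + b * y + c * y\<^sup>2 + d * y ^ 3 + e * y ^ 4 \<partial>std_gaussian) = a + c + 3 * e"
proof -
  have "fact 4 = (24 :: real)" by (simp add: fact_numeral)
  then show ?thesis
    using integral_std_gaussian_power[of 1] integral_std_gaussian_power[of 2]
      integral_std_gaussian_power[of 3] integral_std_gaussian_power[of 4]
      integrable_std_gaussian_power[of 1] integrable_std_gaussian_power[of 2]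
      integrable_std_gaussian_power[of 3] integrable_std_gaussian_power[of 4]
    by (simp add: std_gaussian.prob_space)
qed

lemma integral_gaussian_on_insert:
  assumes "finite I" "i \<notin> I" "all_moments (gaussian_on (insert i I)) f"
  shows "(\<integral>x. f x \<partial>gaussian_on (insert i I)) = (\<integral>x. (\<integral>y. f (x(i := y)) \<partial>std_gaussian) \<partial>gaussian_on I)"
  using assms by (intro gaussians.product_integral_insert all_moments_integrable)

section \<open>Moments of linear forms\<close>

abbreviation (input) dot :: "'i set \<Rightarrow> ('i \<Rightarrow> real) \<Rightarrow> ('i \<Rightarrow> real) \<Rightarrow> real" where
  "dot K c x \<equiv> (\<Sum>j\<in>K. c j * x j)"

lemma all_moments_dot: "all_moments (gaussian_on K) (dot K c)"
proof -
  interpret prob_space "gaussian_on K" by (rule prob_space_gaussian_on)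
  show ?thesis
    by (intro all_moments_sum all_moments_cmult all_moments_gaussian_on)
qed

lemma dot_insert_upd:
  assumes "finite K" "i \<notin> K"
  shows "dot (insert i K) c (x(i := y)) = c i * y + dot K c x"
proof -
  have "dot K c (x(i := y)) = dot K c x"
    using assms by (intro sum.cong) auto
  then show ?thesis using assms by simp
qed

lemma integral_dot:
  assumes "finite K"
  shows "(\<integral>x. dot K a x \<partial>gaussian_on K) = 0"
proof -
  interpret prob_space "gaussian_on K" by (rule prob_space_gaussian_on)
  have "(\<integral>x. x j \<partial>gaussian_on K) = 0" if "j \<in> K" for j
  proof -
    have "(\<integral>x. x j \<partial>gaussian_on K) = (\<integral>y. y \<partial>distr (gaussian_on K) std_gaussian (\<lambda>x. x j))"
      using that by (subst integral_distr) auto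
    also have "\<dots> = (\<integral>y. y \<partial>std_gaussian)"
      using that by (simp add: distr_gaussian_on_component)
    also have "\<dots> = 0" using integral_std_gaussian_power[of 1] by simp
    finally show ?thesis .
  qed
  then show ?thesis
    by (subst Bochner_Integration.integral_sum)
      (auto intro!: all_moments_integrable all_moments_cmult all_moments_gaussian_on)
qed

lemma integral_dot2:
  assumes "finite K"
  shows "(\<integral>x. dot K a x * dot K b x \<partial>gaussian_on K) = dot K a b"
  using assms
proof (induction K rule: finite_induct)
  case empty
  then show ?case by simp
next
  case (insert i K)
  interpret prob_space "gaussian_on K" by (rule prob_space_gaussian_on)
  have "(\<integral>x. dot (insert i K) a x * dot (insert i K) b x \<partial>gaussian_on (insert i K)) =
    (\<integral>x. (\<integral>y. dot (insert i K) a (x(i := y)) * dot (insert i K) b (x(i := y)) \<partial>std_gaussian) \<partial>gaussian_on K)"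
    using insert by (intro integral_gaussian_on_insert all_moments_mult all_moments_dot) auto
  also have "\<dots> = (\<integral>x. (\<integral>y. (dot K a x * dot K b x) + (a i * dot K b x + b i * dot K a x) * y
      + (a i * b i) * y\<^sup>2 + 0 * y ^ 3 + 0 * y ^ 4 \<partial>std_gaussian) \<partial>gaussian_on K)"
    unfolding dot_insert_upd[OF insert.hyps]
    by (intro Bochner_Integration.integral_cong refl) (simp add: algebra_simps power2_eq_square)
  also have "\<dots> = (\<integral>x. dot K a x * dot K b x + a i * b i \<partial>gaussian_on K)"
    unfolding integral_std_gaussian_quartic by simp
  also have "\<dots> = dot K a b + a i * b i"
    by (subst Bochner_Integration.integral_add)
      (auto intro!: all_moments_integrable all_moments_mult all_moments_dot all_moments_const
         simp: prob_space insert.IH)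
  finally show ?case using insert by (simp add: add.commute)
qed

lemma integral_dot3:
  assumes "finite K"
  shows "(\<integral>x. dot K a x * dot K b x * dot K c x \<partial>gaussian_on K) = 0"
  using assms
proof (induction K rule: finite_induct)
  case empty
  then show ?case by simp
next
  case (insert i K)
  interpret prob_space "gaussian_on K" by (rule prob_space_gaussian_on)
  note am = all_moments_integrable all_moments_mult all_moments_add all_moments_dot all_moments_const
  have "(\<integral>x. dot (insert i K) a x * dot (insert i K) b x * dot (insert i K) c x \<partial>gaussian_on (insert i K)) =
    (\<integral>x. (\<integral>y. dot (insert i K) a (x(i := y)) * dot (insert i K) b (x(i := y)) * dot (insert i K) c (x(i := y))
      \<partial>std_gaussian) \<partial>gaussian_on K)"
    using insert by (intro integral_gaussian_on_insert all_moments_mult all_moments_dot) auto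
  also have "\<dots> = (\<integral>x. (\<integral>y. (dot K a x * dot K b x * dot K c x)
      + (a i * dot K b x * dot K c x + b i * dot K a x * dot K c x + c i * dot K a x * dot K b x) * y
      + (a i * b i * dot K c x + a i * c i * dot K b x + b i * c i * dot K a x) * y\<^sup>2
      + (a i * b i * c i) * y ^ 3 + 0 * y ^ 4 \<partial>std_gaussian) \<partial>gaussian_on K)"
    unfolding dot_insert_upd[OF insert.hyps]
    by (intro Bochner_Integration.integral_cong refl)
      (simp add: algebra_simps power2_eq_square power3_eq_cube)
  also have "\<dots> = (\<integral>x. dot K a x * dot K b x * dot K c x
      + a i * b i * dot K c x + a i * c i * dot K b x + b i * c i * dot K a x \<partial>gaussian_on K)"
    unfolding integral_std_gaussian_quartic by (simp add: add.assoc)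
  also have "\<dots> = 0"
    by (simp add: am insert.IH integral_dot insert.hyps)
  finally show ?case .
qed

text \<open>In the induction, the coefficient of \<open>y\<^sup>2\<close> pairs two forms in the new
  coordinate and leaves the other two to the old ones. The moment 3 of \<open>y ^ 4\<close> gives
  one contribution to each of the three pairings on the right.\<close>

lemma integral_dot4:
  assumes "finite K"
  shows "(\<integral>x. dot K a x * dot K b x * dot K c x * dot K d x \<partial>gaussian_on K) =
    dot K a b * dot K c d + dot K a c * dot K b d + dot K a d * dot K b c"
  using assms
proof (induction K rule: finite_induct)
  case empty
  then show ?case by simp
next
  case (insert i K)
  interpret prob_space "gaussian_on K" by (rule prob_space_gaussian_on)
  note am = all_moments_integrable all_moments_mult all_moments_add all_moments_dot all_moments_const
  have "(\<integral>x. dot (insert i K) a x * dot (insert i K) b x * dot (insert i K) c x * dot (insert i K) d x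
      \<partial>gaussian_on (insert i K)) =
    (\<integral>x. (\<integral>y. dot (insert i K) a (x(i := y)) * dot (insert i K) b (x(i := y))
      * dot (insert i K) c (x(i := y)) * dot (insert i K) d (x(i := y)) \<partial>std_gaussian) \<partial>gaussian_on K)"
    using insert by (intro integral_gaussian_on_insert all_moments_mult all_moments_dot) auto
  also have "\<dots> = (\<integral>x. (\<integral>y. (dot K a x * dot K b x * dot K c x * dot K d x)
      + (a i * dot K b x * dot K c x * dot K d x + b i * dot K a x * dot K c x * dot K d x
         + c i * dot K a x * dot K b x * dot K d x + d i * dot K a x * dot K b x * dot K c x) * y
      + (a i * b i * (dot K c x * dot K d x) + a i * c i * (dot K b x * dot K d x)
         + a i * d i * (dot K b x * dot K c x) + b i * c i * (dot K a x * dot K d x)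
         + b i * d i * (dot K a x * dot K c x) + c i * d i * (dot K a x * dot K b x)) * y\<^sup>2
      + (a i * b i * c i * dot K d x + a i * b i * d i * dot K c x
         + a i * c i * d i * dot K b x + b i * c i * d i * dot K a x) * y ^ 3
      + (a i * b i * c i * d i) * y ^ 4 \<partial>std_gaussian) \<partial>gaussian_on K)"
    unfolding dot_insert_upd[OF insert.hyps]
    by (intro Bochner_Integration.integral_cong refl)
      (simp add: algebra_simps power2_eq_square power3_eq_cube power4_eq_xxxx)
  also have "\<dots> = (\<integral>x. dot K a x * dot K b x * dot K c x * dot K d x
      + (a i * b i * (dot K c x * dot K d x) + a i * c i * (dot K b x * dot K d x)
         + a i * d i * (dot K b x * dot K c x) + b i * c i * (dot K a x * dot K d x)
         + b i * d i * (dot K a x * dot K c x) + c i * d i * (dot K a x * dot K b x))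
      + 3 * (a i * b i * c i * d i) \<partial>gaussian_on K)"
    unfolding integral_std_gaussian_quartic by simp
  also have "\<dots> = dot K a b * dot K c d + dot K a c * dot K b d + dot K a d * dot K b c
      + (a i * b i * dot K c d + a i * c i * dot K b d + a i * d i * dot K b c
         + b i * c i * dot K a d + b i * d i * dot K a c + c i * d i * dot K a b)
      + 3 * (a i * b i * c i * d i)"
    by (simp add: am insert.IH integral_dot2 insert.hyps prob_space)
  finally show ?case using insert by (simp add: algebra_simps)
qed

text \<open>Wick's formula for a product of at most four centred jointly Gaussian variables:
  \<open>a12\<close> to \<open>a34\<close> are the covariances
  and \<open>p1\<close> to \<open>p4\<close> tell which variables occur.\<close>

definition wick ::
    "real \<Rightarrow> real \<Rightarrow> real \<Rightarrow> real \<Rightarrow> real \<Rightarrow> real \<Rightarrow> bool \<Rightarrow> bool \<Rightarrow> bool \<Rightarrow> bool \<Rightarrow> real" where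
  "wick a12 a34 a13 a14 a23 a24 p1 p2 p3 p4 =
    (if p1 then
       if p2 then if p3 then if p4 then a12 * a34 + a13 * a24 + a14 * a23 else 0
                  else if p4 then 0 else a12
       else if p3 then if p4 then 0 else a13 else if p4 then a14 else 0
     else
       if p2 then if p3 then if p4 then 0 else a23 else if p4 then a24 else 0
       else if p3 then if p4 then a34 else 0 else if p4 then 0 else 1)"

text \<open>Factors 1 outside a set turn a product over a subset into a product over all rows. Four
  products over different sets then merge into one product over rows, to which independence
  applies.\<close>

definition pick :: "bool \<Rightarrow> real \<Rightarrow> real" where
  "pick p x = (if p then x else 1)"

lemma integral_pick_dot:
  assumes "finite K"
  shows "(\<integral>x. pick p1 (dot K a x) * pick p2 (dot K b x) * pick p3 (dot K c x) * pick p4 (dot K d x)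
      \<partial>gaussian_on K) =
    wick (dot K a b) (dot K c d) (dot K a c) (dot K a d) (dot K b c) (dot K b d) p1 p2 p3 p4"
proof -
  interpret prob_space "gaussian_on K" by (rule prob_space_gaussian_on)
  show ?thesis
    unfolding wick_def pick_def
    using assms by (simp add: integral_dot integral_dot2 integral_dot3 integral_dot4 prob_space)
qed

text \<open>The four variables coincide with one standard Gaussian, so every covariance is 1. These
  values are the weights in all error bounds below.\<close>

lemma integral_pick:
  "(\<integral>y. pick p1 y * pick p2 y * pick p3 y * pick p4 y \<partial>std_gaussian) = wick 1 1 1 1 1 1 p1 p2 p3 p4"
proof -
  have "fact 4 = (24 :: real)" by (simp add: fact_numeral)
  then show ?thesis
    unfolding wick_def pick_def
    using integral_std_gaussian_power[of 1] integral_std_gaussian_power[of 2]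
      integral_std_gaussian_power[of 3] integral_std_gaussian_power[of 4]
    by (simp add: std_gaussian.prob_space power2_eq_square power3_eq_cube power4_eq_xxxx)
qed

lemma all_moments_pick:
  assumes "finite_measure M" "all_moments M f"
  shows "all_moments M (\<lambda>x. pick p (f x))"
  using assms by (cases p) (auto simp: pick_def intro: finite_measure.all_moments_const)

lemma prod_pick: "finite I \<Longrightarrow> S \<subseteq> I \<Longrightarrow> (\<Prod>i\<in>I. pick (i \<in> S) (f i)) = (\<Prod>i\<in>S. f i)"
  unfolding pick_def by (simp add: prod.inter_restrict[symmetric] Int_absorb1)

section \<open>Independent rows\<close>

text \<open>By \<open>restr\<close>, the factor with index \<open>i\<close> sees only the entries of
  row \<open>i\<close>; the factors are therefore functions of disjoint blocks of independent
  coordinates.\<close>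

lemma integral_prod_rows:
  fixes f :: "'i \<Rightarrow> ('i \<times> 'j \<Rightarrow> real) \<Rightarrow> real"
  assumes fin: "finite I" "finite J"
    and meas: "\<And>i. i \<in> I \<Longrightarrow> f i \<in> borel_measurable (gaussian_on ({i} \<times> J))"
    and restr: "\<And>i x. i \<in> I \<Longrightarrow> f i (restrict x ({i} \<times> J)) = f i x"
    and int: "\<And>i. i \<in> I \<Longrightarrow> integrable (gaussian_on (I \<times> J)) (f i)"
  shows "(\<integral>x. (\<Prod>i\<in>I. f i x) \<partial>gaussian_on (I \<times> J)) = (\<Prod>i\<in>I. \<integral>x. f i x \<partial>gaussian_on (I \<times> J))"
\<comment> \<open>The independence criterion used below concerns nonempty families of coordinates.
  For an empty one the measure is a point mass.\<close>
proof (cases "I \<times> J = {}")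
  case True
  interpret prob_space "gaussian_on (I \<times> J)" by (rule prob_space_gaussian_on)
  show ?thesis using fin(1)
    by (simp add: True PiM_empty lebesgue_integral_count_space_finite)
next
  case False
  interpret prob_space "gaussian_on (I \<times> J)" by (rule prob_space_gaussian_on)
  show ?thesis
  proof (rule indep_vars_lebesgue_integral[OF fin(1) _ int])
    have "distr (gaussian_on (I \<times> J)) (gaussian_on (I \<times> J)) (\<lambda>x. \<lambda>i\<in>I \<times> J. x i) =
      distr (gaussian_on (I \<times> J)) (gaussian_on (I \<times> J)) (\<lambda>x. x)"
      by (rule distr_cong) (auto simp: space_PiM PiE_restrict)
    then have eq: "distr (gaussian_on (I \<times> J)) (gaussian_on (I \<times> J)) (\<lambda>x. \<lambda>i\<in>I \<times> J. x i) = gaussian_on (I \<times> J)"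
      by simp
    have "indep_vars (\<lambda>_. std_gaussian) (\<lambda>i x. x i) (I \<times> J)"
    proof (subst indep_vars_iff_distr_eq_PiM')
      have "Pi\<^sub>M (I \<times> J) (\<lambda>i. distr (gaussian_on (I \<times> J)) std_gaussian (\<lambda>x. x i)) = gaussian_on (I \<times> J)"
        by (rule PiM_cong) (auto simp: distr_gaussian_on_component)
      then show "distr (gaussian_on (I \<times> J)) (gaussian_on (I \<times> J)) (\<lambda>x. \<lambda>i\<in>I \<times> J. x i) =
        Pi\<^sub>M (I \<times> J) (\<lambda>i. distr (gaussian_on (I \<times> J)) std_gaussian (\<lambda>x. x i))"
        using eq by simp
    qed (use False in auto)
    then have "indep_vars (\<lambda>i. gaussian_on ({i} \<times> J)) (\<lambda>i x. restrict (\<lambda>k. x k) ({i} \<times> J)) I"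
      by (rule indep_vars_restrict) (auto simp: disjoint_family_on_def)
    then have "indep_vars (\<lambda>_. borel) (\<lambda>i x. f i (restrict (\<lambda>k. x k) ({i} \<times> J))) I"
      by (rule indep_vars_compose2) (use meas in auto)
    then show "indep_vars (\<lambda>_. borel) f I"
      by (rule indep_vars_cong[THEN iffD1, rotated -1]) (auto simp: restr)
  qed
qed


section \<open>Wick's formula with small cross covariances\<close>

lemma wick_odd: "(p1 \<noteq> p2) \<noteq> (p3 \<noteq> p4) \<Longrightarrow> wick a12 a34 a13 a14 a23 a24 p1 p2 p3 p4 = 0"
  by (auto simp: wick_def)

text \<open>A variable of the first pair that occurs without its partner could only be paired
  across, and the cross covariances are zero.\<close>

lemma wick_cross_zero: "p1 \<noteq> p2 \<Longrightarrow> wick a12 a34 0 0 0 0 p1 p2 p3 p4 = 0"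
  by (auto simp: wick_def)

lemma wick_ones_nonneg: "0 \<le> wick 1 1 1 1 1 1 p1 p2 p3 p4"
  by (auto simp: wick_def)

lemma abs_mult_le_one: "\<bar>a\<bar> \<le> 1 \<Longrightarrow> \<bar>b\<bar> \<le> 1 \<Longrightarrow> \<bar>a * b\<bar> \<le> (1 :: real)"
  using mult_mono[of "\<bar>a\<bar>" 1 "\<bar>b\<bar>" 1] by (simp add: abs_mult)

lemma abs_wick_le:
  assumes "\<bar>a12\<bar> \<le> 1" "\<bar>a34\<bar> \<le> 1" "\<bar>a13\<bar> \<le> 1" "\<bar>a14\<bar> \<le> 1" "\<bar>a23\<bar> \<le> 1" "\<bar>a24\<bar> \<le> 1"
  shows "\<bar>wick a12 a34 a13 a14 a23 a24 p1 p2 p3 p4\<bar> \<le> wick 1 1 1 1 1 1 p1 p2 p3 p4"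
proof -
  have "\<bar>a12 * a34 + a13 * a24 + a14 * a23\<bar> \<le> 3"
    using abs_mult_le_one[OF assms(1,2)] abs_mult_le_one[OF assms(3,6)] abs_mult_le_one[OF assms(4,5)]
    by linarith
  then show ?thesis
    by (cases p1; cases p2; cases p3; cases p4) (simp_all add: wick_def assms)
qed

text \<open>If just one variable of the first pair occurs, then either exactly one of the second
  pair occurs too and the value is a single cross covariance, or the number of variables is odd and
  both sides vanish.\<close>

lemma abs_wick_cross_le:
  assumes "\<bar>a13\<bar> \<le> c" "\<bar>a14\<bar> \<le> c" "\<bar>a23\<bar> \<le> c" "\<bar>a24\<bar> \<le> c" "p1 \<noteq> p2"
  shows "\<bar>wick a12 a34 a13 a14 a23 a24 p1 p2 p3 p4\<bar> \<le> c * wick 1 1 1 1 1 1 p1 p2 p3 p4"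
  using assms by (auto simp: wick_def)

text \<open>The excess of the weight over 1 is 2 if all four variables occur, one for each crossed
  pairing, and 0 otherwise. A crossed pairing is a product of two cross covariances, hence
  \<open>c\<^sup>2\<close>. Subtracting 1 gives the bound the shape that survives products in
  \<open>abs_prod_diff_le\<close>.\<close>

lemma wick_uncrossed:
  assumes "\<bar>a12\<bar> \<le> 1" "\<bar>a34\<bar> \<le> 1" "\<bar>a13\<bar> \<le> c" "\<bar>a14\<bar> \<le> c" "\<bar>a23\<bar> \<le> c" "\<bar>a24\<bar> \<le> c"
    and "p1 = p2" "p3 = p4"
  shows "1 \<le> wick 1 1 1 1 1 1 p1 p2 p3 p4"
    and "\<bar>wick a12 a34 0 0 0 0 p1 p2 p3 p4\<bar> \<le> 1"
    and "\<bar>wick a12 a34 a13 a14 a23 a24 p1 p2 p3 p4 - wick a12 a34 0 0 0 0 p1 p2 p3 p4\<bar>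
      \<le> c\<^sup>2 * (wick 1 1 1 1 1 1 p1 p2 p3 p4 - 1)"
proof -
  show "1 \<le> wick 1 1 1 1 1 1 p1 p2 p3 p4"
    using assms(7,8) by (auto simp: wick_def)
  show "\<bar>wick a12 a34 0 0 0 0 p1 p2 p3 p4\<bar> \<le> 1"
    using assms(1,2,7,8) abs_mult_le_one[OF assms(1,2)] by (auto simp: wick_def)
  have "\<bar>a13 * a24\<bar> \<le> c * c" "\<bar>a14 * a23\<bar> \<le> c * c"
    using assms(3-6) unfolding abs_mult by (auto intro!: mult_mono)
  then have "\<bar>a13 * a24 + a14 * a23\<bar> \<le> 2 * c\<^sup>2"
    unfolding power2_eq_square by linarith
  then show "\<bar>wick a12 a34 a13 a14 a23 a24 p1 p2 p3 p4 - wick a12 a34 0 0 0 0 p1 p2 p3 p4\<bar>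
      \<le> c\<^sup>2 * (wick 1 1 1 1 1 1 p1 p2 p3 p4 - 1)"
    using assms(7,8) by (auto simp: wick_def)
qed

text \<open>Telescoping. A bound by a multiple of \<open>K - 1\<close> reproduces itself, since K (P
  - 1) + (K - 1) = K P - 1, so the error of a long product is charged to the product of the weights
  and not to the number of factors.\<close>

lemma abs_prod_diff_le:
  fixes f g K :: "'i \<Rightarrow> real"
  assumes "finite I" "0 \<le> e"
    and "\<And>i. i \<in> I \<Longrightarrow> 1 \<le> K i" "\<And>i. i \<in> I \<Longrightarrow> \<bar>f i\<bar> \<le> K i" "\<And>i. i \<in> I \<Longrightarrow> \<bar>g i\<bar> \<le> 1"
    and "\<And>i. i \<in> I \<Longrightarrow> \<bar>f i - g i\<bar> \<le> e * (K i - 1)"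
  shows "\<bar>prod f I - prod g I\<bar> \<le> e * (prod K I - 1)"
  using assms(1,3-)
proof (induction I rule: finite_induct)
  case (insert i I)
  have g: "\<bar>prod g I\<bar> \<le> 1"
    unfolding abs_prod using insert by (intro prod_le_1) auto
  have K: "1 \<le> prod K I" using insert by (intro prod_ge_1) auto
  have "\<bar>f i * prod f I - g i * prod g I\<bar> = \<bar>f i * (prod f I - prod g I) + (f i - g i) * prod g I\<bar>"
    by (simp add: algebra_simps)
  also have "\<dots> \<le> \<bar>f i\<bar> * \<bar>prod f I - prod g I\<bar> + \<bar>f i - g i\<bar> * \<bar>prod g I\<bar>"
    using abs_triangle_ineq by (simp add: abs_mult[symmetric])
  also have "\<dots> \<le> K i * (e * (prod K I - 1)) + (e * (K i - 1)) * 1"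
    using insert g K assms(2) by (intro add_mono mult_mono) (auto intro: order_trans[of 0 1])
  also have "\<dots> = e * (K i * prod K I - 1)" by (simp add: algebra_simps)
  finally show ?case using insert by simp
qed simp

lemma even_card_sym_diff:
  assumes "finite S" "finite T"
  shows "even (card (S - T \<union> (T - S))) \<longleftrightarrow> even (card S + card T)"
proof -
  have "card (S - T \<union> (T - S)) = card (S - T) + card (T - S)"
    using assms by (intro card_Un_disjoint) auto
  moreover have "card S = card (S - T) + card (S \<inter> T)"
    using assms card_Diff_subset_Int[of S T] card_mono[of S "S \<inter> T"] by auto
  moreover have "card T = card (T - S) + card (S \<inter> T)"
    using assms card_Diff_subset_Int[of T S] card_mono[of T "S \<inter> T"] by (auto simp: Int_commute)
  ultimately show ?thesis by presburger
qed

text \<open>The cross covariances \<open>a13\<close>, \<open>a14\<close>, \<open>a23\<close>, \<open>a24\<close> enter only to second order: if one row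
  contributes a single cross covariance, then by parity so does a second row.\<close>

lemma prod_wick_approx:
  assumes "finite I" "S \<subseteq> I" "T \<subseteq> I" "even (card S + card T)"
    and a: "\<bar>a12\<bar> \<le> 1" "\<bar>a34\<bar> \<le> 1" "\<bar>a13\<bar> \<le> c" "\<bar>a14\<bar> \<le> c" "\<bar>a23\<bar> \<le> c" "\<bar>a24\<bar> \<le> c"
    and c: "0 \<le> c" "c \<le> 1"
  shows "\<bar>(\<Prod>i\<in>I. wick a12 a34 a13 a14 a23 a24 (i \<in> S) (i \<in> T) (i \<in> S') (i \<in> T'))
      - (\<Prod>i\<in>I. wick a12 a34 0 0 0 0 (i \<in> S) (i \<in> T) (i \<in> S') (i \<in> T'))\<bar>
    \<le> c\<^sup>2 * (\<Prod>i\<in>I. wick 1 1 1 1 1 1 (i \<in> S) (i \<in> T) (i \<in> S') (i \<in> T'))"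
proof -
  define w w0 w1 where "w i = wick a12 a34 a13 a14 a23 a24 (i \<in> S) (i \<in> T) (i \<in> S') (i \<in> T')"
    and "w0 i = wick a12 a34 0 0 0 0 (i \<in> S) (i \<in> T) (i \<in> S') (i \<in> T')"
    and "w1 i = wick 1 1 1 1 1 1 (i \<in> S) (i \<in> T) (i \<in> S') (i \<in> T')" for i
  have le1: "\<bar>a13\<bar> \<le> 1" "\<bar>a14\<bar> \<le> 1" "\<bar>a23\<bar> \<le> 1" "\<bar>a24\<bar> \<le> 1" using a c by linarith+
  have w_le: "\<bar>w i\<bar> \<le> w1 i" for i
    unfolding w_def w1_def using a le1 by (intro abs_wick_le)
  have w1_nonneg: "0 \<le> w1 i" for i
    unfolding w1_def by (rule wick_ones_nonneg)
  \<comment> \<open>The rows with exactly one variable of the first pair. Each of them costs a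
    factor \<open>c\<close>, and their number is even by the parity hypothesis, so a nonempty
    \<open>X\<close> yields at least \<open>c\<^sup>2\<close>.\<close>
  define X where "X = S - T \<union> (T - S)"
  have X: "finite X" "X \<subseteq> I" using assms unfolding X_def by (auto intro: finite_subset)
  have "\<bar>prod w I - prod w0 I\<bar> \<le> c\<^sup>2 * prod w1 I"
  proof (cases "\<exists>i\<in>I. ((i \<in> S) \<noteq> (i \<in> T)) \<noteq> ((i \<in> S') \<noteq> (i \<in> T'))")
    case True
    then obtain i where i: "i \<in> I" "((i \<in> S) \<noteq> (i \<in> T)) \<noteq> ((i \<in> S') \<noteq> (i \<in> T'))" by blast
    have "w i = 0" "w0 i = 0"
      unfolding w_def w0_def by (rule wick_odd[OF i(2)])+
    then have "prod w I = 0" "prod w0 I = 0" using assms(1) i(1) by auto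
    then show ?thesis using w1_nonneg by (simp add: prod_nonneg)
  next
    case no_odd: False
    show ?thesis
    proof (cases "X = {}")
      case False
      have "even (card X)"
        using even_card_sym_diff[of S T] assms(1-4) finite_subset unfolding X_def by auto
      moreover have "card X \<noteq> 0" using False X by simp
      ultimately have "2 \<le> card X" by (cases "card X = 1") auto
      obtain i where i: "i \<in> I" "(i \<in> S) \<noteq> (i \<in> T)"
        using False X(2) unfolding X_def by blast
      have "w0 i = 0" unfolding w0_def by (rule wick_cross_zero[OF i(2)])
      then have "prod w0 I = 0" using assms(1) i(1) by auto
      then have "\<bar>prod w I - prod w0 I\<bar> = (\<Prod>i\<in>I. \<bar>w i\<bar>)" by (simp add: abs_prod)
      also have "\<dots> \<le> (\<Prod>i\<in>I. (if i \<in> X then c else 1) * w1 i)"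
      proof (rule prod_mono, safe)
        fix i show "\<bar>w i\<bar> \<le> (if i \<in> X then c else 1) * w1 i"
          using abs_wick_cross_le[OF a(3-6), of "i \<in> S" "i \<in> T"] w_le[of i]
          unfolding X_def w_def w1_def by auto
      qed simp
      also have "\<dots> = c ^ card X * prod w1 I"
        using assms(1) X
        by (simp add: prod.distrib prod.inter_restrict[symmetric] Int_absorb1)
      also have "\<dots> \<le> c\<^sup>2 * prod w1 I"
        using c \<open>2 \<le> card X\<close> w1_nonneg by (intro mult_right_mono power_decreasing prod_nonneg) auto
      finally show ?thesis .
    next
      case True
      have eq: "(i \<in> S) = (i \<in> T)" for i using True unfolding X_def by blast
      have eq': "(i \<in> S') = (i \<in> T')" if "i \<in> I" for i using no_odd eq that by blast
      \<comment> \<open>Now each row has both or neither variable of either pair, so cross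
        covariances occur only two at a time within a row.\<close>
      have "\<bar>prod w I - prod w0 I\<bar> \<le> c\<^sup>2 * (prod w1 I - 1)"
      proof (rule abs_prod_diff_le)
        fix i assume "i \<in> I"
        note * = wick_uncrossed[OF a eq[of i] eq'[OF this]]
        show "1 \<le> w1 i" "\<bar>w0 i\<bar> \<le> 1" "\<bar>w i - w0 i\<bar> \<le> c\<^sup>2 * (w1 i - 1)"
          unfolding w_def w0_def w1_def using * by blast+
      qed (use assms(1) w_le in auto)
      also have "\<dots> \<le> c\<^sup>2 * prod w1 I" by (intro mult_left_mono) auto
      finally show ?thesis .
    qed
  qed
  then show ?thesis unfolding w_def w0_def w1_def .
qed

text \<open>With the second pair absent, five of the six covariances do not enter. This lets the
  integrals of two products be read off from those of four.\<close>

lemma wick_pair: "wick a12 a34 a13 a14 a23 a24 p q False False = wick a12 1 0 0 0 0 p q False False"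
  by (simp add: wick_def)

text \<open>Without cross covariances the two pairs decouple as if they were independent, and a row
  in exactly one of \<open>S\<close> and \<open>T\<close>, or of \<open>S'\<close> and
  \<open>T'\<close>, has a variable without a partner.\<close>

lemma prod_wick_uncrossed:
  assumes "finite I" "S \<subseteq> I" "T \<subseteq> I" "S' \<subseteq> I" "T' \<subseteq> I"
  shows "(\<Prod>i\<in>I. wick a12 a34 0 0 0 0 (i \<in> S) (i \<in> T) (i \<in> S') (i \<in> T')) =
    (if S = T then a12 ^ card S else 0) * (if S' = T' then a34 ^ card S' else 0)"
proof (cases "S = T \<and> S' = T'")
  case True
  have "(\<Prod>i\<in>I. wick a12 a34 0 0 0 0 (i \<in> S) (i \<in> T) (i \<in> S') (i \<in> T')) =
    (\<Prod>i\<in>I. (if i \<in> S then a12 else 1) * (if i \<in> S' then a34 else 1))"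
    using True by (intro prod.cong) (auto simp: wick_def)
  also have "\<dots> = a12 ^ card S * a34 ^ card S'"
    using assms by (simp add: prod.distrib prod.inter_restrict[symmetric] Int_absorb1)
  finally show ?thesis using True by simp
next
  case False
  then obtain i where "i \<in> I" "(i \<in> S) \<noteq> (i \<in> T) \<or> (i \<in> S') \<noteq> (i \<in> T')"
    using assms by blast
  then have "wick a12 a34 0 0 0 0 (i \<in> S) (i \<in> T) (i \<in> S') (i \<in> T') = 0"
    by (auto simp: wick_def)
  then have "(\<Prod>i\<in>I. wick a12 a34 0 0 0 0 (i \<in> S) (i \<in> T) (i \<in> S') (i \<in> T')) = 0"
    using \<open>i \<in> I\<close> assms(1) by auto
  then show ?thesis using False by auto
qed

section \<open>Moments of monomials in the rows of a Gaussian matrix\<close>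

definition row_dot :: "'j set \<Rightarrow> ('i \<times> 'j \<Rightarrow> real) \<Rightarrow> ('j \<Rightarrow> real) \<Rightarrow> 'i \<Rightarrow> real" where
  "row_dot J M u i = (\<Sum>j\<in>J. M (i, j) * u j)"

text \<open>The coefficients of an entry of the image vector as a linear form on all matrix entries.
  Row moments are then moments of linear forms over \<open>I \<times> J\<close>, without passing to
  the marginal law of a row.\<close>

definition row_form :: "('j \<Rightarrow> real) \<Rightarrow> 'i \<Rightarrow> 'i \<times> 'j \<Rightarrow> real" where
  "row_form u i = (\<lambda>(k, j). if k = i then u j else 0)"

lemma row_dot_eq:
  assumes "finite I" "finite J" "i \<in> I"
  shows "row_dot J M u i = dot (I \<times> J) (row_form u i) M"
proof -
  have "dot (I \<times> J) (row_form u i) M = (\<Sum>k\<in>I. \<Sum>j\<in>J. row_form u i (k, j) * M (k, j))"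
    by (simp add: sum.cartesian_product)
  also have "\<dots> = (\<Sum>k\<in>I. if k = i then \<Sum>j\<in>J. u j * M (i, j) else 0)"
    by (intro sum.cong) (auto simp: row_form_def)
  also have "\<dots> = row_dot J M u i"
    using assms by (simp add: row_dot_def mult.commute)
  finally show ?thesis by simp
qed

lemma dot_row_form:
  assumes "finite I" "finite J" "i \<in> I"
  shows "dot (I \<times> J) (row_form u i) (row_form v i) = dot J u v"
  using row_dot_eq[OF assms, of "row_form v i" u, symmetric]
  by (simp add: row_dot_def row_form_def mult.commute)

lemma all_moments_row_dot:
  assumes "finite I" "finite J" "i \<in> I"
  shows "all_moments (gaussian_on (I \<times> J)) (\<lambda>M. row_dot J M u i)"
  unfolding row_dot_eq[OF assms] by (rule all_moments_dot)

text \<open>For fixed vectors the rows are independent, and within one row the four forms are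
  jointly Gaussian with the inner products of the vectors as covariances.\<close>

lemma integral_rows4:
  assumes "finite I" "finite J" "S \<subseteq> I" "T \<subseteq> I" "S' \<subseteq> I" "T' \<subseteq> I"
  shows "(\<integral>M. (\<Prod>i\<in>S. row_dot J M u i) * (\<Prod>i\<in>T. row_dot J M v i) * ((\<Prod>i\<in>S'. row_dot J M u' i) * (\<Prod>i\<in>T'. row_dot J M v' i))
      \<partial>gaussian_on (I \<times> J)) =
    (\<Prod>i\<in>I. wick (dot J u v) (dot J u' v') (dot J u u') (dot J u v') (dot J v u') (dot J v v')
      (i \<in> S) (i \<in> T) (i \<in> S') (i \<in> T'))"
proof -
  interpret prob_space "gaussian_on (I \<times> J)" by (rule prob_space_gaussian_on)
  define f where "f i M = pick (i \<in> S) (row_dot J M u i) * pick (i \<in> T) (row_dot J M v i)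
    * pick (i \<in> S') (row_dot J M u' i) * pick (i \<in> T') (row_dot J M v' i)" for i and M :: "'a \<times> 'b \<Rightarrow> real"
  have f_am: "all_moments (gaussian_on (A \<times> J)) (f i)" if "finite A" "i \<in> A" for A i
    unfolding f_def[abs_def] using that assms(2) prob_space_gaussian_on
    by (intro all_moments_mult all_moments_pick all_moments_row_dot prob_space.finite_measure)
  have "(\<integral>M. (\<Prod>i\<in>S. row_dot J M u i) * (\<Prod>i\<in>T. row_dot J M v i) * ((\<Prod>i\<in>S'. row_dot J M u' i) * (\<Prod>i\<in>T'. row_dot J M v' i))
      \<partial>gaussian_on (I \<times> J)) = (\<integral>M. (\<Prod>i\<in>I. f i M) \<partial>gaussian_on (I \<times> J))"
    unfolding f_def prod.distrib using assms by (simp add: prod_pick mult.assoc)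
  also have "\<dots> = (\<Prod>i\<in>I. \<integral>M. f i M \<partial>gaussian_on (I \<times> J))"
  proof (rule integral_prod_rows[OF assms(1,2)])
    show "f i \<in> borel_measurable (gaussian_on ({i} \<times> J))" for i
      by (intro all_moments_measurable f_am) auto
    show "f i (restrict M ({i} \<times> J)) = f i M" for i M
      by (simp add: f_def row_dot_def)
  qed (use assms in \<open>auto intro: all_moments_integrable f_am\<close>)
  also have "\<dots> = (\<Prod>i\<in>I. wick (dot J u v) (dot J u' v') (dot J u u') (dot J u v') (dot J v u') (dot J v v')
      (i \<in> S) (i \<in> T) (i \<in> S') (i \<in> T'))"
    unfolding f_def using assms(1,2)
    by (intro prod.cong refl) (simp add: row_dot_eq integral_pick_dot dot_row_form)
  finally show ?thesis .
qed

lemma integral_rows2: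
  assumes "finite I" "finite J" "S \<subseteq> I" "T \<subseteq> I"
  shows "(\<integral>M. (\<Prod>i\<in>S. row_dot J M u i) * (\<Prod>i\<in>T. row_dot J M v i) \<partial>gaussian_on (I \<times> J)) =
    (if S = T then dot J u v ^ card S else 0)"
  using integral_rows4[OF assms, of "{}" "{}" u v u v]
    prod_wick_uncrossed[OF assms(1,3,4), of "{}" "{}" "dot J u v" 1]
  by (simp add: wick_pair[of _ "dot J u v"])

text \<open>The same weights as for rows of a matrix when all inner products are 1. This turns
  weighted sums over coefficients back into integrals of polynomials, to which hypercontractivity
  applies.\<close>

lemma integral_monomials4:
  assumes "finite I" "S \<subseteq> I" "T \<subseteq> I" "S' \<subseteq> I" "T' \<subseteq> I"
  shows "(\<integral>x. (\<Prod>i\<in>S. x i) * (\<Prod>i\<in>T. x i) * ((\<Prod>i\<in>S'. x i) * (\<Prod>i\<in>T'. x i)) \<partial>gaussian_on I) =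
    (\<Prod>i\<in>I. wick 1 1 1 1 1 1 (i \<in> S) (i \<in> T) (i \<in> S') (i \<in> T'))"
proof -
  define f where "f i y = pick (i \<in> S) y * pick (i \<in> T) y * pick (i \<in> S') y * pick (i \<in> T') y" for i and y :: real
  have "all_moments std_gaussian (f i)" for i
    unfolding f_def[abs_def]
    by (intro all_moments_mult all_moments_pick all_moments_std_gaussian std_gaussian.finite_measure)
  then have f_int: "integrable std_gaussian (f i)" for i by (rule all_moments_integrable)
  have "(\<integral>x. (\<Prod>i\<in>S. x i) * (\<Prod>i\<in>T. x i) * ((\<Prod>i\<in>S'. x i) * (\<Prod>i\<in>T'. x i)) \<partial>gaussian_on I) =
    (\<integral>x. (\<Prod>i\<in>I. f i (x i)) \<partial>gaussian_on I)"
    unfolding f_def prod.distrib using assms by (simp add: prod_pick mult.assoc)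
  also have "\<dots> = (\<Prod>i\<in>I. integral\<^sup>L std_gaussian (f i))"
    using assms(1) f_int by (rule gaussians.product_integral_prod)
  finally show ?thesis by (simp add: f_def[abs_def] integral_pick)
qed

lemma integral_monomials2:
  assumes "finite I" "S \<subseteq> I" "T \<subseteq> I"
  shows "(\<integral>x. (\<Prod>i\<in>S. x i) * (\<Prod>i\<in>T. x i) \<partial>gaussian_on I) = (if S = T then 1 else 0)"
proof -
  have "wick 1 1 1 1 1 1 p q False False = wick 1 1 0 0 0 0 p q False False" for p q
    by (rule wick_pair)
  then show ?thesis
    using integral_monomials4[OF assms, of "{}" "{}"] prod_wick_uncrossed[OF assms, of "{}" "{}" 1 1]
    by simp
qed


section \<open>Multilinear polynomials and hypercontractivity\<close>

definition mlpoly :: "'i set \<Rightarrow> ('i set \<Rightarrow> real) \<Rightarrow> ('i \<Rightarrow> real) \<Rightarrow> real" where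
  "mlpoly I f x = (\<Sum>S\<in>Pow I. f S * (\<Prod>i\<in>S. x i))"

lemma sum_Pow_insert:
  assumes "finite I" "i \<notin> I"
  shows "(\<Sum>S\<in>Pow (insert i I). h S) = (\<Sum>S\<in>Pow I. h S) + (\<Sum>S\<in>Pow I. h (insert i S))"
proof -
  have "inj_on (insert i) (Pow I)" using assms(2) by (auto simp: inj_on_def)
  then show ?thesis
    unfolding Pow_insert using assms
    by (subst sum.union_disjoint) (auto simp: sum.reindex)
qed

text \<open>The factor of \<open>y\<close> is the partial derivative in the variable
  \<open>i\<close>; its degree is one lower, which pays for a factor 3 in
  \<open>hypercontractive\<close>.\<close>

lemma mlpoly_insert_upd:
  assumes "finite I" "i \<notin> I"
  shows "mlpoly (insert i I) f (x(i := y)) = mlpoly I f x + y * mlpoly I (\<lambda>S. f (insert i S)) x"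
proof -
  have upd: "(\<Prod>j\<in>S. (x(i := y)) j) = (\<Prod>j\<in>S. x j)" if "S \<in> Pow I" for S
    using that assms by (intro prod.cong) auto
  have ins: "(\<Prod>j\<in>insert i S. (x(i := y)) j) = y * (\<Prod>j\<in>S. x j)" if "S \<in> Pow I" for S
  proof -
    have "finite S" "i \<notin> S" using that assms finite_subset by auto
    then show ?thesis using upd[OF that] by simp
  qed
  have "(\<Sum>S\<in>Pow I. f S * (\<Prod>j\<in>S. (x(i := y)) j)) = mlpoly I f x"
    unfolding mlpoly_def by (intro sum.cong refl) (simp only: upd)
  moreover have "(\<Sum>S\<in>Pow I. f (insert i S) * (\<Prod>j\<in>insert i S. (x(i := y)) j))
      = y * mlpoly I (\<lambda>S. f (insert i S)) x"
    unfolding mlpoly_def sum_distrib_left by (intro sum.cong refl) (simp only: ins mult_ac)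
  ultimately show ?thesis
    by (simp only: mlpoly_def[of "insert i I"] sum_Pow_insert[OF assms])
qed

lemma all_moments_monomial: "S \<subseteq> I \<Longrightarrow> all_moments (gaussian_on I) (\<lambda>x. \<Prod>i\<in>S. x i)"
  by (intro finite_measure.all_moments_prod prob_space.finite_measure prob_space_gaussian_on)
    (auto intro: all_moments_gaussian_on)

lemma all_moments_mlpoly: "all_moments (gaussian_on I) (mlpoly I f)"
  unfolding mlpoly_def[abs_def]
  by (intro finite_measure.all_moments_sum finite_measure.all_moments_cmult all_moments_monomial
      prob_space.finite_measure prob_space_gaussian_on) auto

text \<open>Split off one variable: f = f0 + y f1 and g = g0 + y g1. After integrating over
  \<open>y\<close>, every term with a derivative carries at most a factor 3, which the drop in
  degree absorbs. Two functions with separate degree bounds are needed for the induction, because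
  the mixed terms lower only one degree; they also allow the direct application to a product of two
  polynomials.\<close>

lemma hypercontractive:
  assumes "finite I"
    and "\<And>S. S \<subseteq> I \<Longrightarrow> f S \<noteq> 0 \<Longrightarrow> card S \<le> d" "\<And>S. S \<subseteq> I \<Longrightarrow> g S \<noteq> 0 \<Longrightarrow> card S \<le> e"
  shows "(\<integral>x. (mlpoly I f x)\<^sup>2 * (mlpoly I g x)\<^sup>2 \<partial>gaussian_on I)
    \<le> 3 ^ (d + e) * ((\<Sum>S\<in>Pow I. (f S)\<^sup>2) * (\<Sum>S\<in>Pow I. (g S)\<^sup>2))"
  using assms
proof (induction I arbitrary: f g d e rule: finite_induct)
  case empty
  interpret prob_space "gaussian_on {} :: ('a \<Rightarrow> real) measure" by (rule prob_space_gaussian_on)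
  have "1 * ((f {})\<^sup>2 * (g {})\<^sup>2) \<le> 3 ^ (d + e) * ((f {})\<^sup>2 * (g {})\<^sup>2)"
    by (intro mult_right_mono) auto
  then show ?case using prob_space by (simp add: mlpoly_def)
next
  case (insert i I)
  interpret prob_space "gaussian_on I" by (rule prob_space_gaussian_on)
  note am = all_moments_mult all_moments_add all_moments_power all_moments_cmult all_moments_mlpoly
  define nrm where "nrm h = (\<Sum>S\<in>Pow I. (h S)\<^sup>2)" for h :: "'a set \<Rightarrow> real"
  define low where "low k h \<longleftrightarrow> (\<forall>S\<subseteq>I. h S \<noteq> 0 \<longrightarrow> card S \<le> k)" for k and h :: "'a set \<Rightarrow> real"
  define E where "E h h' = (\<integral>x. (mlpoly I h x)\<^sup>2 * (mlpoly I h' x)\<^sup>2 \<partial>gaussian_on I)" for h h'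
  have IH: "E h h' \<le> 3 ^ (k + l) * (nrm h * nrm h')" if "low k h" "low l h'" for h h' k l
    unfolding E_def nrm_def using that insert.IH[of h k h' l] unfolding low_def by blast
  have nrm_nonneg: "0 \<le> nrm h" for h unfolding nrm_def by (simp add: sum_nonneg)
  have E_commute: "E h h' = E h' h" for h h' unfolding E_def by (simp add: mult.commute)
  define shift where "shift h S = h (insert i S)" for h :: "'a set \<Rightarrow> real" and S
  have card_ins: "card (insert i S) = Suc (card S)" if "S \<subseteq> I" for S
    using that insert.hyps finite_subset[of S I] by (subst card_insert_disjoint) auto
  \<comment> \<open>The drop in degree from \<open>k\<close> to \<open>k - 1\<close> supplies the
    factor 3; for k = 0 the derivative vanishes.\<close>
  have IH3: "3 * E (shift h) h' \<le> 3 ^ (k + l) * (nrm (shift h) * nrm h')"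
    if h: "\<And>S. S \<subseteq> insert i I \<Longrightarrow> h S \<noteq> 0 \<Longrightarrow> card S \<le> k" and h': "low l h'" for h h' k l
  proof -
    have le: "Suc (card S) \<le> k" if "S \<subseteq> I" "shift h S \<noteq> 0" for S
      using h[of "insert i S"] that card_ins[OF that(1)] by (auto simp: shift_def)
    show ?thesis
    proof (cases k)
      case 0
      have "mlpoly I (shift h) x = 0" for x
        unfolding mlpoly_def using le 0 by (intro sum.neutral) auto
      then show ?thesis using nrm_nonneg by (simp add: E_def)
    next
      case (Suc k')
      then have "low k' (shift h)" using le unfolding low_def by auto
      from IH[OF this h'] show ?thesis using Suc by simp
    qed
  qed
  have low: "low d f" "low e g" "low e (shift g)"
  proof -
    show "low d f" "low e g" using insert.prems unfolding low_def by blast+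
    show "low e (shift g)"
      unfolding low_def
    proof (intro allI impI)
      fix S assume "S \<subseteq> I" "shift g S \<noteq> 0"
      then show "card S \<le> e"
        using insert.prems(2)[of "insert i S"] card_ins[of S]
        by (simp add: shift_def subset_insertI2 insert_mono)
    qed
  qed
  let ?f = "mlpoly I f" and ?f' = "mlpoly I (shift f)" and ?g = "mlpoly I g" and ?g' = "mlpoly I (shift g)"
  have upd: "mlpoly (insert i I) h (x(i := y)) = mlpoly I h x + y * mlpoly I (shift h) x" for h x y
    unfolding shift_def[abs_def] using insert.hyps by (rule mlpoly_insert_upd)
  have "(\<integral>x. (mlpoly (insert i I) f x)\<^sup>2 * (mlpoly (insert i I) g x)\<^sup>2 \<partial>gaussian_on (insert i I)) =
    (\<integral>x. (\<integral>y. (mlpoly (insert i I) f (x(i := y)))\<^sup>2 * (mlpoly (insert i I) g (x(i := y)))\<^sup>2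
      \<partial>std_gaussian) \<partial>gaussian_on I)"
    using insert.hyps prob_space_gaussian_on
    by (intro integral_gaussian_on_insert all_moments_mult finite_measure.all_moments_power
        all_moments_mlpoly prob_space.finite_measure) auto
  also have "\<dots> = (\<integral>x. (\<integral>y. (?f x)\<^sup>2 * (?g x)\<^sup>2
      + 2 * (?f x * ?f' x * (?g x)\<^sup>2 + (?f x)\<^sup>2 * ?g x * ?g' x) * y
      + ((?f x)\<^sup>2 * (?g' x)\<^sup>2 + (?f' x)\<^sup>2 * (?g x)\<^sup>2 + 4 * (?f x * ?f' x * ?g x * ?g' x)) * y\<^sup>2
      + 2 * (?f' x * ?f x * (?g' x)\<^sup>2 + (?f' x)\<^sup>2 * ?g x * ?g' x) * y ^ 3
      + ((?f' x)\<^sup>2 * (?g' x)\<^sup>2) * y ^ 4 \<partial>std_gaussian) \<partial>gaussian_on I)"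
    unfolding upd
    by (intro Bochner_Integration.integral_cong refl)
      (simp add: algebra_simps power2_eq_square power3_eq_cube power4_eq_xxxx)
  also have "\<dots> = (\<integral>x. (?f x)\<^sup>2 * (?g x)\<^sup>2
      + ((?f x)\<^sup>2 * (?g' x)\<^sup>2 + (?f' x)\<^sup>2 * (?g x)\<^sup>2 + 4 * (?f x * ?f' x * ?g x * ?g' x))
      + 3 * ((?f' x)\<^sup>2 * (?g' x)\<^sup>2) \<partial>gaussian_on I)"
    unfolding integral_std_gaussian_quartic ..
  also have "\<dots> \<le> (\<integral>x. (?f x)\<^sup>2 * (?g x)\<^sup>2 + 3 * ((?f x)\<^sup>2 * (?g' x)\<^sup>2)
      + 3 * ((?f' x)\<^sup>2 * (?g x)\<^sup>2) + 3 * ((?f' x)\<^sup>2 * (?g' x)\<^sup>2) \<partial>gaussian_on I)"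
  \<comment> \<open>The mixed term with coefficient 4 is at most twice the sum of the two products
    of squares, raising their coefficients from 1 to 3.\<close>
  proof (rule integral_mono)
    fix x
    have "0 \<le> (?f x * ?g' x - ?f' x * ?g x)\<^sup>2" by simp
    then show "(?f x)\<^sup>2 * (?g x)\<^sup>2
      + ((?f x)\<^sup>2 * (?g' x)\<^sup>2 + (?f' x)\<^sup>2 * (?g x)\<^sup>2 + 4 * (?f x * ?f' x * ?g x * ?g' x))
      + 3 * ((?f' x)\<^sup>2 * (?g' x)\<^sup>2) \<le> (?f x)\<^sup>2 * (?g x)\<^sup>2 + 3 * ((?f x)\<^sup>2 * (?g' x)\<^sup>2)
      + 3 * ((?f' x)\<^sup>2 * (?g x)\<^sup>2) + 3 * ((?f' x)\<^sup>2 * (?g' x)\<^sup>2)"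
      by (simp add: power2_diff power_mult_distrib algebra_simps)
  qed (intro all_moments_integrable am)+
  also have "\<dots> = E f g + 3 * E f (shift g) + 3 * E (shift f) g + 3 * E (shift f) (shift g)"
  proof -
    have int: "integrable (gaussian_on I) (\<lambda>x. (mlpoly I h x)\<^sup>2 * (mlpoly I h' x)\<^sup>2)" for h h'
      by (intro all_moments_integrable am)
    show ?thesis unfolding E_def by (simp add: int)
  qed
  also have "\<dots> \<le> 3 ^ (d + e) * (nrm f * nrm g) + 3 ^ (d + e) * (nrm f * nrm (shift g))
      + 3 ^ (d + e) * (nrm (shift f) * nrm g) + 3 ^ (d + e) * (nrm (shift f) * nrm (shift g))"
    \<comment> \<open>The term with \<open>f\<close> and \<open>shift g\<close> uses the drop in the
      degree of \<open>g\<close> through symmetry. In the last term only the degree of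
      \<open>f\<close> is lowered; for \<open>shift g\<close> the bound \<open>e\<close> is
      enough.\<close>
    using IH3[OF insert.prems(2) low(1)]
    by (intro add_mono IH IH3 low insert.prems(1)) (auto simp: E_commute[of f] add.commute mult.commute)
  also have "\<dots> = 3 ^ (d + e) * ((nrm f + nrm (shift f)) * (nrm g + nrm (shift g)))"
    by (simp add: algebra_simps)
  finally show ?case
    unfolding nrm_def shift_def sum_Pow_insert[OF insert.hyps] .
qed


section \<open>Normalized Gaussian vectors\<close>

lemma all_moments_chi_square:
  "all_moments (gaussian_on K) (\<lambda>x. \<Sum>j\<in>K. (x j)\<^sup>2 - 1)"
  by (intro finite_measure.all_moments_sum finite_measure.all_moments_diff finite_measure.all_moments_power
      finite_measure.all_moments_const all_moments_gaussian_on prob_space.finite_measure prob_space_gaussian_on)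

text \<open>The summands are independent and centred with variance 3 - 1 = 2.\<close>

lemma integral_chi_square:
  assumes "finite K"
  shows "(\<integral>x. (\<Sum>j\<in>K. (x j)\<^sup>2 - 1)\<^sup>2 \<partial>gaussian_on K) = 2 * real (card K)"
  using assms
proof (induction K rule: finite_induct)
  case empty
  then show ?case by simp
next
  case (insert i K)
  interpret prob_space "gaussian_on K" by (rule prob_space_gaussian_on)
  let ?Q = "\<lambda>x. \<Sum>j\<in>K. (x j)\<^sup>2 - 1"
  have upd: "(\<Sum>j\<in>insert i K. ((x(i := y)) j)\<^sup>2 - 1) = y\<^sup>2 - 1 + ?Q x" for x :: "'a \<Rightarrow> real" and y
  proof -
    have "?Q (x(i := y)) = ?Q x" using insert.hyps by (intro sum.cong) auto
    then show ?thesis using insert.hyps by simp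
  qed
  have "(\<integral>x. (\<Sum>j\<in>insert i K. (x j)\<^sup>2 - 1)\<^sup>2 \<partial>gaussian_on (insert i K)) =
    (\<integral>x. (\<integral>y. (\<Sum>j\<in>insert i K. ((x(i := y)) j)\<^sup>2 - 1)\<^sup>2 \<partial>std_gaussian) \<partial>gaussian_on K)"
    using insert.hyps
    by (intro integral_gaussian_on_insert finite_measure.all_moments_power all_moments_chi_square
        prob_space.finite_measure prob_space_gaussian_on) auto
  also have "\<dots> = (\<integral>x. (\<integral>y. (?Q x - 1)\<^sup>2 + 0 * y + 2 * (?Q x - 1) * y\<^sup>2 + 0 * y ^ 3 + 1 * y ^ 4
      \<partial>std_gaussian) \<partial>gaussian_on K)"
    unfolding upd
    by (intro Bochner_Integration.integral_cong refl) (simp add: power2_eq_square power4_eq_xxxx algebra_simps)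
  also have "\<dots> = (\<integral>x. (?Q x)\<^sup>2 + 2 \<partial>gaussian_on K)"
    unfolding integral_std_gaussian_quartic
    by (intro Bochner_Integration.integral_cong refl) (simp add: power2_eq_square algebra_simps)
  also have "\<dots> = 2 * real (card K) + 2"
    using insert.IH
    by (simp add: prob_space all_moments_integrable all_moments_power all_moments_chi_square)
  finally show ?case using insert.hyps by simp
qed

lemma integral_square_norm:
  assumes "finite K"
  shows "(\<integral>x. dot K x x \<partial>gaussian_on K) = real (card K)"
proof -
  interpret prob_space "gaussian_on K" by (rule prob_space_gaussian_on)
  have one: "(\<integral>x. x j * x j \<partial>gaussian_on K) = 1" if "j \<in> K" for j
  proof -
    have "dot K (\<lambda>k. if k = j then 1 else 0) x = x j" for x
      using that assms by (simp add: if_distrib[of "\<lambda>c. c * _"] cong: if_cong)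
    then show ?thesis
      using integral_dot2[OF assms, of "\<lambda>k. if k = j then 1 else 0" "\<lambda>k. if k = j then 1 else 0"]
        that assms by (simp add: if_distrib[of "\<lambda>c. c * _"] cong: if_cong)
  qed
  have "(\<integral>x. dot K x x \<partial>gaussian_on K) = (\<Sum>j\<in>K. \<integral>x. x j * x j \<partial>gaussian_on K)"
    by (intro Bochner_Integration.integral_sum all_moments_integrable all_moments_mult all_moments_gaussian_on)
  then show ?thesis using one by simp
qed

section \<open>Correlated Gaussian pairs and their normalization\<close>

abbreviation gaussian_pair :: "'j set \<Rightarrow> (('j \<Rightarrow> real) \<times> ('j \<Rightarrow> real)) measure" where
  "gaussian_pair J \<equiv> gaussian_on J \<Otimes>\<^sub>M gaussian_on J"

lemma prob_space_gaussian_pair: "prob_space (gaussian_pair J)"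
  by (intro prob_space_pair prob_space_gaussian_on)

lemma pair_sigma_finite_prob: "prob_space M \<Longrightarrow> prob_space N \<Longrightarrow> pair_sigma_finite M N"
  by (simp add: pair_sigma_finite_def prob_space_imp_sigma_finite)

lemma all_moments_gaussian_fst: "all_moments (gaussian_on J) f \<Longrightarrow> all_moments (gaussian_pair J) (\<lambda>\<omega>. f (fst \<omega>))"
  by (intro all_moments_fst prob_space_gaussian_on prob_space_imp_sigma_finite)

lemma all_moments_gaussian_snd: "all_moments (gaussian_on J) f \<Longrightarrow> all_moments (gaussian_pair J) (\<lambda>\<omega>. f (snd \<omega>))"
  by (intro all_moments_snd prob_space_gaussian_on prob_space_imp_sigma_finite)

lemma integral_gaussian_fst:
  assumes "all_moments (gaussian_on J) f"
  shows "(\<integral>\<omega>. f (fst \<omega>) \<partial>gaussian_pair J) = (\<integral>x. f x \<partial>gaussian_on J)"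
proof -
  interpret prob_space "gaussian_on J" by (rule prob_space_gaussian_on)
  have "(\<integral>x. f x \<partial>gaussian_on J) = (\<integral>x. f x \<partial>distr (gaussian_pair J) (gaussian_on J) fst)"
    by (simp add: distr_pair_fst)
  also have "\<dots> = (\<integral>\<omega>. f (fst \<omega>) \<partial>gaussian_pair J)"
    using all_moments_measurable[OF assms] by (intro integral_distr) auto
  finally show ?thesis by simp
qed

lemma integral_gaussian_snd:
  assumes "all_moments (gaussian_on J) f"
  shows "(\<integral>\<omega>. f (snd \<omega>) \<partial>gaussian_pair J) = (\<integral>x. f x \<partial>gaussian_on J)"
proof -
  interpret pair_sigma_finite "gaussian_on J" "gaussian_on J"
    by (intro pair_sigma_finite_prob prob_space_gaussian_on)
  have "(\<integral>\<omega>. f (snd \<omega>) \<partial>gaussian_pair J) = (\<integral>(x, y). f (snd (y, x)) \<partial>gaussian_pair J)"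
    using integral_product_swap[of "\<lambda>\<omega>. f (snd \<omega>)"] all_moments_measurable[OF assms]
    by (simp add: case_prod_unfold)
  then show ?thesis using integral_gaussian_fst[OF assms] by (simp add: case_prod_unfold)
qed

text \<open>The second vector of the correlated pair as a function of two independent vectors, so
  that all expectations are taken over a product measure. It is not restricted to \<open>J\<close>:
  inner products, norms and polynomials look only at coordinates in the index set.\<close>

definition correlate :: "real \<Rightarrow> ('j \<Rightarrow> real) \<times> ('j \<Rightarrow> real) \<Rightarrow> 'j \<Rightarrow> real" where
  "correlate \<rho> \<omega> j = \<rho> * fst \<omega> j + sqrt (1 - \<rho>\<^sup>2) * snd \<omega> j"

text \<open>Division by zero sends a vector of length zero to the zero vector. The bounds below use
  only that the length is at most 1, hence hold at every point and no null set has to be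
  removed.\<close>

definition unit_vec :: "'j set \<Rightarrow> ('j \<Rightarrow> real) \<Rightarrow> 'j \<Rightarrow> real" where
  "unit_vec J x j = x j / L2_set x J"

lemma L2_set_sqrt_dot: "L2_set x J = sqrt (dot J x x)"
  by (simp add: L2_set_def power2_eq_square)

lemma dot_nonneg: "0 \<le> dot J x x"
  by (simp add: sum_nonneg)

lemma L2_set_square: "(L2_set x J)\<^sup>2 = dot J x x"
  unfolding L2_set_sqrt_dot using dot_nonneg by (rule real_sqrt_pow2)

lemma dot_unit_vec: "dot J (unit_vec J x) w = dot J x w / L2_set x J"
  by (simp add: unit_vec_def sum_divide_distrib)

lemma dot_unit_vec2: "dot J (unit_vec J x) (unit_vec J y) = dot J x y / (L2_set x J * L2_set y J)"
  by (simp add: unit_vec_def sum_divide_distrib)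

lemma abs_dot_le: "\<bar>dot J x y\<bar> \<le> L2_set x J * L2_set y J"
proof -
  have "\<bar>dot J x y\<bar> \<le> (\<Sum>j\<in>J. \<bar>x j\<bar> * \<bar>y j\<bar>)"
    by (rule order_trans[OF sum_abs]) (simp add: abs_mult)
  also have "\<dots> \<le> L2_set x J * L2_set y J" by (rule L2_set_mult_ineq)
  finally show ?thesis .
qed

lemma dot_unit_vec_self: "dot J (unit_vec J x) (unit_vec J x) \<le> 1"
  by (simp only: dot_unit_vec2 L2_set_square[unfolded power2_eq_square]) simp

lemma abs_dot_le_one: "dot J x x \<le> 1 \<Longrightarrow> dot J y y \<le> 1 \<Longrightarrow> \<bar>dot J x y\<bar> \<le> 1"
  using abs_dot_le[where J=J and x=x and y=y] mult_mono[of "L2_set x J" 1 "L2_set y J" 1]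
  by (simp add: L2_set_sqrt_dot dot_nonneg)

text \<open>The fluctuation of \<open>\<parallel>x\<parallel>\<^sup>2\<close>, \<open>\<parallel>z\<parallel>\<^sup>2\<close> and \<open>x \<bullet> z\<close>; it dominates all normalization errors.\<close>

definition fluct :: "'j set \<Rightarrow> ('j \<Rightarrow> real) \<times> ('j \<Rightarrow> real) \<Rightarrow> real" where
  "fluct J \<omega> = (\<Sum>j\<in>J. (fst \<omega> j)\<^sup>2 - 1)\<^sup>2 + (dot J (fst \<omega>) (snd \<omega>))\<^sup>2 + (\<Sum>j\<in>J. (snd \<omega> j)\<^sup>2 - 1)\<^sup>2"

lemma all_moments_dot_pair: "all_moments (gaussian_pair J) (\<lambda>\<omega>. dot J (fst \<omega>) (snd \<omega>))"
  by (intro finite_measure.all_moments_sum all_moments_mult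
      all_moments_gaussian_fst[where f="\<lambda>x. x _"] all_moments_gaussian_snd[where f="\<lambda>x. x _"]
      all_moments_gaussian_on prob_space.finite_measure prob_space_gaussian_pair)

lemma all_moments_fluct: "all_moments (gaussian_pair J) (fluct J)"
  unfolding fluct_def[abs_def]
  by (intro all_moments_add finite_measure.all_moments_power all_moments_dot_pair
      all_moments_gaussian_fst[where f="\<lambda>x. \<Sum>j\<in>J. (x j)\<^sup>2 - 1"]
      all_moments_gaussian_snd[where f="\<lambda>x. \<Sum>j\<in>J. (x j)\<^sup>2 - 1"]
      all_moments_chi_square prob_space.finite_measure prob_space_gaussian_pair)

text \<open>The two squared norms contribute 2 per coordinate each, the inner product of the
  independent vectors 1.\<close>

lemma integral_fluct:
  assumes "finite J"
  shows "(\<integral>\<omega>. fluct J \<omega> \<partial>gaussian_pair J) = 5 * real (card J)"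
proof -
  interpret pair_sigma_finite "gaussian_on J" "gaussian_on J"
    by (intro pair_sigma_finite_prob prob_space_gaussian_on)
  interpret prob_space "gaussian_on J" by (rule prob_space_gaussian_on)
  interpret \<Omega>: prob_space "gaussian_pair J" by (rule prob_space_gaussian_pair)
  have chi: "all_moments (gaussian_on J) (\<lambda>x. (\<Sum>j\<in>J. (x j)\<^sup>2 - 1)\<^sup>2)"
    by (intro all_moments_power all_moments_chi_square)
  have "(\<integral>\<omega>. (dot J (fst \<omega>) (snd \<omega>))\<^sup>2 \<partial>gaussian_pair J) =
    (\<integral>x. (\<integral>z. (dot J x z)\<^sup>2 \<partial>gaussian_on J) \<partial>gaussian_on J)"
    by (subst integral_fst'[symmetric])
      (auto intro!: all_moments_integrable \<Omega>.all_moments_power all_moments_dot_pair)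
  also have "\<dots> = real (card J)"
    using assms by (simp add: power2_eq_square integral_dot2 integral_square_norm)
  finally show ?thesis
    unfolding fluct_def using assms
    by (simp add: all_moments_integrable \<Omega>.all_moments_power all_moments_dot_pair
        all_moments_gaussian_fst[OF chi] all_moments_gaussian_snd[OF chi]
        integral_gaussian_fst[OF chi] integral_gaussian_snd[OF chi] integral_chi_square)
qed

text \<open>In terms of the three deviations \<open>P\<close>, \<open>Q\<close>, \<open>R\<close>,
  each left side is the square of a linear combination with coefficients of absolute value at most
  1. The factors 2 and 3 are the numbers of summands, by Cauchy-Schwarz.\<close>

lemma
  assumes "finite J" "0 \<le> \<rho>" "\<rho> \<le> 1"
  shows fluct_fst: "(dot J (fst \<omega>) (fst \<omega>) - real (card J))\<^sup>2 \<le> fluct J \<omega>"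
    and fluct_correlate: "(dot J (correlate \<rho> \<omega>) (correlate \<rho> \<omega>) - real (card J))\<^sup>2 \<le> 3 * fluct J \<omega>"
    and fluct_dot: "(dot J (fst \<omega>) (correlate \<rho> \<omega>) - \<rho> * real (card J))\<^sup>2 \<le> 2 * fluct J \<omega>"
proof -
  define s where "s = sqrt (1 - \<rho>\<^sup>2)"
  have "\<rho>\<^sup>2 \<le> 1" using assms by (simp add: power_le_one)
  then have s2: "s\<^sup>2 = 1 - \<rho>\<^sup>2" by (simp add: s_def)
  have cor: "correlate \<rho> \<omega> j = \<rho> * fst \<omega> j + s * snd \<omega> j" for j
    by (simp add: correlate_def s_def)
  have s_le: "\<rho>\<^sup>2 \<le> 1" "s\<^sup>2 \<le> 1" using \<open>\<rho>\<^sup>2 \<le> 1\<close> s2 by auto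
  define P Q R where "P = dot J (fst \<omega>) (fst \<omega>) - real (card J)" and "Q = dot J (fst \<omega>) (snd \<omega>)"
    and "R = dot J (snd \<omega>) (snd \<omega>) - real (card J)"
  have fl: "fluct J \<omega> = P\<^sup>2 + Q\<^sup>2 + R\<^sup>2"
    by (simp add: fluct_def P_def Q_def R_def sum_subtractf power2_eq_square)
  show "(dot J (fst \<omega>) (fst \<omega>) - real (card J))\<^sup>2 \<le> fluct J \<omega>"
    unfolding fl P_def[symmetric] by simp
  have "dot J (fst \<omega>) (correlate \<rho> \<omega>) = \<rho> * dot J (fst \<omega>) (fst \<omega>) + s * Q"
    by (simp add: cor Q_def algebra_simps sum.distrib sum_distrib_left)
  then have "(dot J (fst \<omega>) (correlate \<rho> \<omega>) - \<rho> * real (card J))\<^sup>2 = (\<rho> * P + s * Q)\<^sup>2"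
    by (simp add: P_def algebra_simps)
  also have "\<dots> \<le> 2 * (\<rho>\<^sup>2 * P\<^sup>2 + s\<^sup>2 * Q\<^sup>2)"
    using sum_squares_ge_zero[of "\<rho> * P - s * Q" 0] by (simp add: power2_eq_square algebra_simps)
  also have "\<dots> \<le> 2 * (1 * P\<^sup>2 + 1 * Q\<^sup>2)"
    using s_le by (intro mult_left_mono add_mono mult_right_mono) auto
  also have "\<dots> \<le> 2 * fluct J \<omega>" unfolding fl by simp
  finally show "(dot J (fst \<omega>) (correlate \<rho> \<omega>) - \<rho> * real (card J))\<^sup>2 \<le> 2 * fluct J \<omega>" .
  have "dot J (correlate \<rho> \<omega>) (correlate \<rho> \<omega>) =
    \<rho>\<^sup>2 * dot J (fst \<omega>) (fst \<omega>) + 2 * (\<rho> * s) * Q + s\<^sup>2 * dot J (snd \<omega>) (snd \<omega>)"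
  proof -
    have "correlate \<rho> \<omega> j * correlate \<rho> \<omega> j = \<rho>\<^sup>2 * (fst \<omega> j * fst \<omega> j)
      + 2 * (\<rho> * s) * (fst \<omega> j * snd \<omega> j) + s\<^sup>2 * (snd \<omega> j * snd \<omega> j)" for j
      by (simp add: cor algebra_simps power2_eq_square)
    then show ?thesis by (simp only: Q_def sum.distrib sum_distrib_left)
  qed
  also have "\<dots> = \<rho>\<^sup>2 * P + 2 * (\<rho> * s) * Q + s\<^sup>2 * R + (\<rho>\<^sup>2 + s\<^sup>2) * real (card J)"
    by (simp add: P_def R_def algebra_simps)
  finally have "(dot J (correlate \<rho> \<omega>) (correlate \<rho> \<omega>) - real (card J))\<^sup>2 =
      (\<rho>\<^sup>2 * P + 2 * (\<rho> * s) * Q + s\<^sup>2 * R)\<^sup>2"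
    by (simp add: s2)
  also have "\<dots> \<le> 3 * ((\<rho>\<^sup>2 * P)\<^sup>2 + (2 * (\<rho> * s) * Q)\<^sup>2 + (s\<^sup>2 * R)\<^sup>2)"
  proof -
    have "(a + b + c)\<^sup>2 \<le> 3 * (a\<^sup>2 + b\<^sup>2 + c\<^sup>2)" for a b c :: real
      using zero_le_power2[of "a - b"] zero_le_power2[of "b - c"] zero_le_power2[of "a - c"]
      by (simp add: power2_eq_square algebra_simps)
    then show ?thesis .
  qed
  also have "\<dots> = 3 * ((\<rho>\<^sup>2)\<^sup>2 * P\<^sup>2 + (2 * (\<rho> * s))\<^sup>2 * Q\<^sup>2 + (s\<^sup>2)\<^sup>2 * R\<^sup>2)"
    by (simp only: power_mult_distrib)
  also have "\<dots> \<le> 3 * (1 * P\<^sup>2 + 1 * Q\<^sup>2 + 1 * R\<^sup>2)"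
  proof (intro mult_left_mono add_mono mult_right_mono)
    show "(\<rho>\<^sup>2)\<^sup>2 \<le> 1" "(s\<^sup>2)\<^sup>2 \<le> 1"
      by (rule power_le_one[OF zero_le_power2 s_le(1)], rule power_le_one[OF zero_le_power2 s_le(2)])
    \<comment> \<open>With t = \<open>\<rho>\<^sup>2\<close>, this is 4 t (1 - t) \<le> 1, which
      follows from \<open>0 \<le> (1 - 2 * t)\<^sup>2\<close>.\<close>
    have "(2 * (\<rho> * s))\<^sup>2 = 4 * \<rho>\<^sup>2 * (1 - \<rho>\<^sup>2)" by (simp add: power_mult_distrib s2)
    also have "\<dots> \<le> 1"
      using zero_le_power2[of "1 - 2 * \<rho>\<^sup>2"] by (simp add: power2_diff algebra_simps power_mult_distrib power2_eq_square)
    finally show "(2 * (\<rho> * s))\<^sup>2 \<le> 1" .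
  qed auto
  finally show "(dot J (correlate \<rho> \<omega>) (correlate \<rho> \<omega>) - real (card J))\<^sup>2 \<le> 3 * fluct J \<omega>"
    unfolding fl by simp
qed

lemma square_sum_le: "(a + b)\<^sup>2 \<le> 2 * a\<^sup>2 + 2 * (b :: real)\<^sup>2"
  using zero_le_power2[of "a - b"] by (simp add: power2_eq_square algebra_simps)

lemma fluct_nonneg: "0 \<le> fluct J \<omega>"
  by (simp add: fluct_def)

text \<open>Let n be the dimension. If a squared norm is below n/2, then \<open>n\<^sup>2\<close> is
  at most 12 times the fluctuation, while the left side is at most 4. Otherwise the norms can be
  divided out: the error times \<open>(p * q)\<^sup>2\<close> is at most 12 times the fluctuation,
  and \<open>p * q\<close> is at least n/2. Both cases lead to 48.\<close>

lemma correlation_error: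
  assumes J: "finite J" "J \<noteq> {}" and \<rho>: "0 \<le> \<rho>" "\<rho> \<le> 1"
  shows "(dot J (unit_vec J (fst \<omega>)) (unit_vec J (correlate \<rho> \<omega>)) - \<rho>)\<^sup>2 \<le> 48 * fluct J \<omega> / (real (card J))\<^sup>2"
proof -
  define n where "n = real (card J)"
  define x y where "x = fst \<omega>" and "y = correlate \<rho> \<omega>"
  define p q where "p = L2_set x J" and "q = L2_set y J"
  define r where "r = dot J (unit_vec J x) (unit_vec J y)"
  have n: "0 < n" using J by (simp add: n_def card_gt_0_iff)
  have pq: "0 \<le> p" "0 \<le> q" by (auto simp: p_def q_def)
  have P: "(p\<^sup>2 - n)\<^sup>2 \<le> fluct J \<omega>" and R: "(q\<^sup>2 - n)\<^sup>2 \<le> 3 * fluct J \<omega>"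
    and Q: "(dot J x y - \<rho> * n)\<^sup>2 \<le> 2 * fluct J \<omega>"
    using fluct_fst[OF J(1) \<rho>, of \<omega>] fluct_correlate[OF J(1) \<rho>, of \<omega>] fluct_dot[OF J(1) \<rho>, of \<omega>]
    by (simp_all only: p_def q_def L2_set_square x_def y_def n_def)
  have "n\<^sup>2 * (r - \<rho>)\<^sup>2 \<le> 48 * fluct J \<omega>"
  proof (cases "p\<^sup>2 < n / 2 \<or> q\<^sup>2 < n / 2")
    case True
    have "\<bar>r\<bar> \<le> 1"
      unfolding r_def by (intro abs_dot_le_one dot_unit_vec_self)
    then have "\<bar>r - \<rho>\<bar> \<le> 2" using \<rho> by linarith
    then have "(r - \<rho>)\<^sup>2 \<le> 2\<^sup>2" by (rule abs_le_square_iff[THEN iffD1, OF order_trans]) simp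
    then have *: "n\<^sup>2 * (r - \<rho>)\<^sup>2 \<le> n\<^sup>2 * 4" by (intro mult_left_mono) auto
    have sq: "(n / 2)\<^sup>2 \<le> (a - n)\<^sup>2" if "a < n / 2" for a
      using that n by (intro abs_le_square_iff[THEN iffD1]) (auto simp: abs_if)
    have "(n / 2)\<^sup>2 \<le> 3 * fluct J \<omega>"
      using True sq[of "p\<^sup>2"] sq[of "q\<^sup>2"] P R fluct_nonneg[of J \<omega>] by auto
    then show ?thesis using * by (simp add: power_divide)
  next
    case False
    then have pq2: "n / 2 \<le> p\<^sup>2" "n / 2 \<le> q\<^sup>2" by auto
    then have pos: "0 < p" "0 < q" using n pq by (auto simp: less_le)
    have r: "r * (p * q) = dot J x y"
      using pos by (simp add: r_def dot_unit_vec2 p_def q_def)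
    have "(n / 2)\<^sup>2 \<le> p\<^sup>2 * q\<^sup>2"
      unfolding power2_eq_square[of "n / 2"] using pq2 n by (intro mult_mono) auto
    then have lower: "(n / 2)\<^sup>2 \<le> (p * q)\<^sup>2" by (simp add: power_mult_distrib)
    \<comment> \<open>The product \<open>p * q\<close> lies between \<open>p\<^sup>2\<close> and
      \<open>q\<^sup>2\<close>, so its distance from \<open>n\<close> is at most the larger of their
      distances.\<close>
    have mid: "(n - p * q)\<^sup>2 \<le> (p\<^sup>2 - n)\<^sup>2 + (q\<^sup>2 - n)\<^sup>2"
    proof -
      have "\<bar>n - p * q\<bar> \<le> \<bar>p\<^sup>2 - n\<bar> \<or> \<bar>n - p * q\<bar> \<le> \<bar>q\<^sup>2 - n\<bar>"
      proof (cases "p \<le> q")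
        case True
        then have "p\<^sup>2 \<le> p * q" "p * q \<le> q\<^sup>2" using pq by (auto simp: power2_eq_square intro: mult_mono)
        then show ?thesis by linarith
      next
        case False
        then have "q\<^sup>2 \<le> p * q" "p * q \<le> p\<^sup>2" using pq by (auto simp: power2_eq_square intro: mult_mono)
        then show ?thesis by linarith
      qed
      then show ?thesis
        unfolding abs_le_square_iff
        using zero_le_power2[of "p\<^sup>2 - n"] zero_le_power2[of "q\<^sup>2 - n"] by linarith
    qed
    \<comment> \<open>The error splits into that of the inner product against \<rho> n and that of
      the product of the norms against n.\<close>
    have "(r - \<rho>)\<^sup>2 * (p * q)\<^sup>2 = ((dot J x y - \<rho> * n) + \<rho> * (n - p * q))\<^sup>2"
      unfolding r[symmetric] power_mult_distrib[symmetric] by (simp add: algebra_simps)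
    also have "\<dots> \<le> 2 * (dot J x y - \<rho> * n)\<^sup>2 + 2 * (\<rho> * (n - p * q))\<^sup>2"
      by (rule square_sum_le)
    also have "(\<rho> * (n - p * q))\<^sup>2 \<le> 1 * (n - p * q)\<^sup>2"
      unfolding power_mult_distrib using \<rho> by (intro mult_right_mono power_le_one) auto
    finally have "(r - \<rho>)\<^sup>2 * (p * q)\<^sup>2 \<le> 12 * fluct J \<omega>"
      using mid P Q R by linarith
    moreover have "(r - \<rho>)\<^sup>2 * (n / 2)\<^sup>2 \<le> (r - \<rho>)\<^sup>2 * (p * q)\<^sup>2"
      using lower by (intro mult_left_mono) auto
    ultimately show ?thesis by (simp add: power_divide mult.commute)
  qed
  then show ?thesis
    using n unfolding r_def x_def y_def n_def by (simp add: pos_le_divide_eq mult.commute)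
qed

text \<open>The same case distinction at half the dimension: a short vector makes the last term at
  least 1, which dominates the left side; for the others, dividing by the squared norm costs a
  factor 2 over dividing by its mean. The factor 3 in the hypothesis is the one of
  \<open>fluct_correlate\<close>.\<close>

lemma unit_vec_dot_le:
  assumes J: "finite J" "J \<noteq> {}" and a: "(dot J a a - real (card J))\<^sup>2 \<le> 3 * F" and w: "dot J w w \<le> 1"
    and F: "0 \<le> F"
  shows "(dot J (unit_vec J a) w)\<^sup>2 \<le> 2 * (dot J a w)\<^sup>2 / real (card J) + 12 * F / (real (card J))\<^sup>2"
proof -
  define n where "n = real (card J)"
  have n: "0 < n" using J by (simp add: n_def card_gt_0_iff)
  show ?thesis
    unfolding n_def[symmetric]
  proof (cases "dot J a a < n / 2")
    case True
    have "(n / 2)\<^sup>2 \<le> (dot J a a - n)\<^sup>2"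
      using True n by (intro abs_le_square_iff[THEN iffD1]) (auto simp: abs_if)
    also have "\<dots> \<le> 3 * F" using a by (simp only: n_def)
    finally have "n\<^sup>2 \<le> 12 * F" by (simp add: power_divide)
    then have "1 \<le> 12 * F / n\<^sup>2" using n by simp
    moreover have "0 \<le> 2 * (dot J a w)\<^sup>2 / n" using n by simp
    moreover have "(dot J (unit_vec J a) w)\<^sup>2 \<le> 1"
      using abs_dot_le_one[OF dot_unit_vec_self w, of a] by (simp add: abs_square_le_1)
    ultimately show "(dot J (unit_vec J a) w)\<^sup>2 \<le> 2 * (dot J a w)\<^sup>2 / n + 12 * F / n\<^sup>2" by linarith
  next
    case False
    have "(dot J (unit_vec J a) w)\<^sup>2 = (dot J a w)\<^sup>2 / dot J a a"
      by (simp only: dot_unit_vec power_divide L2_set_square)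
    also have "\<dots> \<le> (dot J a w)\<^sup>2 / (n / 2)"
      using False n by (intro divide_left_mono) auto
    also have "\<dots> = 2 * (dot J a w)\<^sup>2 / n" by simp
    finally show "(dot J (unit_vec J a) w)\<^sup>2 \<le> 2 * (dot J a w)\<^sup>2 / n + 12 * F / n\<^sup>2"
      using F n by (simp add: add_increasing2)
  qed
qed

lemma measurable_unit_vec:
  assumes "\<And>j. j \<in> J \<Longrightarrow> (\<lambda>\<omega>. a \<omega> j) \<in> borel_measurable M" "j \<in> J"
  shows "(\<lambda>\<omega>. unit_vec J (a \<omega>) j) \<in> borel_measurable M"
  unfolding unit_vec_def L2_set_def using assms
  by (intro borel_measurable_divide borel_measurable_sqrt[THEN measurable_compose[rotated]]
      borel_measurable_sum borel_measurable_power) auto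

lemma measurable_fst_component: "j \<in> J \<Longrightarrow> (\<lambda>\<omega>. fst \<omega> j) \<in> borel_measurable (gaussian_pair J)"
  by (intro all_moments_measurable all_moments_gaussian_fst[where f="\<lambda>x. x j"] all_moments_gaussian_on)

lemma measurable_correlate: "j \<in> J \<Longrightarrow> (\<lambda>\<omega>. correlate \<rho> \<omega> j) \<in> borel_measurable (gaussian_pair J)"
  unfolding correlate_def
  by (intro borel_measurable_add borel_measurable_times borel_measurable_const measurable_fst_component
     all_moments_measurable[OF all_moments_gaussian_snd[where f="\<lambda>x. x j"]] all_moments_gaussian_on)

lemma integral_correlation_error:
  assumes J: "finite J" "J \<noteq> {}" and \<rho>: "0 \<le> \<rho>" "\<rho> \<le> 1"
  shows "(\<integral>\<omega>. (dot J (unit_vec J (fst \<omega>)) (unit_vec J (correlate \<rho> \<omega>)) - \<rho>)\<^sup>2 \<partial>gaussian_pair J)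
    \<le> 240 / real (card J)"
proof -
  interpret prob_space "gaussian_pair J" by (rule prob_space_gaussian_pair)
  have "(\<integral>\<omega>. (dot J (unit_vec J (fst \<omega>)) (unit_vec J (correlate \<rho> \<omega>)) - \<rho>)\<^sup>2 \<partial>gaussian_pair J)
    \<le> (\<integral>\<omega>. 48 * fluct J \<omega> / (real (card J))\<^sup>2 \<partial>gaussian_pair J)"
  proof (rule integral_mono')
    show "integrable (gaussian_pair J) (\<lambda>\<omega>. 48 * fluct J \<omega> / (real (card J))\<^sup>2)"
      by (simp add: all_moments_integrable all_moments_fluct)
  qed (simp_all only: correlation_error[OF assms] fluct_nonneg divide_nonneg_nonneg mult_nonneg_nonneg zero_le_power2 zero_le_numeral)
  also have "\<dots> = 240 / real (card J)"
    using J by (simp add: integral_fluct power2_eq_square)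
  finally show ?thesis .
qed

text \<open>A random direction has a small component along any fixed \<open>w\<close>. The
  fluctuation term gives 12 * 5 = 60, and the Gaussian component adds at most 2 for the first vector
  and 4 for the second, hence 64.\<close>

lemma integral_unit_vec_dot:
  assumes J: "finite J" "J \<noteq> {}" and \<rho>: "0 \<le> \<rho>" "\<rho> \<le> 1" and w: "dot J w w \<le> 1"
  shows "(\<integral>\<omega>. (dot J (unit_vec J (fst \<omega>)) w)\<^sup>2 \<partial>gaussian_pair J) \<le> 64 / real (card J)"
    and "(\<integral>\<omega>. (dot J (unit_vec J (correlate \<rho> \<omega>)) w)\<^sup>2 \<partial>gaussian_pair J) \<le> 64 / real (card J)"
proof -
  interpret prob_space "gaussian_pair J" by (rule prob_space_gaussian_pair)
  interpret G: prob_space "gaussian_on J" by (rule prob_space_gaussian_on)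
  define n where "n = real (card J)"
  have n: "0 < n" using J by (simp add: n_def card_gt_0_iff)
  \<comment> \<open>A majorant of \<open>(dot J (correlate \<rho> \<omega>) w)\<^sup>2\<close>
    without a mixed term, so that its integral involves only the two marginals.\<close>
  define G where "G \<omega> = 2 * \<rho>\<^sup>2 * (dot J w (fst \<omega>))\<^sup>2 + 2 * (1 - \<rho>\<^sup>2) * (dot J w (snd \<omega>))\<^sup>2" for \<omega> :: "('a \<Rightarrow> real) \<times> ('a \<Rightarrow> real)"
  have dot2: "all_moments (gaussian_on J) (\<lambda>x. (dot J w x)\<^sup>2)"
    by (intro G.all_moments_power all_moments_dot)
  have int: "(\<integral>x. (dot J w x)\<^sup>2 \<partial>gaussian_on J) = dot J w w"
    using J(1) by (simp only: power2_eq_square integral_dot2)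
  note am = all_moments_gaussian_fst[OF dot2] all_moments_gaussian_snd[OF dot2]
  have fl: "integrable (gaussian_pair J) (\<lambda>\<omega>. 12 * fluct J \<omega> / n\<^sup>2)"
      "(\<integral>\<omega>. 12 * fluct J \<omega> / n\<^sup>2 \<partial>gaussian_pair J) = 60 / n"
    using J(1) n by (simp_all add: all_moments_integrable all_moments_fluct integral_fluct n_def power2_eq_square)
  have le1: "(dot J (unit_vec J (fst \<omega>)) w)\<^sup>2 \<le> 2 * (dot J w (fst \<omega>))\<^sup>2 / n + 12 * fluct J \<omega> / n\<^sup>2" for \<omega>
  proof -
    have "(dot J (fst \<omega>) (fst \<omega>) - real (card J))\<^sup>2 \<le> 3 * fluct J \<omega>"
      using fluct_fst[OF J(1) \<rho>, of \<omega>] fluct_nonneg[of J \<omega>] by linarith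
    from unit_vec_dot_le[OF J this w fluct_nonneg] show ?thesis by (simp add: n_def mult.commute)
  qed
  have "(\<integral>\<omega>. (dot J (unit_vec J (fst \<omega>)) w)\<^sup>2 \<partial>gaussian_pair J)
    \<le> (\<integral>\<omega>. 2 * (dot J w (fst \<omega>))\<^sup>2 / n + 12 * fluct J \<omega> / n\<^sup>2 \<partial>gaussian_pair J)"
    by (rule integral_mono'[OF _ le1 order_trans[OF zero_le_power2 le1]])
      (use fl(1) am in \<open>simp add: all_moments_integrable\<close>)
  also have "\<dots> = 2 * dot J w w / n + 60 / n"
    using am fl by (simp add: all_moments_integrable integral_gaussian_fst[OF dot2] int)
  also have "\<dots> \<le> 64 / n"
    using n w by (simp add: divide_simps)
  finally show "(\<integral>\<omega>. (dot J (unit_vec J (fst \<omega>)) w)\<^sup>2 \<partial>gaussian_pair J) \<le> 64 / real (card J)"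
    by (simp add: n_def)
  have s: "(sqrt (1 - \<rho>\<^sup>2))\<^sup>2 = 1 - \<rho>\<^sup>2" using \<rho> by (simp add: power_le_one)
  have G: "(dot J (correlate \<rho> \<omega>) w)\<^sup>2 \<le> G \<omega>" for \<omega>
  proof -
    have "dot J (correlate \<rho> \<omega>) w = \<rho> * dot J w (fst \<omega>) + sqrt (1 - \<rho>\<^sup>2) * dot J w (snd \<omega>)"
      by (simp add: correlate_def algebra_simps sum.distrib sum_distrib_left)
    then have "(dot J (correlate \<rho> \<omega>) w)\<^sup>2
        \<le> 2 * (\<rho> * dot J w (fst \<omega>))\<^sup>2 + 2 * (sqrt (1 - \<rho>\<^sup>2) * dot J w (snd \<omega>))\<^sup>2"
      by (simp only: square_sum_le)
    then show ?thesis by (simp only: G_def power_mult_distrib s mult.assoc)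
  qed
  have le2: "(dot J (unit_vec J (correlate \<rho> \<omega>)) w)\<^sup>2 \<le> 2 * G \<omega> / n + 12 * fluct J \<omega> / n\<^sup>2" for \<omega>
  proof -
    have "2 * (dot J (correlate \<rho> \<omega>) w)\<^sup>2 / n \<le> 2 * G \<omega> / n"
      using n G[of \<omega>] by (intro divide_right_mono) auto
    then show ?thesis
      using unit_vec_dot_le[OF J fluct_correlate[OF J(1) \<rho>] w fluct_nonneg, of \<omega>] unfolding n_def
      by linarith
  qed
  have "(\<integral>\<omega>. G \<omega> \<partial>gaussian_pair J) = 2 * \<rho>\<^sup>2 * dot J w w + 2 * (1 - \<rho>\<^sup>2) * dot J w w"
    unfolding G_def using am
    by (simp add: all_moments_integrable integral_gaussian_fst[OF dot2] integral_gaussian_snd[OF dot2] int)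
  then have G_int: "(\<integral>\<omega>. G \<omega> \<partial>gaussian_pair J) = 2 * dot J w w"
    by (simp add: algebra_simps)
  have G_integrable: "integrable (gaussian_pair J) G"
    unfolding G_def[abs_def] using am by (simp add: all_moments_integrable)
  have "(\<integral>\<omega>. (dot J (unit_vec J (correlate \<rho> \<omega>)) w)\<^sup>2 \<partial>gaussian_pair J)
    \<le> (\<integral>\<omega>. 2 * G \<omega> / n + 12 * fluct J \<omega> / n\<^sup>2 \<partial>gaussian_pair J)"
    by (rule integral_mono'[OF _ le2 order_trans[OF zero_le_power2 le2]]) (use fl(1) G_integrable in simp)
  also have "\<dots> = 2 * (2 * dot J w w) / n + 60 / n"
    using fl G_integrable by (simp add: G_int)
  also have "\<dots> \<le> 64 / n"
    using n w by (simp add: divide_simps)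
  finally show "(\<integral>\<omega>. (dot J (unit_vec J (correlate \<rho> \<omega>)) w)\<^sup>2 \<partial>gaussian_pair J) \<le> 64 / real (card J)"
    by (simp add: n_def)
qed


section \<open>Second moments of the compressed correlation\<close>

lemma abs_unit_vec_le: "finite J \<Longrightarrow> j \<in> J \<Longrightarrow> \<bar>unit_vec J x j\<bar> \<le> 1"
proof -
  assume *: "finite J" "j \<in> J"
  have "\<bar>x j\<bar> = sqrt ((x j)\<^sup>2)" by simp
  also have "\<dots> \<le> L2_set x J"
    unfolding L2_set_def using * by (intro real_sqrt_le_mono member_le_sum) auto
  finally have "\<bar>x j\<bar> \<le> L2_set x J" .
  moreover have "0 \<le> L2_set x J" by (rule L2_set_nonneg)
  ultimately show ?thesis
    unfolding unit_vec_def abs_divide by (cases "L2_set x J = 0") (auto simp: divide_simps)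
qed

lemma all_moments_unit_vec:
  assumes "finite J" "j \<in> J" "finite_measure M"
    and "\<And>j. j \<in> J \<Longrightarrow> (\<lambda>\<omega>. a \<omega> j) \<in> borel_measurable M"
  shows "all_moments M (\<lambda>\<omega>. unit_vec J (a \<omega>) j)"
  using assms by (intro finite_measure.all_moments_bounded[where K=1] measurable_unit_vec abs_unit_vec_le)

text \<open>Joint integrability in matrix and vectors, as Fubini's theorem requires: Gaussian
  entries are multiplied by bounded coordinates.\<close>

lemma all_moments_row_unit_vec:
  fixes a :: "'c \<Rightarrow> 'j \<Rightarrow> real"
  assumes "finite J" "i \<in> I" and N: "prob_space N"
    and "\<And>j. j \<in> J \<Longrightarrow> (\<lambda>\<omega>. a \<omega> j) \<in> borel_measurable N"
  shows "all_moments (gaussian_on (I \<times> J) \<Otimes>\<^sub>M N) (\<lambda>p. row_dot J (fst p) (unit_vec J (a (snd p))) i)"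
  unfolding row_dot_def
proof (intro finite_measure.all_moments_sum all_moments_mult)
  interpret N: prob_space N by fact
  show "finite_measure (gaussian_on (I \<times> J) \<Otimes>\<^sub>M N)"
    by (intro prob_space.finite_measure prob_space_pair prob_space_gaussian_on N)
  fix j assume j: "j \<in> J"
  show "all_moments (gaussian_on (I \<times> J) \<Otimes>\<^sub>M N) (\<lambda>p. fst p (i, j))"
    using j assms
    by (intro all_moments_fst[where f="\<lambda>M. M (i, j)"] all_moments_gaussian_on prob_space_gaussian_on
        prob_space_imp_sigma_finite N) auto
  show "all_moments (gaussian_on (I \<times> J) \<Otimes>\<^sub>M N) (\<lambda>p. unit_vec J (a (snd p)) j)"
    by (intro all_moments_snd[where f="\<lambda>\<omega>. unit_vec J (a \<omega>) j"] prob_space_gaussian_on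
        prob_space_imp_sigma_finite N all_moments_unit_vec N.finite_measure assms j)
qed

text \<open>A monomial in the entries of \<open>M u\<close> times one in the entries of
  \<open>M v\<close>. The two row sets form one index, so that the product of the expansions of
  \<open>A\<close> and \<open>B\<close> is a single sum.\<close>

definition form ::
    "'j set \<Rightarrow> real \<Rightarrow> 'i set \<times> 'i set \<Rightarrow> ('i \<times> 'j \<Rightarrow> real) \<Rightarrow> ('j \<Rightarrow> real) \<times> ('j \<Rightarrow> real) \<Rightarrow> real" where
  "form J \<rho> p M \<omega> = (\<Prod>i\<in>fst p. row_dot J M (unit_vec J (fst \<omega>)) i)
     * (\<Prod>i\<in>snd p. row_dot J M (unit_vec J (correlate \<rho> \<omega>)) i)"

definition avg :: "'j set \<Rightarrow> real \<Rightarrow> 'i set \<times> 'i set \<Rightarrow> ('i \<times> 'j \<Rightarrow> real) \<Rightarrow> real" where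
  "avg J \<rho> p M = (\<integral>\<omega>. form J \<rho> p M \<omega> \<partial>gaussian_pair J)"

definition corr :: "'j set \<Rightarrow> real \<Rightarrow> ('j \<Rightarrow> real) \<times> ('j \<Rightarrow> real) \<Rightarrow> real" where
  "corr J \<rho> \<omega> = dot J (unit_vec J (fst \<omega>)) (unit_vec J (correlate \<rho> \<omega>))"

definition corr_moment :: "'j set \<Rightarrow> real \<Rightarrow> nat \<Rightarrow> real" where
  "corr_moment J \<rho> k = (\<integral>\<omega>. corr J \<rho> \<omega> ^ k \<partial>gaussian_pair J)"

lemma abs_corr_le: "\<bar>corr J \<rho> \<omega>\<bar> \<le> 1"
  unfolding corr_def by (intro abs_dot_le_one dot_unit_vec_self)

lemma all_moments_corr: "finite J \<Longrightarrow> all_moments (gaussian_pair J) (corr J \<rho>)"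
  unfolding corr_def[abs_def]
  by (intro finite_measure.all_moments_sum all_moments_mult all_moments_unit_vec measurable_fst_component
      measurable_correlate prob_space.finite_measure prob_space_gaussian_pair)

text \<open>The map \<open>g\<close> lets one statement serve a single pair of vectors (the
  identity) and two independent copies (the projections).\<close>

lemma all_moments_form:
  assumes "finite J" "p \<in> Pow I \<times> Pow I" "prob_space N" "g \<in> N \<rightarrow>\<^sub>M gaussian_pair J"
  shows "all_moments (gaussian_on (I \<times> J) \<Otimes>\<^sub>M N) (\<lambda>q. form J \<rho> p (fst q) (g (snd q)))"
proof -
  interpret N: prob_space N by fact
  have fin: "finite_measure (gaussian_on (I \<times> J) \<Otimes>\<^sub>M N)"
    by (intro prob_space.finite_measure prob_space_pair prob_space_gaussian_on assms)
  have m: "(\<lambda>\<omega>. fst (g \<omega>) j) \<in> borel_measurable N" "(\<lambda>\<omega>. correlate \<rho> (g \<omega>) j) \<in> borel_measurable N"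
    if "j \<in> J" for j
    using measurable_compose[OF assms(4) measurable_fst_component[OF that]]
      measurable_compose[OF assms(4) measurable_correlate[OF that]] by simp_all
  show ?thesis
    unfolding form_def using assms
    by (intro all_moments_mult finite_measure.all_moments_prod fin
        all_moments_row_unit_vec[where a="\<lambda>\<omega>. fst (g \<omega>)"] all_moments_row_unit_vec[where a="\<lambda>\<omega>. correlate \<rho> (g \<omega>)"] m)
      auto
qed

lemma all_moments_form_fixed:
  assumes "finite J"
  shows "all_moments (gaussian_pair J) (form J \<rho> p M)"
  unfolding form_def[abs_def] row_dot_def using assms
  by (intro all_moments_mult finite_measure.all_moments_prod finite_measure.all_moments_sum
      finite_measure.all_moments_cmult all_moments_unit_vec measurable_fst_component measurable_correlate
      prob_space.finite_measure prob_space_gaussian_pair)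

lemma integral_form:
  assumes "finite I" "finite J" "S \<subseteq> I" "T \<subseteq> I"
  shows "integrable (gaussian_on (I \<times> J)) (avg J \<rho> (S, T))"
    and "(\<integral>M. avg J \<rho> (S, T) M \<partial>gaussian_on (I \<times> J)) = (if S = T then corr_moment J \<rho> (card S) else 0)"
proof -
  interpret pair_sigma_finite "gaussian_on (I \<times> J)" "gaussian_pair J"
    by (intro pair_sigma_finite_prob prob_space_gaussian_on prob_space_gaussian_pair)
  have "all_moments (gaussian_on (I \<times> J) \<Otimes>\<^sub>M gaussian_pair J) (\<lambda>q. form J \<rho> (S, T) (fst q) (snd q))"
    using assms by (intro all_moments_form[where g="\<lambda>\<omega>. \<omega>"] prob_space_gaussian_pair) auto
  then have int: "integrable (gaussian_on (I \<times> J) \<Otimes>\<^sub>M gaussian_pair J) (\<lambda>(M, \<omega>). form J \<rho> (S, T) M \<omega>)"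
    by (simp add: all_moments_integrable case_prod_unfold)
  show "integrable (gaussian_on (I \<times> J)) (avg J \<rho> (S, T))"
    using integrable_fst'[OF int] by (simp add: avg_def[abs_def])
  have "(\<integral>M. avg J \<rho> (S, T) M \<partial>gaussian_on (I \<times> J)) =
    (\<integral>\<omega>. (\<integral>M. form J \<rho> (S, T) M \<omega> \<partial>gaussian_on (I \<times> J)) \<partial>gaussian_pair J)"
    unfolding avg_def by (rule Fubini_integral[OF int, symmetric])
  also have "\<dots> = (\<integral>\<omega>. (if S = T then corr J \<rho> \<omega> ^ card S else 0) \<partial>gaussian_pair J)"
    unfolding form_def corr_def fst_conv snd_conv integral_rows2[OF assms] ..
  finally show "(\<integral>M. avg J \<rho> (S, T) M \<partial>gaussian_on (I \<times> J)) = (if S = T then corr_moment J \<rho> (card S) else 0)"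
    by (simp add: corr_moment_def)
qed

lemma integral_mult_pair:
  fixes f :: "'a \<Rightarrow> real" and g :: "'b \<Rightarrow> real"
  assumes "prob_space M" "prob_space N" "all_moments M f" "all_moments N g"
  shows "(\<integral>p. f (fst p) * g (snd p) \<partial>(M \<Otimes>\<^sub>M N)) = (\<integral>x. f x \<partial>M) * (\<integral>y. g y \<partial>N)"
proof -
  interpret pair_sigma_finite M N
    using assms by (intro pair_sigma_finite_prob)
  have "integrable (M \<Otimes>\<^sub>M N) (\<lambda>p. f (fst p) * g (snd p))"
    using assms
    by (intro all_moments_integrable all_moments_mult all_moments_fst all_moments_snd prob_space_imp_sigma_finite)
  from integral_fst'[OF this] show ?thesis by simp
qed

text \<open>A product of two averages over the vectors is one average over two independent copies.
  Exchanging it with the integral over the matrix makes \<open>integral_rows4\<close> applicable at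
  fixed vectors.\<close>

lemma integral_avg_mult:
  assumes "finite I" "finite J" "S \<subseteq> I" "T \<subseteq> I" "S' \<subseteq> I" "T' \<subseteq> I"
  shows "integrable (gaussian_on (I \<times> J)) (\<lambda>M. avg J \<rho> (S, T) M * avg J \<rho> (S', T') M)"
    and "(\<integral>M. avg J \<rho> (S, T) M * avg J \<rho> (S', T') M \<partial>gaussian_on (I \<times> J)) =
      (\<integral>q. (\<Prod>i\<in>I. wick (corr J \<rho> (fst q)) (corr J \<rho> (snd q))
          (dot J (unit_vec J (fst (fst q))) (unit_vec J (fst (snd q))))
          (dot J (unit_vec J (fst (fst q))) (unit_vec J (correlate \<rho> (snd q))))
          (dot J (unit_vec J (correlate \<rho> (fst q))) (unit_vec J (fst (snd q))))
          (dot J (unit_vec J (correlate \<rho> (fst q))) (unit_vec J (correlate \<rho> (snd q))))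
          (i \<in> S) (i \<in> T) (i \<in> S') (i \<in> T')) \<partial>(gaussian_pair J \<Otimes>\<^sub>M gaussian_pair J))"
proof -
  let ?P2 = "gaussian_pair J \<Otimes>\<^sub>M gaussian_pair J"
  have P2: "prob_space ?P2" by (intro prob_space_pair prob_space_gaussian_pair)
  interpret pair_sigma_finite "gaussian_on (I \<times> J)" ?P2
    by (intro pair_sigma_finite_prob prob_space_gaussian_on P2)
  have "all_moments (gaussian_on (I \<times> J) \<Otimes>\<^sub>M ?P2)
      (\<lambda>q. form J \<rho> (S, T) (fst q) (fst (snd q)) * form J \<rho> (S', T') (fst q) (snd (snd q)))"
    using assms by (intro all_moments_mult all_moments_form P2) auto
  then have int: "integrable (gaussian_on (I \<times> J) \<Otimes>\<^sub>M ?P2)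
      (\<lambda>(M, q). form J \<rho> (S, T) M (fst q) * form J \<rho> (S', T') M (snd q))"
    by (simp add: all_moments_integrable case_prod_unfold)
  have avg: "avg J \<rho> (S, T) M * avg J \<rho> (S', T') M =
      (\<integral>q. form J \<rho> (S, T) M (fst q) * form J \<rho> (S', T') M (snd q) \<partial>?P2)" for M
    unfolding avg_def using assms(2)
    by (intro integral_mult_pair[symmetric] prob_space_gaussian_pair all_moments_form_fixed)
  show "integrable (gaussian_on (I \<times> J)) (\<lambda>M. avg J \<rho> (S, T) M * avg J \<rho> (S', T') M)"
    unfolding avg using integrable_fst'[OF int] by simp
  have "(\<integral>M. avg J \<rho> (S, T) M * avg J \<rho> (S', T') M \<partial>gaussian_on (I \<times> J)) =
    (\<integral>q. (\<integral>M. form J \<rho> (S, T) M (fst q) * form J \<rho> (S', T') M (snd q) \<partial>gaussian_on (I \<times> J)) \<partial>?P2)"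
    unfolding avg by (rule Fubini_integral[OF int, symmetric])
  then show "(\<integral>M. avg J \<rho> (S, T) M * avg J \<rho> (S', T') M \<partial>gaussian_on (I \<times> J)) =
      (\<integral>q. (\<Prod>i\<in>I. wick (corr J \<rho> (fst q)) (corr J \<rho> (snd q))
          (dot J (unit_vec J (fst (fst q))) (unit_vec J (fst (snd q))))
          (dot J (unit_vec J (fst (fst q))) (unit_vec J (correlate \<rho> (snd q))))
          (dot J (unit_vec J (correlate \<rho> (fst q))) (unit_vec J (fst (snd q))))
          (dot J (unit_vec J (correlate \<rho> (fst q))) (unit_vec J (correlate \<rho> (snd q))))
          (i \<in> S) (i \<in> T) (i \<in> S') (i \<in> T')) \<partial>(gaussian_pair J \<Otimes>\<^sub>M gaussian_pair J))"
    unfolding form_def corr_def fst_conv snd_conv integral_rows4[OF assms] .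
qed

section \<open>The sign symmetry\<close>

lemma distr_uminus_gaussian_pair:
  assumes "finite J"
  shows "distr (gaussian_pair J) (gaussian_pair J) (\<lambda>(x, z). (\<lambda>j\<in>J. - x j, \<lambda>j\<in>J. - z j)) = gaussian_pair J"
proof -
  interpret prob_space "gaussian_on J" by (rule prob_space_gaussian_on)
  have m: "(\<lambda>x. \<lambda>j\<in>J. - x j) \<in> gaussian_on J \<rightarrow>\<^sub>M gaussian_on J"
    by (intro measurable_restrict) (auto intro!: measurable_compose[OF measurable_component_singleton])
  show ?thesis
    using pair_measure_distr[OF m m] distr_uminus_gaussian_on[OF assms] sigma_finite_measure_axioms by simp
qed

text \<open>Changing the sign of both independent vectors preserves the measure, negates the
  correlated vector by linearity and leaves the norms alone. It works for each fixed matrix, and it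
  provides the parity hypothesis of \<open>prod_wick_approx\<close>.\<close>

lemma avg_odd:
  fixes M :: "'i \<times> 'j \<Rightarrow> real"
  assumes "finite J" "odd (card S + card T)"
  shows "avg J \<rho> (S, T) M = 0"
proof -
  define neg :: "('j \<Rightarrow> real) \<times> ('j \<Rightarrow> real) \<Rightarrow> _" where
    "neg = (\<lambda>(x, z). (\<lambda>j\<in>J. - x j, \<lambda>j\<in>J. - z j))"
  have neg: "neg \<in> gaussian_pair J \<rightarrow>\<^sub>M gaussian_pair J"
  proof -
    have m: "(\<lambda>x. \<lambda>j\<in>J. - x j) \<in> gaussian_on J \<rightarrow>\<^sub>M gaussian_on J"
      by (intro measurable_restrict) (auto intro!: measurable_compose[OF measurable_component_singleton])
    show ?thesis unfolding neg_def case_prod_unfold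
      by (intro measurable_Pair measurable_compose[OF measurable_fst m] measurable_compose[OF measurable_snd m])
  qed
  have unit: "unit_vec J x j = - unit_vec J y j" if "\<And>j. j \<in> J \<Longrightarrow> x j = - y j" "j \<in> J"
    for x y :: "'j \<Rightarrow> real" and j
  proof -
    have "L2_set x J = L2_set y J"
      unfolding L2_set_def using that(1) by (intro arg_cong[where f=sqrt] sum.cong) auto
    then show ?thesis using that by (simp add: unit_vec_def)
  qed
  have row_dot_neg: "row_dot J M (unit_vec J x) i = - row_dot J M (unit_vec J y) i" if "\<And>j. j \<in> J \<Longrightarrow> x j = - y j"
    for x y :: "'j \<Rightarrow> real" and i
    unfolding row_dot_def sum_negf[symmetric] using unit[OF that] by (intro sum.cong) auto
  have "fst (neg \<omega>) j = - fst \<omega> j" "correlate \<rho> (neg \<omega>) j = - correlate \<rho> \<omega> j" if "j \<in> J" for \<omega> j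
    using that by (auto simp: neg_def correlate_def case_prod_unfold algebra_simps)
  then have "form J \<rho> (S, T) M (neg \<omega>) = (\<Prod>i\<in>S. - row_dot J M (unit_vec J (fst \<omega>)) i)
      * (\<Prod>i\<in>T. - row_dot J M (unit_vec J (correlate \<rho> \<omega>)) i)" for \<omega>
    unfolding form_def fst_conv snd_conv by (intro arg_cong2[where f=times] prod.cong refl row_dot_neg) auto
  then have "form J \<rho> (S, T) M (neg \<omega>) = (- 1) ^ (card S + card T) * form J \<rho> (S, T) M \<omega>" for \<omega>
    by (simp add: form_def prod_uminus power_add)
  then have odd_form: "form J \<rho> (S, T) M (neg \<omega>) = - form J \<rho> (S, T) M \<omega>" for \<omega>
    using assms(2) by simp
  have "avg J \<rho> (S, T) M = (\<integral>\<omega>. form J \<rho> (S, T) M \<omega> \<partial>distr (gaussian_pair J) (gaussian_pair J) neg)"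
    unfolding avg_def neg_def distr_uminus_gaussian_pair[OF assms(1)] ..
  also have "\<dots> = (\<integral>\<omega>. form J \<rho> (S, T) M (neg \<omega>) \<partial>gaussian_pair J)"
    by (rule integral_distr[OF neg all_moments_measurable[OF all_moments_form_fixed[OF assms(1)]]])
  also have "\<dots> = - avg J \<rho> (S, T) M"
    unfolding odd_form avg_def by simp
  finally show ?thesis by simp
qed


section \<open>Bias and covariance of the averaged monomials\<close>

lemma (in prob_space) square_integral_le:
  assumes "all_moments M f"
  shows "(\<integral>x. f x \<partial>M)\<^sup>2 \<le> (\<integral>x. (f x)\<^sup>2 \<partial>M)"
proof -
  have int: "integrable M f" "integrable M (\<lambda>x. (f x)\<^sup>2)"
    using assms by (auto intro: all_moments_integrable all_moments_power)
  have "0 \<le> variance f" by simp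
  also have "\<dots> = (\<integral>x. (f x)\<^sup>2 \<partial>M) - (\<integral>x. f x \<partial>M)\<^sup>2"
    using int by (rule variance_eq)
  finally show ?thesis by simp
qed

text \<open>On [-1, 1] the power with exponent \<open>k\<close> is Lipschitz with constant
  \<open>k\<close>, and the square of a mean is at most the mean of the square. The constant 240 is
  48 * 5.\<close>

lemma corr_moment_error:
  assumes J: "finite J" "J \<noteq> {}" and \<rho>: "0 \<le> \<rho>" "\<rho> \<le> 1"
  shows "\<bar>corr_moment J \<rho> k - \<rho> ^ k\<bar> \<le> real k * sqrt (240 / real (card J))"
proof -
  interpret prob_space "gaussian_pair J" by (rule prob_space_gaussian_pair)
  note am = all_moments_corr[OF J(1), of \<rho>]
  have diff: "all_moments (gaussian_pair J) (\<lambda>\<omega>. corr J \<rho> \<omega> ^ k - \<rho> ^ k)"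
    by (intro all_moments_diff all_moments_power all_moments_const am)
  have "corr_moment J \<rho> k - \<rho> ^ k = (\<integral>\<omega>. corr J \<rho> \<omega> ^ k - \<rho> ^ k \<partial>gaussian_pair J)"
    by (simp add: corr_moment_def all_moments_integrable all_moments_power am prob_space)
  then have "(corr_moment J \<rho> k - \<rho> ^ k)\<^sup>2 \<le> (\<integral>\<omega>. (corr J \<rho> \<omega> ^ k - \<rho> ^ k)\<^sup>2 \<partial>gaussian_pair J)"
    using square_integral_le[OF diff] by simp
  also have "\<dots> \<le> (\<integral>\<omega>. (real k)\<^sup>2 * (corr J \<rho> \<omega> - \<rho>)\<^sup>2 \<partial>gaussian_pair J)"
  proof (rule integral_mono)
    fix \<omega>
    have "\<bar>corr J \<rho> \<omega> ^ k - \<rho> ^ k\<bar> \<le> real k * \<bar>corr J \<rho> \<omega> - \<rho>\<bar>"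
      using norm_power_diff[of "corr J \<rho> \<omega>" \<rho> k] abs_corr_le[of J \<rho> \<omega>] \<rho> by simp
    then have "(corr J \<rho> \<omega> ^ k - \<rho> ^ k)\<^sup>2 \<le> (real k * \<bar>corr J \<rho> \<omega> - \<rho>\<bar>)\<^sup>2"
      using power_mono[of "\<bar>corr J \<rho> \<omega> ^ k - \<rho> ^ k\<bar>" "real k * \<bar>corr J \<rho> \<omega> - \<rho>\<bar>" 2] by simp
    then show "(corr J \<rho> \<omega> ^ k - \<rho> ^ k)\<^sup>2 \<le> (real k)\<^sup>2 * (corr J \<rho> \<omega> - \<rho>)\<^sup>2"
      by (simp add: power_mult_distrib)
  qed (intro all_moments_integrable all_moments_power all_moments_cmult all_moments_diff all_moments_const am)+
  also have "\<dots> = (real k)\<^sup>2 * (\<integral>\<omega>. (corr J \<rho> \<omega> - \<rho>)\<^sup>2 \<partial>gaussian_pair J)" by simp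
  also have "\<dots> \<le> (real k)\<^sup>2 * (240 / real (card J))"
    unfolding corr_def by (intro mult_left_mono integral_correlation_error assms) auto
  finally have "sqrt ((corr_moment J \<rho> k - \<rho> ^ k)\<^sup>2) \<le> sqrt ((real k)\<^sup>2 * (240 / real (card J)))"
    by (rule real_sqrt_le_mono)
  then show ?thesis by (simp add: real_sqrt_mult del: times_divide_eq_right)
qed

text \<open>A sum of squares, because it dominates the square of the largest cross product and can
  be integrated term by term.\<close>

definition cross :: "'j set \<Rightarrow> real \<Rightarrow> (('j \<Rightarrow> real) \<times> ('j \<Rightarrow> real)) \<times> (('j \<Rightarrow> real) \<times> ('j \<Rightarrow> real)) \<Rightarrow> real" where
  "cross J \<rho> q = (dot J (unit_vec J (fst (fst q))) (unit_vec J (fst (snd q))))\<^sup>2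
    + (dot J (unit_vec J (fst (fst q))) (unit_vec J (correlate \<rho> (snd q))))\<^sup>2
    + (dot J (unit_vec J (correlate \<rho> (fst q))) (unit_vec J (fst (snd q))))\<^sup>2
    + (dot J (unit_vec J (correlate \<rho> (fst q))) (unit_vec J (correlate \<rho> (snd q))))\<^sup>2"

lemma all_moments_unit_vec_dot:
  assumes "finite J"
    and "\<And>j. j \<in> J \<Longrightarrow> (\<lambda>\<omega>. a \<omega> j) \<in> borel_measurable (gaussian_pair J)"
    and "\<And>j. j \<in> J \<Longrightarrow> (\<lambda>\<omega>. b \<omega> j) \<in> borel_measurable (gaussian_pair J)"
  shows "all_moments (gaussian_pair J \<Otimes>\<^sub>M gaussian_pair J)
    (\<lambda>q. dot J (unit_vec J (a (fst q))) (unit_vec J (b (snd q))))"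
proof (intro finite_measure.all_moments_sum all_moments_mult)
  show "finite_measure (gaussian_pair J \<Otimes>\<^sub>M gaussian_pair J)"
    by (intro prob_space.finite_measure prob_space_pair prob_space_gaussian_on)
  fix j assume j: "j \<in> J"
  note sf = prob_space_imp_sigma_finite[OF prob_space_gaussian_pair]
  show "all_moments (gaussian_pair J \<Otimes>\<^sub>M gaussian_pair J) (\<lambda>q. unit_vec J (a (fst q)) j)"
    using assms j
    by (intro all_moments_fst[where f="\<lambda>\<omega>. unit_vec J (a \<omega>) j"] all_moments_unit_vec sf
        prob_space_gaussian_pair prob_space.finite_measure)
  show "all_moments (gaussian_pair J \<Otimes>\<^sub>M gaussian_pair J) (\<lambda>q. unit_vec J (b (snd q)) j)"
    using assms j
    by (intro all_moments_snd[where f="\<lambda>\<omega>. unit_vec J (b \<omega>) j"] all_moments_unit_vec sf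
        prob_space_gaussian_pair prob_space.finite_measure)
qed

text \<open>Conditionally on the first copy, its normalized vector is a fixed \<open>w\<close> of
  length at most 1 for the second.\<close>

lemma integral_unit_vec_dot_pair:
  assumes "finite J"
    and a: "\<forall>j\<in>J. (\<lambda>\<omega>. a \<omega> j) \<in> borel_measurable (gaussian_pair J)"
    and b: "\<forall>j\<in>J. (\<lambda>\<omega>. b \<omega> j) \<in> borel_measurable (gaussian_pair J)"
    and K: "\<forall>w. dot J w w \<le> 1 \<longrightarrow> (\<integral>\<omega>. (dot J (unit_vec J (b \<omega>)) w)\<^sup>2 \<partial>gaussian_pair J) \<le> K"
  shows "integrable (gaussian_pair J \<Otimes>\<^sub>M gaussian_pair J)
      (\<lambda>q. (dot J (unit_vec J (a (fst q))) (unit_vec J (b (snd q))))\<^sup>2)"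
    and "(\<integral>q. (dot J (unit_vec J (a (fst q))) (unit_vec J (b (snd q))))\<^sup>2
      \<partial>(gaussian_pair J \<Otimes>\<^sub>M gaussian_pair J)) \<le> K"
proof -
  interpret prob_space "gaussian_pair J" by (rule prob_space_gaussian_pair)
  interpret pair_sigma_finite "gaussian_pair J" "gaussian_pair J" ..
  interpret P2: prob_space "gaussian_pair J \<Otimes>\<^sub>M gaussian_pair J"
    by (intro prob_space_pair prob_space_gaussian_on)
  show int: "integrable (gaussian_pair J \<Otimes>\<^sub>M gaussian_pair J)
      (\<lambda>q. (dot J (unit_vec J (a (fst q))) (unit_vec J (b (snd q))))\<^sup>2)"
    using a b by (intro all_moments_integrable P2.all_moments_power all_moments_unit_vec_dot assms(1)) auto
  have "(\<integral>q. (dot J (unit_vec J (a (fst q))) (unit_vec J (b (snd q))))\<^sup>2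
      \<partial>(gaussian_pair J \<Otimes>\<^sub>M gaussian_pair J)) =
    (\<integral>\<omega>. (\<integral>\<omega>'. (dot J (unit_vec J (b \<omega>')) (unit_vec J (a \<omega>)))\<^sup>2 \<partial>gaussian_pair J) \<partial>gaussian_pair J)"
    using integral_fst'[OF int] by (simp add: mult.commute)
  also have "\<dots> \<le> (\<integral>\<omega>. K \<partial>gaussian_pair J)"
  proof (rule integral_mono')
    \<comment> \<open>The choice w = 0 in the hypothesis on \<open>K\<close> gives its sign.\<close>
    show "0 \<le> K" if "\<omega> \<in> space (gaussian_pair J)" for \<omega> :: "('a \<Rightarrow> real) \<times> ('a \<Rightarrow> real)"
      using K[rule_format, of "\<lambda>_. 0"] by simp
  qed (auto intro!: K[rule_format] dot_unit_vec_self)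
  finally show "(\<integral>q. (dot J (unit_vec J (a (fst q))) (unit_vec J (b (snd q))))\<^sup>2
      \<partial>(gaussian_pair J \<Otimes>\<^sub>M gaussian_pair J)) \<le> K"
    by (simp add: prob_space)
qed

lemma integral_cross:
  assumes J: "finite J" "J \<noteq> {}" and \<rho>: "0 \<le> \<rho>" "\<rho> \<le> 1"
  shows "integrable (gaussian_pair J \<Otimes>\<^sub>M gaussian_pair J) (cross J \<rho>)"
    and "(\<integral>q. cross J \<rho> q \<partial>(gaussian_pair J \<Otimes>\<^sub>M gaussian_pair J)) \<le> 256 / real (card J)"
proof -
  have m: "\<forall>j\<in>J. (\<lambda>\<omega>. fst \<omega> j) \<in> borel_measurable (gaussian_pair J)"
    "\<forall>j\<in>J. (\<lambda>\<omega>. correlate \<rho> \<omega> j) \<in> borel_measurable (gaussian_pair J)"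
    by (auto intro: measurable_fst_component measurable_correlate)
  have K: "\<forall>w. dot J w w \<le> 1 \<longrightarrow> (\<integral>\<omega>. (dot J (unit_vec J (fst \<omega>)) w)\<^sup>2 \<partial>gaussian_pair J) \<le> 64 / real (card J)"
    "\<forall>w. dot J w w \<le> 1 \<longrightarrow> (\<integral>\<omega>. (dot J (unit_vec J (correlate \<rho> \<omega>)) w)\<^sup>2 \<partial>gaussian_pair J) \<le> 64 / real (card J)"
    using integral_unit_vec_dot[OF assms] by blast+
  note fst_corr = integral_unit_vec_dot_pair[OF J(1) m(1,2) K(2)]
  note fst_fst = integral_unit_vec_dot_pair[OF J(1) m(1,1) K(1)]
  note corr_corr = integral_unit_vec_dot_pair[OF J(1) m(2,2) K(2)]
  note corr_fst = integral_unit_vec_dot_pair[OF J(1) m(2,1) K(1)]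
  show "integrable (gaussian_pair J \<Otimes>\<^sub>M gaussian_pair J) (cross J \<rho>)"
    unfolding cross_def[abs_def]
    by (intro Bochner_Integration.integrable_add fst_corr(1) fst_fst(1) corr_corr(1) corr_fst(1))
  have "(\<integral>q. cross J \<rho> q \<partial>(gaussian_pair J \<Otimes>\<^sub>M gaussian_pair J)) \<le>
      64 / real (card J) + 64 / real (card J) + 64 / real (card J) + 64 / real (card J)"
    using fst_corr fst_fst corr_corr corr_fst unfolding cross_def by simp
  then show "(\<integral>q. cross J \<rho> q \<partial>(gaussian_pair J \<Otimes>\<^sub>M gaussian_pair J)) \<le> 256 / real (card J)"
    by simp
qed

text \<open>The averages are nearly uncorrelated: up to the cross products, Wick's polynomial is a
  product of a function of the first copy and one of the second. The constant is 4 * 64, one share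
  for each cross product. In the odd case both terms on the left vanish.\<close>

lemma avg_covariance_error:
  assumes I: "finite I" and J: "finite J" "J \<noteq> {}" and \<rho>: "0 \<le> \<rho>" "\<rho> \<le> 1"
    and sub: "S \<subseteq> I" "T \<subseteq> I" "S' \<subseteq> I" "T' \<subseteq> I"
  shows "\<bar>(\<integral>M. avg J \<rho> (S, T) M * avg J \<rho> (S', T') M \<partial>gaussian_on (I \<times> J))
      - (if S = T then corr_moment J \<rho> (card S) else 0) * (if S' = T' then corr_moment J \<rho> (card S') else 0)\<bar>
    \<le> 256 / real (card J) * (\<Prod>i\<in>I. wick 1 1 1 1 1 1 (i \<in> S) (i \<in> T) (i \<in> S') (i \<in> T'))"
proof (cases "even (card S + card T)")
  case False
  then have "S \<noteq> T" by auto
  then show ?thesis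
    using False J by (simp add: avg_odd prod_nonneg wick_ones_nonneg)
next
  case True
  let ?P2 = "gaussian_pair J \<Otimes>\<^sub>M gaussian_pair J"
  interpret P2: prob_space ?P2 by (intro prob_space_pair prob_space_gaussian_on)
  note sf = prob_space_imp_sigma_finite[OF prob_space_gaussian_pair]
  define W where "W q = (\<Prod>i\<in>I. wick (corr J \<rho> (fst q)) (corr J \<rho> (snd q))
          (dot J (unit_vec J (fst (fst q))) (unit_vec J (fst (snd q))))
          (dot J (unit_vec J (fst (fst q))) (unit_vec J (correlate \<rho> (snd q))))
          (dot J (unit_vec J (correlate \<rho> (fst q))) (unit_vec J (fst (snd q))))
          (dot J (unit_vec J (correlate \<rho> (fst q))) (unit_vec J (correlate \<rho> (snd q))))
          (i \<in> S) (i \<in> T) (i \<in> S') (i \<in> T'))" for q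
  \<comment> \<open>Wick's polynomial with the cross products deleted. As the copies are
    independent, its integral is the product of the two means.\<close>
  define W0 where "W0 q = (if S = T then corr J \<rho> (fst q) ^ card S else 0)
      * (if S' = T' then corr J \<rho> (snd q) ^ card S' else 0)" for q
  define W1 where "W1 = (\<Prod>i\<in>I. wick 1 1 1 1 1 1 (i \<in> S) (i \<in> T) (i \<in> S') (i \<in> T'))"
  have W1_nonneg: "0 \<le> W1" unfolding W1_def by (simp add: prod_nonneg wick_ones_nonneg)
  have pointwise: "\<bar>W q - W0 q\<bar> \<le> cross J \<rho> q * W1" for q
  proof -
    \<comment> \<open>The largest cross product depends on the point, so the approximation is
      applied pointwise and integrated only after \<open>c\<^sup>2\<close> has been bounded by
      \<open>cross\<close>.\<close>
    define c where "c = Max {\<bar>dot J (unit_vec J (fst (fst q))) (unit_vec J (fst (snd q)))\<bar>,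
      \<bar>dot J (unit_vec J (fst (fst q))) (unit_vec J (correlate \<rho> (snd q)))\<bar>,
      \<bar>dot J (unit_vec J (correlate \<rho> (fst q))) (unit_vec J (fst (snd q)))\<bar>,
      \<bar>dot J (unit_vec J (correlate \<rho> (fst q))) (unit_vec J (correlate \<rho> (snd q)))\<bar>}"
      (is "c = Max ?C")
    have c_ge: "x \<le> c" if "x \<in> ?C" for x
      unfolding c_def using that by (intro Max_ge) auto
    have "c \<in> ?C" unfolding c_def by (rule Max_in) auto
    then have "c\<^sup>2 \<le> cross J \<rho> q" unfolding cross_def by auto
    have "\<forall>x\<in>?C. 0 \<le> x \<and> x \<le> 1"
      by (simp add: abs_dot_le_one dot_unit_vec_self)
    with \<open>c \<in> ?C\<close> have "0 \<le> c" "c \<le> 1" by blast+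
    have "\<bar>W q - (\<Prod>i\<in>I. wick (corr J \<rho> (fst q)) (corr J \<rho> (snd q)) 0 0 0 0
        (i \<in> S) (i \<in> T) (i \<in> S') (i \<in> T'))\<bar> \<le> c\<^sup>2 * W1"
      unfolding W_def W1_def
      by (rule prod_wick_approx[OF I sub(1,2) True])
        (intro abs_corr_le c_ge insertI1 insertI2 singletonI \<open>0 \<le> c\<close> \<open>c \<le> 1\<close>)+
    also have "\<dots> \<le> cross J \<rho> q * W1"
      using \<open>c\<^sup>2 \<le> cross J \<rho> q\<close> W1_nonneg by (rule mult_right_mono)
    finally show ?thesis
      unfolding prod_wick_uncrossed[OF I sub] W0_def .
  qed
  note corr_am = P2.all_moments_power[OF all_moments_fst[OF all_moments_corr[OF J(1)] sf prob_space_gaussian_pair]]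
    P2.all_moments_power[OF all_moments_snd[OF all_moments_corr[OF J(1)] prob_space_gaussian_pair sf]]
  have W0_am: "all_moments ?P2 W0"
    unfolding W0_def[abs_def]
    by (cases "S = T"; cases "S' = T'") (auto intro!: all_moments_mult corr_am P2.all_moments_const)
  have corr_pow: "all_moments (gaussian_pair J) (\<lambda>\<omega>. corr J \<rho> \<omega> ^ k)" for k
    by (intro finite_measure.all_moments_power all_moments_corr J prob_space.finite_measure prob_space_gaussian_pair)
  have W0_int: "(\<integral>q. W0 q \<partial>?P2) = (if S = T then corr_moment J \<rho> (card S) else 0)
      * (if S' = T' then corr_moment J \<rho> (card S') else 0)"
    using integral_mult_pair[OF prob_space_gaussian_pair prob_space_gaussian_pair
        corr_pow[of "card S"] corr_pow[of "card S'"]]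
    by (cases "S = T"; cases "S' = T'") (simp_all add: W0_def corr_moment_def)
  have dots: "all_moments ?P2 (\<lambda>q. dot J (unit_vec J (fst (fst q))) (unit_vec J (fst (snd q))))"
    "all_moments ?P2 (\<lambda>q. dot J (unit_vec J (fst (fst q))) (unit_vec J (correlate \<rho> (snd q))))"
    "all_moments ?P2 (\<lambda>q. dot J (unit_vec J (correlate \<rho> (fst q))) (unit_vec J (fst (snd q))))"
    "all_moments ?P2 (\<lambda>q. dot J (unit_vec J (correlate \<rho> (fst q))) (unit_vec J (correlate \<rho> (snd q))))"
    by (intro all_moments_unit_vec_dot J measurable_fst_component measurable_correlate; assumption)+
  have W_am: "all_moments ?P2 W"
    unfolding W_def[abs_def]
  proof (intro P2.all_moments_prod)
    have wick_am: "all_moments ?P2 (\<lambda>q. wick (a q) (b q) (c q) (d q) (e q) (f q) p1 p2 p3 p4)"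
      if "all_moments ?P2 a" "all_moments ?P2 b" "all_moments ?P2 c" "all_moments ?P2 d"
        "all_moments ?P2 e" "all_moments ?P2 f" for a b c d e f p1 p2 p3 p4
      using that
      by (cases p1; cases p2; cases p3; cases p4)
        (auto simp: wick_def intro!: all_moments_mult all_moments_add P2.all_moments_const)
    show "all_moments ?P2 (\<lambda>q. wick (corr J \<rho> (fst q)) (corr J \<rho> (snd q))
          (dot J (unit_vec J (fst (fst q))) (unit_vec J (fst (snd q))))
          (dot J (unit_vec J (fst (fst q))) (unit_vec J (correlate \<rho> (snd q))))
          (dot J (unit_vec J (correlate \<rho> (fst q))) (unit_vec J (fst (snd q))))
          (dot J (unit_vec J (correlate \<rho> (fst q))) (unit_vec J (correlate \<rho> (snd q))))
          (i \<in> S) (i \<in> T) (i \<in> S') (i \<in> T'))" for i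
      by (intro wick_am dots all_moments_fst[where f="corr J \<rho>"] all_moments_snd[where f="corr J \<rho>"]
          all_moments_corr J sf prob_space_gaussian_pair)
  qed
  have "(\<integral>M. avg J \<rho> (S, T) M * avg J \<rho> (S', T') M \<partial>gaussian_on (I \<times> J)) = (\<integral>q. W q \<partial>?P2)"
    unfolding W_def by (rule integral_avg_mult[OF I J(1) sub])
  then have "\<bar>(\<integral>M. avg J \<rho> (S, T) M * avg J \<rho> (S', T') M \<partial>gaussian_on (I \<times> J))
      - (if S = T then corr_moment J \<rho> (card S) else 0) * (if S' = T' then corr_moment J \<rho> (card S') else 0)\<bar>
    = \<bar>\<integral>q. W q - W0 q \<partial>?P2\<bar>"
    using W_am W0_am by (simp add: W0_int all_moments_integrable)
  also have "\<dots> \<le> (\<integral>q. \<bar>W q - W0 q\<bar> \<partial>?P2)" by (rule integral_abs_bound)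
  also have "\<dots> \<le> (\<integral>q. cross J \<rho> q * W1 \<partial>?P2)"
  proof (rule integral_mono)
    show "integrable ?P2 (\<lambda>q. \<bar>W q - W0 q\<bar>)"
      using W_am W0_am by (intro integrable_abs Bochner_Integration.integrable_diff all_moments_integrable)
    show "integrable ?P2 (\<lambda>q. cross J \<rho> q * W1)"
      by (intro integrable_mult_left integral_cross(1) J \<rho>)
  qed (rule pointwise)
  also have "\<dots> \<le> 256 / real (card J) * W1"
    using mult_right_mono[OF integral_cross(2)[OF J \<rho>] W1_nonneg] by simp
  finally show ?thesis unfolding W1_def .
qed


section \<open>Norms and correlations of multilinear polynomials\<close>

lemma (in finite_measure) integral_sum_sum:
  assumes "\<And>p q. p \<in> X \<Longrightarrow> q \<in> Y \<Longrightarrow> integrable M (h p q)"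
  shows "(\<integral>x. (\<Sum>p\<in>X. \<Sum>q\<in>Y. c p q * h p q x) \<partial>M) = (\<Sum>p\<in>X. \<Sum>q\<in>Y. c p q * (\<integral>x. h p q x \<partial>M) :: real)"
proof -
  have inner: "integrable M (\<lambda>x. c p q * h p q x)" if "p \<in> X" "q \<in> Y" for p q
    using assms[OF that] by simp
  have "(\<integral>x. (\<Sum>p\<in>X. \<Sum>q\<in>Y. c p q * h p q x) \<partial>M) = (\<Sum>p\<in>X. \<integral>x. (\<Sum>q\<in>Y. c p q * h p q x) \<partial>M)"
    by (intro Bochner_Integration.integral_sum Bochner_Integration.integrable_sum inner)
  also have "\<dots> = (\<Sum>p\<in>X. \<Sum>q\<in>Y. c p q * (\<integral>x. h p q x \<partial>M))"
  proof (intro sum.cong refl)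
    fix p assume "p \<in> X"
    then have "(\<integral>x. (\<Sum>q\<in>Y. c p q * h p q x) \<partial>M) = (\<Sum>q\<in>Y. \<integral>x. c p q * h p q x \<partial>M)"
      by (intro Bochner_Integration.integral_sum inner)
    then show "(\<integral>x. (\<Sum>q\<in>Y. c p q * h p q x) \<partial>M) = (\<Sum>q\<in>Y. c p q * (\<integral>x. h p q x \<partial>M))"
      by simp
  qed
  finally show ?thesis .
qed

lemma integral_mlpoly_square:
  assumes "finite I"
  shows "(\<integral>x. (mlpoly I f x)\<^sup>2 \<partial>gaussian_on I) = (\<Sum>S\<in>Pow I. (f S)\<^sup>2)"
proof -
  interpret prob_space "gaussian_on I" by (rule prob_space_gaussian_on)
  have "(mlpoly I f x)\<^sup>2 = (\<Sum>S\<in>Pow I. \<Sum>T\<in>Pow I. f S * f T * ((\<Prod>i\<in>S. x i) * (\<Prod>i\<in>T. x i)))" for x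
    unfolding mlpoly_def power2_eq_square sum_product by (intro sum.cong refl) (simp only: mult_ac)
  then have "(\<integral>x. (mlpoly I f x)\<^sup>2 \<partial>gaussian_on I) =
    (\<integral>x. (\<Sum>S\<in>Pow I. \<Sum>T\<in>Pow I. f S * f T * ((\<Prod>i\<in>S. x i) * (\<Prod>i\<in>T. x i))) \<partial>gaussian_on I)"
    by (simp only:)
  also have "\<dots> =
    (\<Sum>S\<in>Pow I. \<Sum>T\<in>Pow I. f S * f T * (\<integral>x. (\<Prod>i\<in>S. x i) * (\<Prod>i\<in>T. x i) \<partial>gaussian_on I))"
    by (intro integral_sum_sum all_moments_integrable all_moments_mult all_moments_monomial) auto
  also have "\<dots> = (\<Sum>S\<in>Pow I. \<Sum>T\<in>Pow I. if S = T then f S * f T else 0)"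
    using assms by (intro sum.cong refl) (simp add: integral_monomials2)
  also have "\<dots> = (\<Sum>S\<in>Pow I. (f S)\<^sup>2)"
    using assms by (intro sum.cong refl) (simp add: power2_eq_square)
  finally show ?thesis .
qed

lemma mlpoly_mult:
  "mlpoly I f x * mlpoly I g y = (\<Sum>p\<in>Pow I \<times> Pow I. f (fst p) * g (snd p) * ((\<Prod>i\<in>fst p. x i) * (\<Prod>i\<in>snd p. y i)))"
  unfolding mlpoly_def sum_product sum.cartesian_product by (intro sum.cong refl) (simp add: mult_ac split_beta)

text \<open>Read from right to left, this evaluates the weighted sum of coefficients that the
  covariance bounds produce.\<close>

lemma integral_mlpoly_square_mult:
  assumes "finite I"
  shows "(\<integral>x. (mlpoly I f x)\<^sup>2 * (mlpoly I g x)\<^sup>2 \<partial>gaussian_on I) =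
    (\<Sum>p\<in>Pow I \<times> Pow I. \<Sum>q\<in>Pow I \<times> Pow I. f (fst p) * g (snd p) * (f (fst q) * g (snd q))
      * (\<Prod>i\<in>I. wick 1 1 1 1 1 1 (i \<in> fst p) (i \<in> snd p) (i \<in> fst q) (i \<in> snd q)))"
proof -
  interpret prob_space "gaussian_on I" by (rule prob_space_gaussian_on)
  let ?m = "\<lambda>p x. (\<Prod>i\<in>fst p. x i) * (\<Prod>i\<in>snd p. x i)"
  have "(mlpoly I f x)\<^sup>2 * (mlpoly I g x)\<^sup>2 = (\<Sum>p\<in>Pow I \<times> Pow I. \<Sum>q\<in>Pow I \<times> Pow I.
      f (fst p) * g (snd p) * (f (fst q) * g (snd q)) * (?m p x * ?m q x))" for x
  proof -
    have "(mlpoly I f x)\<^sup>2 * (mlpoly I g x)\<^sup>2 = (mlpoly I f x * mlpoly I g x) * (mlpoly I f x * mlpoly I g x)"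
      by (simp add: power2_eq_square)
    then show ?thesis
      unfolding mlpoly_mult[of I f x g x] sum_product by (simp add: mult_ac)
  qed
  then have "(\<integral>x. (mlpoly I f x)\<^sup>2 * (mlpoly I g x)\<^sup>2 \<partial>gaussian_on I) =
    (\<integral>x. (\<Sum>p\<in>Pow I \<times> Pow I. \<Sum>q\<in>Pow I \<times> Pow I.
      f (fst p) * g (snd p) * (f (fst q) * g (snd q)) * (?m p x * ?m q x)) \<partial>gaussian_on I)"
    by (simp only:)
  also have "\<dots> =
    (\<Sum>p\<in>Pow I \<times> Pow I. \<Sum>q\<in>Pow I \<times> Pow I. f (fst p) * g (snd p) * (f (fst q) * g (snd q))
      * (\<integral>x. ?m p x * ?m q x \<partial>gaussian_on I))"
    by (intro integral_sum_sum all_moments_integrable all_moments_mult all_moments_monomial) auto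
  also have "\<dots> = (\<Sum>p\<in>Pow I \<times> Pow I. \<Sum>q\<in>Pow I \<times> Pow I. f (fst p) * g (snd p) * (f (fst q) * g (snd q))
      * (\<Prod>i\<in>I. wick 1 1 1 1 1 1 (i \<in> fst p) (i \<in> snd p) (i \<in> fst q) (i \<in> snd q)))"
    using assms by (intro sum.cong refl arg_cong2[where f=times] integral_monomials4) auto
  finally show ?thesis .
qed

text \<open>Every coordinate occurs at most once, so independence and centring replace each factor
  by its mean.\<close>

lemma integral_shifted_monomial:
  assumes "finite I" "T \<subseteq> I"
  shows "(\<integral>z. (\<Prod>i\<in>T. a i + s * z i) \<partial>gaussian_on I) = (\<Prod>i\<in>T. a i)"
proof -
  define f where "f i y = pick (i \<in> T) (a i + s * y)" for i y
  have lin: "integrable std_gaussian (\<lambda>y. a i + s * y)" "(\<integral>y. a i + s * y \<partial>std_gaussian) = a i" for i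
    using integral_std_gaussian_quartic[of "a i" s 0 0 0] integrable_std_gaussian_power[of 1] by simp_all
  have f: "integrable std_gaussian (f i)" "(\<integral>y. f i y \<partial>std_gaussian) = pick (i \<in> T) (a i)" for i
    using lin[of i] by (cases "i \<in> T"; simp add: f_def[abs_def] pick_def)+
  have "(\<integral>z. (\<Prod>i\<in>T. a i + s * z i) \<partial>gaussian_on I) = (\<integral>z. (\<Prod>i\<in>I. f i (z i)) \<partial>gaussian_on I)"
    using assms by (simp add: f_def prod_pick)
  also have "\<dots> = (\<Prod>i\<in>I. \<integral>y. f i y \<partial>std_gaussian)"
    using assms f(1) by (intro gaussians.product_integral_prod)
  also have "\<dots> = (\<Prod>i\<in>T. a i)"
    using assms by (simp add: f(2) prod_pick)
  finally show ?thesis .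
qed

lemma all_moments_correlate: "j \<in> J \<Longrightarrow> all_moments (gaussian_pair J) (\<lambda>\<omega>. correlate \<rho> \<omega> j)"
  unfolding correlate_def
  by (intro all_moments_add finite_measure.all_moments_cmult all_moments_gaussian_fst[where f="\<lambda>x. x j"]
      all_moments_gaussian_snd[where f="\<lambda>x. x j"] all_moments_gaussian_on
      prob_space.finite_measure prob_space_gaussian_pair)

lemma correlated_monomials:
  assumes "finite I" "S \<subseteq> I" "T \<subseteq> I"
  shows "all_moments (gaussian_pair I) (\<lambda>\<omega>. (\<Prod>i\<in>S. fst \<omega> i) * (\<Prod>i\<in>T. correlate \<rho> \<omega> i))"
    and "(\<integral>\<omega>. (\<Prod>i\<in>S. fst \<omega> i) * (\<Prod>i\<in>T. correlate \<rho> \<omega> i) \<partial>gaussian_pair I) =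
      (if S = T then \<rho> ^ card S else 0)"
proof -
  interpret pair_sigma_finite "gaussian_on I" "gaussian_on I"
    by (intro pair_sigma_finite_prob prob_space_gaussian_on)
  show am: "all_moments (gaussian_pair I) (\<lambda>\<omega>. (\<Prod>i\<in>S. fst \<omega> i) * (\<Prod>i\<in>T. correlate \<rho> \<omega> i))"
    using assms
    by (intro all_moments_mult all_moments_gaussian_fst[where f="\<lambda>x. \<Prod>i\<in>S. x i"] all_moments_monomial
        finite_measure.all_moments_prod prob_space.finite_measure prob_space_gaussian_pair all_moments_correlate) auto
  have "(\<integral>\<omega>. (\<Prod>i\<in>S. fst \<omega> i) * (\<Prod>i\<in>T. correlate \<rho> \<omega> i) \<partial>gaussian_pair I) =
    (\<integral>x. (\<integral>z. (\<Prod>i\<in>S. x i) * (\<Prod>i\<in>T. \<rho> * x i + sqrt (1 - \<rho>\<^sup>2) * z i) \<partial>gaussian_on I) \<partial>gaussian_on I)"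
    using integral_fst'[OF all_moments_integrable[OF am]] by (simp add: correlate_def)
  also have "\<dots> = (\<integral>x. \<rho> ^ card T * ((\<Prod>i\<in>S. x i) * (\<Prod>i\<in>T. x i)) \<partial>gaussian_on I)"
    by (simp add: integral_shifted_monomial[OF assms(1,3)] prod.distrib mult.left_commute)
  also have "\<dots> = (if S = T then \<rho> ^ card S else 0)"
    using integral_monomials2[OF assms] by simp
  finally show "(\<integral>\<omega>. (\<Prod>i\<in>S. fst \<omega> i) * (\<Prod>i\<in>T. correlate \<rho> \<omega> i) \<partial>gaussian_pair I) =
      (if S = T then \<rho> ^ card S else 0)" .
qed

lemma sum_Pow_diagonal:
  assumes "finite I"
  shows "(\<Sum>p\<in>Pow I \<times> Pow I. h p * (if fst p = snd p then e (fst p) else 0)) = (\<Sum>S\<in>Pow I. h (S, S) * (e S :: real))"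
proof -
  have "(\<Sum>p\<in>Pow I \<times> Pow I. h p * (if fst p = snd p then e (fst p) else 0)) =
    (\<Sum>S\<in>Pow I. \<Sum>T\<in>Pow I. if S = T then h (S, T) * e S else 0)"
    by (auto simp: sum.cartesian_product intro!: sum.cong)
  then show ?thesis using assms by simp
qed

lemma integral_correlated_mlpoly:
  assumes "finite I"
  shows "(\<integral>\<omega>. mlpoly I f (fst \<omega>) * mlpoly I g (correlate \<rho> \<omega>) \<partial>gaussian_pair I) =
    (\<Sum>S\<in>Pow I. f S * g S * \<rho> ^ card S)"
proof -
  interpret prob_space "gaussian_pair I" by (rule prob_space_gaussian_pair)
  have "(\<integral>\<omega>. mlpoly I f (fst \<omega>) * mlpoly I g (correlate \<rho> \<omega>) \<partial>gaussian_pair I) =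
    (\<Sum>p\<in>Pow I \<times> Pow I. f (fst p) * g (snd p) *
      (\<integral>\<omega>. (\<Prod>i\<in>fst p. fst \<omega> i) * (\<Prod>i\<in>snd p. correlate \<rho> \<omega> i) \<partial>gaussian_pair I))"
    unfolding mlpoly_mult
    by (subst Bochner_Integration.integral_sum)
      (auto intro!: all_moments_integrable all_moments_cmult correlated_monomials(1) assms)
  also have "\<dots> = (\<Sum>p\<in>Pow I \<times> Pow I. f (fst p) * g (snd p) * (if fst p = snd p then \<rho> ^ card (fst p) else 0))"
    using assms by (intro sum.cong refl arg_cong2[where f=times] correlated_monomials(2)) auto
  finally show ?thesis
    using sum_Pow_diagonal[OF assms, of "\<lambda>p. f (fst p) * g (snd p)" "\<lambda>S. \<rho> ^ card S"] by simp
qed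

lemma integral_mlpoly_rows:
  assumes "finite J"
  shows "(\<integral>\<omega>. mlpoly I f (row_dot J M (unit_vec J (fst \<omega>))) * mlpoly I g (row_dot J M (unit_vec J (correlate \<rho> \<omega>)))
      \<partial>gaussian_pair J) = (\<Sum>p\<in>Pow I \<times> Pow I. f (fst p) * g (snd p) * avg J \<rho> p M)"
proof -
  interpret prob_space "gaussian_pair J" by (rule prob_space_gaussian_pair)
  show ?thesis
    unfolding mlpoly_mult avg_def form_def[symmetric]
    by (subst Bochner_Integration.integral_sum)
      (auto intro!: all_moments_integrable all_moments_cmult all_moments_form_fixed assms)
qed

section \<open>The functions of the statement\<close>

text \<open>The Hermite polynomials of degree 0 and 1 are 1 and x. A multi-index with entries 0 and
  1 is the indicator of a set, so the expansion is one in ordinary monomials, and the degree becomes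
  the cardinality.\<close>

lemma multilinear_polynomialE:
  assumes poly: "polynomial_on_Rn N A" and ml: "multilinear N A" and deg: "hermite_degree N A \<le> d"
  obtains f where "\<And>S. S \<subseteq> {..<N} \<Longrightarrow> f S \<noteq> 0 \<Longrightarrow> card S \<le> d"
    and "\<And>x. x \<in> {..<N} \<rightarrow>\<^sub>E UNIV \<Longrightarrow> A x = mlpoly {..<N} f x"
proof -
  define \<sigma> :: "nat set \<Rightarrow> nat \<Rightarrow> nat" where "\<sigma> S = (\<lambda>i\<in>{..<N}. if i \<in> S then 1 else 0)" for S
  define supp where "supp = hermite_support N A"
  define f where "f S = (if \<sigma> S \<in> supp then hermite_coeff N A (\<sigma> S) else 0)" for S
  have fin: "finite supp" using poly by (simp add: polynomial_on_Rn_def supp_def)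
  have card: "(\<Sum>i<N. \<sigma> S i) = card S" if "S \<subseteq> {..<N}" for S
    using that by (simp add: \<sigma>_def sum.If_cases Int_absorb1)
  have prod: "hermite_prod N (\<sigma> S) x = (\<Prod>i\<in>S. x i)" if "S \<subseteq> {..<N}" for S x
  proof -
    have "hermite_prod N (\<sigma> S) x = (\<Prod>i<N. pick (i \<in> S) (x i))"
      unfolding hermite_prod_def by (intro prod.cong refl) (simp add: \<sigma>_def pick_def hermite_def)
    then show ?thesis using that by (simp add: prod_pick)
  qed
  have inj: "inj_on \<sigma> (Pow {..<N})"
  proof (rule inj_onI)
    fix S T assume ST: "S \<in> Pow {..<N}" "T \<in> Pow {..<N}" "\<sigma> S = \<sigma> T"
    have "i \<in> S \<longleftrightarrow> i \<in> T" if "i < N" for i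
      using fun_cong[OF ST(3), of i] that by (auto simp: \<sigma>_def split: if_splits)
    then show "S = T" using ST by blast
  qed
  \<comment> \<open>Multi-indices in the support are extensional and take the values 0 and 1 only,
    so each is the indicator of the set where it equals 1.\<close>
  have image: "supp = \<sigma> ` {S \<in> Pow {..<N}. \<sigma> S \<in> supp}"
  proof (intro equalityI subsetI)
    fix \<tau> assume \<tau>: "\<tau> \<in> supp"
    have "\<tau> = \<sigma> {i. i < N \<and> \<tau> i = 1}"
    proof
      fix i
      show "\<tau> i = \<sigma> {i. i < N \<and> \<tau> i = 1} i"
        using \<tau> ml unfolding \<sigma>_def supp_def multilinear_def
        by (cases "i < N") (auto simp: hermite_support_def PiE_def extensional_def)
    qed
    then show "\<tau> \<in> \<sigma> ` {S \<in> Pow {..<N}. \<sigma> S \<in> supp}"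
      using \<tau> by (intro image_eqI[where x="{i. i < N \<and> \<tau> i = 1}"]) auto
  qed auto
  have "A x = mlpoly {..<N} f x" if "x \<in> {..<N} \<rightarrow>\<^sub>E UNIV" for x
  proof -
    have "A x = (\<Sum>\<tau>\<in>supp. hermite_coeff N A \<tau> * hermite_prod N \<tau> x)"
      using poly that by (simp add: polynomial_on_Rn_def supp_def)
    also have "\<dots> = (\<Sum>S\<in>{S \<in> Pow {..<N}. \<sigma> S \<in> supp}. hermite_coeff N A (\<sigma> S) * hermite_prod N (\<sigma> S) x)"
      by (subst image, subst sum.reindex) (auto intro: inj_on_subset[OF inj])
    also have "\<dots> = (\<Sum>S\<in>Pow {..<N}. if \<sigma> S \<in> supp then hermite_coeff N A (\<sigma> S) * hermite_prod N (\<sigma> S) x else 0)"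
      by (rule sum.inter_filter) simp
    also have "\<dots> = mlpoly {..<N} f x"
      unfolding mlpoly_def f_def by (intro sum.cong refl) (auto simp: prod)
    finally show ?thesis .
  qed
  moreover have "card S \<le> d" if "S \<subseteq> {..<N}" "f S \<noteq> 0" for S
  proof -
    have "\<sigma> S \<in> supp" using that(2) by (auto simp: f_def split: if_splits)
    then have "(\<Sum>i<N. \<sigma> S i) \<le> hermite_degree N A"
      unfolding hermite_degree_def supp_def[symmetric] using fin by (intro Max_ge) auto
    then show ?thesis using card[OF that(1)] deg by simp
  qed
  ultimately show ?thesis using that by blast
qed

lemma gaussian_eq: "gaussian n = gaussian_on {..<n}"
  by (simp add: gaussian_def)

lemma measurable_restrict_correlate:
  "(\<lambda>\<omega>. (fst \<omega>, restrict (correlate \<rho> \<omega>) J)) \<in> gaussian_pair J \<rightarrow>\<^sub>M gaussian_pair J"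
proof (intro measurable_Pair measurable_fst measurable_restrict)
  fix j assume "j \<in> J"
  then show "(\<lambda>\<omega>. correlate \<rho> \<omega> j) \<in> gaussian_pair J \<rightarrow>\<^sub>M std_gaussian"
    using measurable_correlate[of j J \<rho>] by (simp cong: measurable_cong_sets)
qed

text \<open>The restriction is essential for a general \<open>B\<close>, whose values are controlled
  only on extensional functions; it disappears once \<open>B\<close> is known to be a polynomial in
  the coordinates.\<close>

lemma correlated_inner_eq:
  assumes [measurable]: "A \<in> borel_measurable (gaussian_on {..<n})" "B \<in> borel_measurable (gaussian_on {..<n})"
  shows "correlated_inner \<rho> n A B =
    (\<integral>\<omega>. A (fst \<omega>) * B (restrict (correlate \<rho> \<omega>) {..<n}) \<partial>gaussian_pair {..<n})"
proof -
  have "(\<lambda>(x, z). (x, \<lambda>i\<in>{..<n}. \<rho> * x i + sqrt (1 - \<rho>\<^sup>2) * z i)) =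
    (\<lambda>\<omega>. (fst \<omega>, restrict (correlate \<rho> \<omega>) {..<n}))"
    by (simp add: correlate_def fun_eq_iff split_beta)
  then have "correlated_gaussian \<rho> n =
      distr (gaussian_pair {..<n}) (gaussian_pair {..<n}) (\<lambda>\<omega>. (fst \<omega>, restrict (correlate \<rho> \<omega>) {..<n}))"
    by (simp add: correlated_gaussian_def gaussian_eq)
  then show ?thesis
    unfolding correlated_inner_def by (simp add: integral_distr[OF measurable_restrict_correlate] split_beta)
qed

lemma gaussian_norm_mlpoly:
  assumes "\<And>x. x \<in> {..<N} \<rightarrow>\<^sub>E UNIV \<Longrightarrow> A x = mlpoly {..<N} f x"
  shows "gaussian_norm N A = sqrt (\<Sum>S\<in>Pow {..<N}. (f S)\<^sup>2)"
proof -
  have "(\<integral>x. (A x)\<^sup>2 \<partial>gaussian_on {..<N}) = (\<integral>x. (mlpoly {..<N} f x)\<^sup>2 \<partial>gaussian_on {..<N})"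
    using assms by (intro Bochner_Integration.integral_cong) (auto simp: space_PiM)
  then show ?thesis by (simp add: gaussian_norm_def gaussian_eq integral_mlpoly_square)
qed

lemma measurable_mlpoly_eq:
  assumes "\<And>x. x \<in> {..<N} \<rightarrow>\<^sub>E UNIV \<Longrightarrow> A x = mlpoly {..<N} f x"
  shows "A \<in> borel_measurable (gaussian_on {..<N})"
  using assms all_moments_measurable[OF all_moments_mlpoly[of "{..<N}" f]]
  by (subst measurable_cong[where g="mlpoly {..<N} f"]) (auto simp: space_PiM)

lemma mlpoly_cong: "(\<And>i. i \<in> I \<Longrightarrow> x i = y i) \<Longrightarrow> mlpoly I f x = mlpoly I f y"
  unfolding mlpoly_def by (intro sum.cong refl arg_cong2[where f=times] prod.cong) auto

lemma correlated_inner_mlpoly: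
  assumes A: "\<And>x. x \<in> {..<N} \<rightarrow>\<^sub>E UNIV \<Longrightarrow> A x = mlpoly {..<N} f x"
    and B: "\<And>x. x \<in> {..<N} \<rightarrow>\<^sub>E UNIV \<Longrightarrow> B x = mlpoly {..<N} g x"
  shows "correlated_inner \<rho> N A B = (\<Sum>S\<in>Pow {..<N}. f S * g S * \<rho> ^ card S)"
proof -
  have "B (restrict y {..<N}) = mlpoly {..<N} g y" for y
    using B[of "restrict y {..<N}"] mlpoly_cong[of "{..<N}" "restrict y {..<N}" y g] by simp
  then have "correlated_inner \<rho> N A B =
      (\<integral>\<omega>. A (fst \<omega>) * mlpoly {..<N} g (correlate \<rho> \<omega>) \<partial>gaussian_pair {..<N})"
    by (simp add: correlated_inner_eq measurable_mlpoly_eq[OF A] measurable_mlpoly_eq[OF B])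
  also have "\<dots> = (\<integral>\<omega>. mlpoly {..<N} f (fst \<omega>) * mlpoly {..<N} g (correlate \<rho> \<omega>) \<partial>gaussian_pair {..<N})"
    using A by (intro Bochner_Integration.integral_cong refl) (auto simp: space_pair_measure space_PiM)
  finally show ?thesis by (simp add: integral_correlated_mlpoly)
qed

lemma compose_matrix_mlpoly:
  assumes A: "\<And>x. x \<in> {..<N} \<rightarrow>\<^sub>E UNIV \<Longrightarrow> A x = mlpoly {..<N} f x"
  shows "compose_matrix N D M A a = mlpoly {..<N} f (row_dot {..<D} M (unit_vec {..<D} a))"
proof -
  have "compose_matrix N D M A a =
      mlpoly {..<N} f (\<lambda>i\<in>{..<N}. (\<Sum>j<D. M (i, j) * a j) / L2_set a {..<D})"
    unfolding compose_matrix_def by (rule A) auto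
  also have "\<dots> = mlpoly {..<N} f (row_dot {..<D} M (unit_vec {..<D} a))"
    by (rule mlpoly_cong) (simp add: row_dot_def unit_vec_def sum_divide_distrib)
  finally show ?thesis .
qed

lemma correlated_inner_compose_matrix:
  assumes A: "\<And>x. x \<in> {..<N} \<rightarrow>\<^sub>E UNIV \<Longrightarrow> A x = mlpoly {..<N} f x"
    and B: "\<And>x. x \<in> {..<N} \<rightarrow>\<^sub>E UNIV \<Longrightarrow> B x = mlpoly {..<N} g x"
  shows "correlated_inner \<rho> D (compose_matrix N D M A) (compose_matrix N D M B) =
    (\<Sum>p\<in>Pow {..<N} \<times> Pow {..<N}. f (fst p) * g (snd p) * avg {..<D} \<rho> p M)"
proof -
  have meas: "(\<lambda>a. mlpoly {..<N} h (row_dot {..<D} M (unit_vec {..<D} a))) \<in> borel_measurable (gaussian_on {..<D})" for h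
    unfolding mlpoly_def row_dot_def
    by (intro borel_measurable_sum borel_measurable_times borel_measurable_const borel_measurable_prod
        measurable_unit_vec all_moments_measurable[OF all_moments_gaussian_on])
  have "row_dot {..<D} M (unit_vec {..<D} (restrict a {..<D})) = row_dot {..<D} M (unit_vec {..<D} a)" for a
    by (simp add: row_dot_def unit_vec_def L2_set_def fun_eq_iff)
  moreover have "compose_matrix N D M A = (\<lambda>a. mlpoly {..<N} f (row_dot {..<D} M (unit_vec {..<D} a)))"
    "compose_matrix N D M B = (\<lambda>a. mlpoly {..<N} g (row_dot {..<D} M (unit_vec {..<D} a)))"
    using compose_matrix_mlpoly[of N A f D M] compose_matrix_mlpoly[of N B g D M] A B by auto
  ultimately show ?thesis
    by (simp add: correlated_inner_eq[OF meas meas] integral_mlpoly_rows)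
qed


section \<open>Mean square error and choice of the dimension\<close>

lemma abs_sum_mult_le:
  fixes f g e :: "'i \<Rightarrow> real"
  assumes "\<And>S. S \<in> X \<Longrightarrow> f S \<noteq> 0 \<Longrightarrow> \<bar>e S\<bar> \<le> K" "0 \<le> K" "(\<Sum>S\<in>X. (f S)\<^sup>2) \<le> 1" "(\<Sum>S\<in>X. (g S)\<^sup>2) \<le> 1"
  shows "\<bar>\<Sum>S\<in>X. f S * g S * e S\<bar> \<le> K"
proof -
  have "\<bar>\<Sum>S\<in>X. f S * g S * e S\<bar> \<le> (\<Sum>S\<in>X. \<bar>f S * g S * e S\<bar>)" by (rule sum_abs)
  also have "\<dots> \<le> (\<Sum>S\<in>X. K * (((f S)\<^sup>2 + (g S)\<^sup>2) / 2))"
  proof (rule sum_mono)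
    fix S assume S: "S \<in> X"
    \<comment> \<open>The arithmetic-geometric mean inequality for each term; as both coefficient
      vectors have norm at most 1, this is as good as Cauchy-Schwarz.\<close>
    have "\<bar>f S * g S\<bar> \<le> ((f S)\<^sup>2 + (g S)\<^sup>2) / 2"
      using zero_le_power2[of "\<bar>f S\<bar> - \<bar>g S\<bar>"] by (simp add: power2_diff abs_mult)
    moreover have "\<bar>f S * g S * e S\<bar> \<le> \<bar>f S * g S\<bar> * K"
      unfolding abs_mult[of "f S * g S"] using assms(1)[OF S]
      by (cases "f S = 0") (auto intro: mult_left_mono)
    ultimately show "\<bar>f S * g S * e S\<bar> \<le> K * (((f S)\<^sup>2 + (g S)\<^sup>2) / 2)"
      using assms(2) mult_right_mono[of "\<bar>f S * g S\<bar>" "((f S)\<^sup>2 + (g S)\<^sup>2) / 2" K]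
      by (simp add: mult.commute)
  qed
  also have "\<dots> = K * (((\<Sum>S\<in>X. (f S)\<^sup>2) + (\<Sum>S\<in>X. (g S)\<^sup>2)) / 2)"
    by (simp add: sum_distrib_left[symmetric] sum_divide_distrib[symmetric] sum.distrib)
  also have "\<dots> \<le> K * 1"
    using assms(2-) by (intro mult_left_mono) auto
  finally show ?thesis by simp
qed

text \<open>Decomposition into variance and squared bias. The variance contributes 256 times
  \<open>9 ^ d\<close> through the covariance bound and hypercontractivity, the bias 240 times
  \<open>d\<^sup>2\<close> through the moments of the inner product of the normalized
  vectors.\<close>

lemma compressed_correlation_error:
  fixes f g :: "'i set \<Rightarrow> real" and J :: "'j set"
  assumes I: "finite I" and J: "finite J" "J \<noteq> {}" and \<rho>: "0 \<le> \<rho>" "\<rho> \<le> 1"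
    and f: "\<And>S. S \<subseteq> I \<Longrightarrow> f S \<noteq> 0 \<Longrightarrow> card S \<le> d" "(\<Sum>S\<in>Pow I. (f S)\<^sup>2) \<le> 1"
    and g: "\<And>S. S \<subseteq> I \<Longrightarrow> g S \<noteq> 0 \<Longrightarrow> card S \<le> d" "(\<Sum>S\<in>Pow I. (g S)\<^sup>2) \<le> 1"
  defines "F \<equiv> \<lambda>M. \<Sum>p\<in>Pow I \<times> Pow I. f (fst p) * g (snd p) * avg J \<rho> p M"
    and "\<mu> \<equiv> \<Sum>S\<in>Pow I. f S * g S * \<rho> ^ card S"
  shows "integrable (gaussian_on (I \<times> J)) (\<lambda>M. (F M - \<mu>)\<^sup>2)"
    and "(\<integral>M. (F M - \<mu>)\<^sup>2 \<partial>gaussian_on (I \<times> J)) \<le> (240 * (real d)\<^sup>2 + 256 * 9 ^ d) / real (card J)"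
    and "F \<in> borel_measurable (gaussian_on (I \<times> J))"
proof -
  define G where "G = gaussian_on (I \<times> J)"
  interpret G: prob_space G unfolding G_def by (rule prob_space_gaussian_on)
  define X where "X = Pow I \<times> Pow I"
  define c where "c p = f (fst p) * g (snd p)" for p
  define e where "e p = (if fst p = snd p then corr_moment J \<rho> (card (fst p)) else 0)" for p :: "'i set \<times> 'i set"
  define w where "w p q = (\<Prod>i\<in>I. wick 1 1 1 1 1 1 (i \<in> fst p) (i \<in> snd p) (i \<in> fst q) (i \<in> snd q))"
    for p q :: "'i set \<times> 'i set"
  define m where "m = (\<Sum>p\<in>X. c p * e p)"
  define \<tau> where "\<tau> = 256 / real (card J)"
  have avg1: "integrable G (avg J \<rho> p)" "(\<integral>M. avg J \<rho> p M \<partial>G) = e p" if "p \<in> X" for p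
  proof -
    obtain S T where p: "p = (S, T)" "S \<subseteq> I" "T \<subseteq> I" using \<open>p \<in> X\<close> unfolding X_def by blast
    show "integrable G (avg J \<rho> p)" "(\<integral>M. avg J \<rho> p M \<partial>G) = e p"
      using integral_form[OF I J(1) p(2,3), of \<rho>] by (simp_all add: p(1) G_def e_def)
  qed
  have avg2: "integrable G (\<lambda>M. avg J \<rho> p M * avg J \<rho> q M)"
    "\<bar>(\<integral>M. avg J \<rho> p M * avg J \<rho> q M \<partial>G) - e p * e q\<bar> \<le> \<tau> * w p q" if "p \<in> X" "q \<in> X" for p q
    using that integral_avg_mult(1)[OF I J(1), of "fst p" "snd p" "fst q" "snd q" \<rho>]
      avg_covariance_error[OF I J \<rho>, of "fst p" "snd p" "fst q" "snd q"]
    unfolding X_def G_def e_def w_def \<tau>_def by (auto simp only: SigmaE2 Pow_iff mem_Times_iff prod.collapse)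
  have F: "F M = (\<Sum>p\<in>X. c p * avg J \<rho> p M)" for M unfolding F_def X_def c_def ..
  have F2: "(F M)\<^sup>2 = (\<Sum>p\<in>X. \<Sum>q\<in>X. c p * c q * (avg J \<rho> p M * avg J \<rho> q M))" for M
    unfolding F power2_eq_square sum_product by (intro sum.cong refl) (simp only: mult_ac)
  have intF: "integrable G F" unfolding F[abs_def] by (simp add: avg1)
  then show "F \<in> borel_measurable (gaussian_on (I \<times> J))" by (simp add: G_def)
  have "integrable G (\<lambda>M. c p * c q * (avg J \<rho> p M * avg J \<rho> q M))" if "p \<in> X" "q \<in> X" for p q
    using avg2(1)[OF that] by simp
  then have intF2: "integrable G (\<lambda>M. (F M)\<^sup>2)" unfolding F2 by (intro Bochner_Integration.integrable_sum)
  have EF: "(\<integral>M. F M \<partial>G) = m"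
    unfolding F m_def by (simp add: avg1)
  have EF2: "(\<integral>M. (F M)\<^sup>2 \<partial>G) = (\<Sum>p\<in>X. \<Sum>q\<in>X. c p * c q * (\<integral>M. avg J \<rho> p M * avg J \<rho> q M \<partial>G))"
    unfolding F2 by (rule G.integral_sum_sum) (rule avg2(1))
  have "m\<^sup>2 = (\<Sum>p\<in>X. \<Sum>q\<in>X. c p * c q * (e p * e q))"
    unfolding m_def power2_eq_square sum_product by (intro sum.cong refl) (simp only: mult_ac)
  then have "(\<integral>M. (F M)\<^sup>2 \<partial>G) - m\<^sup>2 =
      (\<Sum>p\<in>X. \<Sum>q\<in>X. c p * c q * ((\<integral>M. avg J \<rho> p M * avg J \<rho> q M \<partial>G) - e p * e q))"
    unfolding EF2 by (simp add: sum_subtractf right_diff_distrib)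
  \<comment> \<open>Signs of the coefficients are given up here. Since the weights are nonnegative,
    the sum is again an integral, now for the polynomials with absolute coefficients, which have the
    same norms and degree bounds.\<close>
  also have "\<dots> \<le> (\<Sum>p\<in>X. \<Sum>q\<in>X. \<bar>c p\<bar> * \<bar>c q\<bar> * (\<tau> * w p q))"
  proof (intro sum_mono)
    fix p q assume pq: "p \<in> X" "q \<in> X"
    have "c p * c q * ((\<integral>M. avg J \<rho> p M * avg J \<rho> q M \<partial>G) - e p * e q)
      \<le> \<bar>c p * c q * ((\<integral>M. avg J \<rho> p M * avg J \<rho> q M \<partial>G) - e p * e q)\<bar>" by simp
    also have "\<dots> \<le> \<bar>c p\<bar> * \<bar>c q\<bar> * (\<tau> * w p q)"
      unfolding abs_mult using avg2(2)[OF pq] by (intro mult_left_mono) auto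
    finally show "c p * c q * ((\<integral>M. avg J \<rho> p M * avg J \<rho> q M \<partial>G) - e p * e q)
      \<le> \<bar>c p\<bar> * \<bar>c q\<bar> * (\<tau> * w p q)" .
  qed
  also have "\<dots> = \<tau> * (\<Sum>p\<in>X. \<Sum>q\<in>X. \<bar>c p\<bar> * \<bar>c q\<bar> * w p q)"
    by (simp add: sum_distrib_left mult_ac)
  also have "(\<Sum>p\<in>X. \<Sum>q\<in>X. \<bar>c p\<bar> * \<bar>c q\<bar> * w p q) =
      (\<integral>x. (mlpoly I (\<lambda>S. \<bar>f S\<bar>) x)\<^sup>2 * (mlpoly I (\<lambda>S. \<bar>g S\<bar>) x)\<^sup>2 \<partial>gaussian_on I)"
    unfolding integral_mlpoly_square_mult[OF I] X_def c_def w_def by (simp add: abs_mult)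
  also have "\<tau> * \<dots> \<le> \<tau> * (3 ^ (d + d) * ((\<Sum>S\<in>Pow I. \<bar>f S\<bar>\<^sup>2) * (\<Sum>S\<in>Pow I. \<bar>g S\<bar>\<^sup>2)))"
    using f(1) g(1) by (intro mult_left_mono hypercontractive I) (auto simp: \<tau>_def)
  also have "\<dots> \<le> \<tau> * (3 ^ (d + d) * (1 * 1))"
    using f(2) g(2) by (intro mult_left_mono mult_mono) (auto simp: \<tau>_def sum_nonneg)
  also have "\<dots> = \<tau> * 9 ^ d"
    by (simp add: power_add power_mult_distrib[symmetric])
  finally have var: "(\<integral>M. (F M)\<^sup>2 \<partial>G) - m\<^sup>2 \<le> \<tau> * 9 ^ d" .
  have m: "m = (\<Sum>S\<in>Pow I. f S * g S * corr_moment J \<rho> (card S))"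
    using sum_Pow_diagonal[OF I, of c "\<lambda>S. corr_moment J \<rho> (card S)"] by (simp add: m_def X_def e_def c_def)
  define K where "K = real d * sqrt (240 / real (card J))"
  have "\<bar>m - \<mu>\<bar> = \<bar>\<Sum>S\<in>Pow I. f S * g S * (corr_moment J \<rho> (card S) - \<rho> ^ card S)\<bar>"
    unfolding m \<mu>_def by (simp add: right_diff_distrib sum_subtractf)
  also have "\<dots> \<le> K"
  proof (rule abs_sum_mult_le)
    fix S assume "S \<in> Pow I" "f S \<noteq> 0"
    then have "real (card S) * sqrt (240 / real (card J)) \<le> K"
      unfolding K_def using f(1)[of S] by (intro mult_right_mono) auto
    then show "\<bar>corr_moment J \<rho> (card S) - \<rho> ^ card S\<bar> \<le> K"
      using corr_moment_error[OF J \<rho>, of "card S"] by linarith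
  qed (use f(2) g(2) in \<open>auto simp: K_def\<close>)
  finally have "\<bar>m - \<mu>\<bar>\<^sup>2 \<le> K\<^sup>2" by (rule power_mono) simp
  then have bias: "(m - \<mu>)\<^sup>2 \<le> 240 * (real d)\<^sup>2 / real (card J)"
    by (simp add: K_def power_mult_distrib mult.commute)
  have sq: "(F M - \<mu>)\<^sup>2 = (F M)\<^sup>2 - 2 * \<mu> * F M + \<mu>\<^sup>2" for M
    by (simp add: power2_diff)
  show "integrable (gaussian_on (I \<times> J)) (\<lambda>M. (F M - \<mu>)\<^sup>2)"
    unfolding sq using intF intF2 by (simp add: G_def[symmetric])
  have "(\<integral>M. (F M - \<mu>)\<^sup>2 \<partial>G) = (\<integral>M. (F M)\<^sup>2 \<partial>G) - 2 * \<mu> * m + \<mu>\<^sup>2"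
    unfolding sq using intF intF2 by (simp add: EF G.prob_space)
  also have "\<dots> = ((\<integral>M. (F M)\<^sup>2 \<partial>G) - m\<^sup>2) + (m - \<mu>)\<^sup>2"
    by (simp add: power2_diff)
  also have "\<dots> \<le> \<tau> * 9 ^ d + 240 * (real d)\<^sup>2 / real (card J)"
    using var bias by (rule add_mono)
  also have "\<dots> = (240 * (real d)\<^sup>2 + 256 * 9 ^ d) / real (card J)"
    by (simp add: \<tau>_def add_divide_distrib)
  finally show "(\<integral>M. (F M - \<mu>)\<^sup>2 \<partial>gaussian_on (I \<times> J)) \<le> (240 * (real d)\<^sup>2 + 256 * 9 ^ d) / real (card J)"
    by (simp add: G_def)
qed

text \<open>From d \<le> \<open>2 ^ d\<close> the first term is at most 240 times
  \<open>9 ^ d\<close>, and 240 + 256 = 496. For d \<ge> 2, 9 \<le> \<open>2 ^ 4\<close> explains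
  the lower bound on \<open>k\<close>. For d = 1 the power of \<open>d\<close> is 1 and a factor 9
  is needed, whence 9 * 496 = 4464.\<close>

lemma dimension_bound:
  assumes "0 < d" "4 \<le> k"
  shows "240 * (real d)\<^sup>2 + 256 * 9 ^ d \<le> 4464 * real d ^ (k * d)"
proof -
  have "(real d)\<^sup>2 \<le> (2 ^ d)\<^sup>2"
    by (intro power_mono) (auto simp: less_imp_le of_nat_less_two_power)
  also have "\<dots> = (2\<^sup>2) ^ d" by (simp only: power_mult[symmetric] mult.commute)
  also have "\<dots> \<le> (9 :: real) ^ d" by (intro power_mono) auto
  finally have 1: "240 * (real d)\<^sup>2 + 256 * 9 ^ d \<le> 496 * 9 ^ d" by simp
  have "(9 :: real) ^ d \<le> 9 * real d ^ (k * d)"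
  proof (cases "d = 1")
    case False
    then have d: "2 \<le> real d" using assms(1) by auto
    have "(9 :: real) ^ d \<le> (2 ^ 4) ^ d" by (intro power_mono) auto
    also have "\<dots> = 2 ^ (4 * d)" by (rule power_mult[symmetric])
    also have "\<dots> \<le> real d ^ (4 * d)" using d by (intro power_mono) auto
    also have "\<dots> \<le> real d ^ (k * d)" using d assms(2) by (intro power_increasing) auto
    finally show ?thesis using zero_le_power[of "real d" "k * d"] by linarith
  qed simp
  then show ?thesis using 1 by linarith
qed

theorem theorem3p1:
  "\<exists>C::nat. C > 0 \<and>
     (\<forall>(d::nat) (\<rho>::real) (\<delta>::real). d > 0 \<longrightarrow> \<rho> \<in> {0..1} \<longrightarrow> \<delta> > 0 \<longrightarrow>
       (let D = nat \<lceil>real C * real d ^ (C * d) / \<delta> ^ 4\<rceil> in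
         \<forall>(N::nat) (A :: (nat \<Rightarrow> real) \<Rightarrow> real) (B :: (nat \<Rightarrow> real) \<Rightarrow> real).
           polynomial_on_Rn N A \<longrightarrow> multilinear N A \<longrightarrow> hermite_degree N A \<le> d \<longrightarrow>
           polynomial_on_Rn N B \<longrightarrow> multilinear N B \<longrightarrow> hermite_degree N B \<le> d \<longrightarrow>
           gaussian_norm N A \<le> 1 \<longrightarrow> gaussian_norm N B \<le> 1 \<longrightarrow>
           measure (gaussian_matrix N D)
             {M \<in> space (gaussian_matrix N D).
                \<bar>correlated_inner \<rho> D (compose_matrix N D M A) (compose_matrix N D M B)
                  - correlated_inner \<rho> N A B\<bar> < \<delta>} \<ge> 1 - \<delta>))"
proof (intro exI[of _ 4464] conjI allI impI, goal_cases)
  case (2 d \<rho> \<delta>)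
  \<comment> \<open>A single constant serves as factor and as exponent; its size comes from the
    factor, the exponent being only required to be at least 4.\<close>
  define L where "L = 4464 * real d ^ (4464 * d)"
  define D where "D = nat \<lceil>L / \<delta> ^ 4\<rceil>"
  have "0 < L / \<delta> ^ 4" using 2 by (simp add: L_def)
  then have D: "0 < D" "L / \<delta> ^ 4 \<le> real D"
    unfolding D_def by linarith+
  have "1 - \<delta> \<le> measure (gaussian_matrix N D)
      {M \<in> space (gaussian_matrix N D).
        \<bar>correlated_inner \<rho> D (compose_matrix N D M A) (compose_matrix N D M B) - correlated_inner \<rho> N A B\<bar> < \<delta>}"
    if A: "polynomial_on_Rn N A" "multilinear N A" "hermite_degree N A \<le> d"
      and B: "polynomial_on_Rn N B" "multilinear N B" "hermite_degree N B \<le> d"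
      and norm: "gaussian_norm N A \<le> 1" "gaussian_norm N B \<le> 1" for N A B
  proof (cases "\<delta> < 1")
    case False
    then have "1 - \<delta> \<le> 0" by simp
    then show ?thesis by (rule order_trans) simp
  next
    case True
    obtain f where f: "\<And>S. S \<subseteq> {..<N} \<Longrightarrow> f S \<noteq> 0 \<Longrightarrow> card S \<le> d"
      and Af: "\<And>x. x \<in> {..<N} \<rightarrow>\<^sub>E UNIV \<Longrightarrow> A x = mlpoly {..<N} f x"
      using multilinear_polynomialE[OF A] by blast
    obtain g where g: "\<And>S. S \<subseteq> {..<N} \<Longrightarrow> g S \<noteq> 0 \<Longrightarrow> card S \<le> d"
      and Bg: "\<And>x. x \<in> {..<N} \<rightarrow>\<^sub>E UNIV \<Longrightarrow> B x = mlpoly {..<N} g x"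
      using multilinear_polynomialE[OF B] by blast
    have norms: "(\<Sum>S\<in>Pow {..<N}. (f S)\<^sup>2) \<le> 1" "(\<Sum>S\<in>Pow {..<N}. (g S)\<^sup>2) \<le> 1"
      using norm gaussian_norm_mlpoly[of N A f, OF Af] gaussian_norm_mlpoly[of N B g, OF Bg] by auto
    define F where "F M = correlated_inner \<rho> D (compose_matrix N D M A) (compose_matrix N D M B)" for M
    define \<mu> where "\<mu> = correlated_inner \<rho> N A B"
    define G where "G = gaussian_matrix N D"
    have G: "G = gaussian_on ({..<N} \<times> {..<D})" by (simp add: G_def gaussian_matrix_def)
    interpret G: prob_space G unfolding G by (rule prob_space_gaussian_on)
    have F: "F = (\<lambda>M. \<Sum>p\<in>Pow {..<N} \<times> Pow {..<N}. f (fst p) * g (snd p) * avg {..<D} \<rho> p M)"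
      unfolding F_def[abs_def] by (simp add: correlated_inner_compose_matrix[OF Af Bg])
    have \<mu>: "\<mu> = (\<Sum>S\<in>Pow {..<N}. f S * g S * \<rho> ^ card S)"
      unfolding \<mu>_def by (rule correlated_inner_mlpoly[OF Af Bg])
    have \<rho>: "0 \<le> \<rho>" "\<rho> \<le> 1" using 2(2) by auto
    have "{..<D} \<noteq> {}" using D(1) by auto
    have err: "integrable G (\<lambda>M. (F M - \<mu>)\<^sup>2)"
      "(\<integral>M. (F M - \<mu>)\<^sup>2 \<partial>G) \<le> (240 * (real d)\<^sup>2 + 256 * 9 ^ d) / real D"
      "F \<in> borel_measurable G"
      using compressed_correlation_error[OF finite_lessThan finite_lessThan \<open>{..<D} \<noteq> {}\<close> \<rho> f norms(1) g norms(2)]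
      unfolding F \<mu> G by simp_all
    note [measurable] = err(3)
    \<comment> \<open>Markov's inequality for the square. Dividing by
      \<open>\<delta>\<^sup>2\<close> leaves \<delta> provided the integral is at most
      \<open>\<delta> ^ 3\<close>, which \<delta> < 1 and the fourth power in \<open>D\<close>
      guarantee.\<close>
    have "measure G {M \<in> space G. \<delta>\<^sup>2 \<le> (F M - \<mu>)\<^sup>2} \<le> (\<integral>M. (F M - \<mu>)\<^sup>2 \<partial>G) / \<delta>\<^sup>2"
      using 2(3) err(1) by (intro integral_Markov_inequality_measure[where A="{}"]) auto
    also have "\<dots> \<le> \<delta>"
    proof -
      have "L \<le> real D * \<delta> ^ 4"
        using D(2) 2(3) by (simp add: pos_divide_le_eq)
      also have "\<dots> \<le> real D * \<delta> ^ 3"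
        using True 2(3) by (intro mult_left_mono power_decreasing) auto
      finally have "L / real D \<le> \<delta> ^ 3"
        using D(1) by (simp add: pos_divide_le_eq mult.commute)
      moreover have "(\<integral>M. (F M - \<mu>)\<^sup>2 \<partial>G) \<le> L / real D"
      proof -
        have "(240 * (real d)\<^sup>2 + 256 * 9 ^ d) / real D \<le> L / real D"
          unfolding L_def by (intro divide_right_mono dimension_bound 2(1)) auto
        then show ?thesis using err(2) by simp
      qed
      ultimately have "(\<integral>M. (F M - \<mu>)\<^sup>2 \<partial>G) \<le> \<delta> * \<delta>\<^sup>2"
        by (simp add: power3_eq_cube power2_eq_square)
      then show ?thesis using 2(3) by (simp add: pos_divide_le_eq)
    qed
    finally have bad: "measure G {M \<in> space G. \<delta>\<^sup>2 \<le> (F M - \<mu>)\<^sup>2} \<le> \<delta>" .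
    have iff: "\<bar>F M - \<mu>\<bar> < \<delta> \<longleftrightarrow> \<not> \<delta>\<^sup>2 \<le> (F M - \<mu>)\<^sup>2" for M
      using abs_le_square_iff[of \<delta> "F M - \<mu>"] 2(3) by auto
    have "measure G {M \<in> space G. \<bar>F M - \<mu>\<bar> < \<delta>} = measure G (space G - {M \<in> space G. \<delta>\<^sup>2 \<le> (F M - \<mu>)\<^sup>2})"
      unfolding iff by (rule arg_cong[where f="measure G"]) auto
    also have "\<dots> = 1 - measure G {M \<in> space G. \<delta>\<^sup>2 \<le> (F M - \<mu>)\<^sup>2}"
      by (rule G.prob_compl) measurable
    finally show ?thesis
      using bad unfolding F_def \<mu>_def G_def by simp
  qed
  then show ?case by (simp add: D_def L_def Let_def)
qed simp

end
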